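(* Let $X$ be the homogeneous diffusion with coefficients $a,b$ described in the context, and assume $\Phi(0,+\infty)<+\infty$ and $\Phi(0,-\infty)=-\infty$. Let $f:\mathbb{R}\to\mathbb{R}$ be a measurable function such that $f$ and $f/a^2$ are locally integrable, and assume that $$P_0=2\sup_{x\in\mathbb{R}}\left(\int_x^{+\infty}\frac{|f(u)|}{a(u)^2}\Phi(u,+\infty)\,du+\Phi(x,+\infty)\int_{-\infty}^x\frac{|f(u)|}{a(u)^2}\varphi(u,x)\,du\right)<\infty.$$ Then for every $x\in\mathbb{R}$ and every $\lambda$ with $0\le\lambda<P_0^{-1}$ (where $P_0^{-1}=+\infty$ if $P_0=0$) $$\mathsf{E}\left[\exp\left(\lambda J^x_\infty(f)\right)\right]\le\frac{1}{1-\lambda P_0}.$$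
   Context: On a complete filtered probability space $(\Omega,\mathcal{F},\{\mathcal{F}_t\}_{t\ge0},\mathsf{P})$ with a standard $\mathcal{F}_t$-Wiener process $W$, consider the family $\{X^x_t,\,t\ge 0,\,x\in\mathbb{R}\}$ of one-dimensional homogeneous diffusion processes $$dX^x_t=b(X^x_t)\,dt+a(X^x_t)\,dW_t,\quad t\ge 0,\qquad X_0^x=x.$$ The coefficients $a,b:\mathbb{R}\to\mathbb{R}$ are continuous, $a(x)\ne 0$ for all $x\in\mathbb{R}$, and they are such that a non-explosive weak solution on $\mathbb{R}$ exists. Define $\varphi(x_0,x)=\exp\left\{-2\int_{x_0}^{x}\frac{b(u)}{a(u)^2}\,du\right\}$ and $\Phi(x_0,x)=\int_{x_0}^x\varphi(x_0,z)\,dz$ for $x_0,x\in\mathbb{R}$, and $\Phi(x_0,\pm\infty)=\lim_{x\to\pm\infty}\Phi(x_0,x)$. Integral functional: $J^x_\infty(f)=\int_0^\infty f(X^x_s)\,ds$. *)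

theory Defs
  imports "HOL-Probability.Probability"
begin

section \<open>Filtered probability spaces and Wiener processes\<close>

text \<open>
  The filtration is indexed by all reals; only the times \<open>t \<ge> 0\<close> are used below, and a filtration
  on \<open>[0, \<infinity>)\<close> is extended by the value at \<open>0\<close>. Right-continuity is not required.
\<close>

locale complete_filtered_prob_space = prob_space M + filtration "space M" F
  for M :: "'w measure" and F :: "real \<Rightarrow> 'w measure" +
  assumes subalgebra_F: "\<And>t. subalgebra M (F t)"
    and complete_M: "\<And>A B. A \<in> null_sets M \<Longrightarrow> B \<subseteq> A \<Longrightarrow> B \<in> sets M"
    and null_sets_F: "null_sets M \<subseteq> sets (F 0)"

definition adapted :: "(real \<Rightarrow> 'w measure) \<Rightarrow> (real \<Rightarrow> 'w \<Rightarrow> real) \<Rightarrow> bool" where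
  "adapted F Y \<longleftrightarrow> (\<forall>t\<ge>0. Y t \<in> borel_measurable (F t))"

definition continuous_paths :: "'w measure \<Rightarrow> (real \<Rightarrow> 'w \<Rightarrow> real) \<Rightarrow> bool" where
  "continuous_paths M Y \<longleftrightarrow> (AE \<omega> in M. continuous_on {0..} (\<lambda>t. Y t \<omega>))"

definition wiener_process ::
    "'w measure \<Rightarrow> (real \<Rightarrow> 'w measure) \<Rightarrow> (real \<Rightarrow> 'w \<Rightarrow> real) \<Rightarrow> bool" where
  "wiener_process M F W \<longleftrightarrow>
     adapted F W \<and> continuous_paths M W \<and> (AE \<omega> in M. W 0 \<omega> = 0) \<and>
     (\<forall>s t. 0 \<le> s \<and> s < t \<longrightarrow>
        prob_space.indep_set M (sets (F s))
          {(\<lambda>\<omega>. W t \<omega> - W s \<omega>) -` B \<inter> space M | B. B \<in> sets borel} \<and>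
        distributed M lborel (\<lambda>\<omega>. W t \<omega> - W s \<omega>)
          (\<lambda>y. ennreal (normal_density 0 (sqrt (t - s)) y)))"

section \<open>The It\^{o} integral\<close>

text \<open>
  A simple integrand \<open>(n, \<tau>, \<xi>)\<close> stands for the process
  \<open>\<Sum>i<n. \<xi>\<^sub>i 1\<^bsub>(\<tau>\<^sub>i, \<tau>\<^sub>i\<^sub>+\<^sub>1]\<^esub>\<close>
  with bounded \<open>\<xi>\<^sub>i\<close> measurable at time \<open>\<tau>\<^sub>i\<close>.
\<close>

definition simple_integrand ::
    "'w measure \<Rightarrow> (real \<Rightarrow> 'w measure) \<Rightarrow> nat \<Rightarrow> (nat \<Rightarrow> real) \<Rightarrow> (nat \<Rightarrow> 'w \<Rightarrow> real) \<Rightarrow> bool" where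
  "simple_integrand M F n \<tau> \<xi> \<longleftrightarrow>
     0 \<le> \<tau> 0 \<and>
     (\<forall>i<n. \<tau> i \<le> \<tau> (Suc i) \<and> \<xi> i \<in> borel_measurable (F (\<tau> i)) \<and>
            (\<exists>C. \<forall>\<omega>\<in>space M. \<bar>\<xi> i \<omega>\<bar> \<le> C))"

definition simple_process ::
    "nat \<Rightarrow> (nat \<Rightarrow> real) \<Rightarrow> (nat \<Rightarrow> 'w \<Rightarrow> real) \<Rightarrow> real \<Rightarrow> 'w \<Rightarrow> real" where
  "simple_process n \<tau> \<xi> s \<omega> = (\<Sum>i<n. \<xi> i \<omega> * indicator {\<tau> i<..\<tau> (Suc i)} s)"

definition simple_ito_integral ::
    "(real \<Rightarrow> 'w \<Rightarrow> real) \<Rightarrow> nat \<Rightarrow> (nat \<Rightarrow> real) \<Rightarrow> (nat \<Rightarrow> 'w \<Rightarrow> real) \<Rightarrow> real \<Rightarrow> 'w \<Rightarrow> real" where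
  "simple_ito_integral W n \<tau> \<xi> t \<omega> =
     (\<Sum>i<n. \<xi> i \<omega> * (W (min t (\<tau> (Suc i))) \<omega> - W (min t (\<tau> i)) \<omega>))"

definition tendsto_zero_in_prob :: "'w measure \<Rightarrow> (nat \<Rightarrow> 'w \<Rightarrow> ennreal) \<Rightarrow> bool" where
  "tendsto_zero_in_prob M Y \<longleftrightarrow>
     (\<forall>k. Y k \<in> borel_measurable M) \<and>
     (\<forall>\<epsilon>>0. (\<lambda>k. measure M {\<omega> \<in> space M. Y k \<omega> > \<epsilon>}) \<longlonglongrightarrow> 0)"

text \<open>
  \<open>is_ito_integral M F W H I\<close>: the process \<open>I\<close> is a continuous version of
  \<open>\<integral>\<^sub>0\<^sup>\<cdot> H dW\<close>. For every \<open>T\<close>, the value \<open>I T\<close> is the limit in probability of the integrals of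
  simple integrands that converge to \<open>H\<close> in \<open>L\<^sup>2[0,T]\<close> in probability; by the It\^{o} isometry the
  limit does not depend on the approximating sequence, so \<open>I\<close> is unique up to
  indistinguishability. No progressive measurability of \<open>H\<close> is demanded separately: an adapted
  process that admits such approximations agrees almost everywhere with a predictable one.
\<close>

definition is_ito_integral ::
    "'w measure \<Rightarrow> (real \<Rightarrow> 'w measure) \<Rightarrow> (real \<Rightarrow> 'w \<Rightarrow> real) \<Rightarrow>
     (real \<Rightarrow> 'w \<Rightarrow> real) \<Rightarrow> (real \<Rightarrow> 'w \<Rightarrow> real) \<Rightarrow> bool" where
  "is_ito_integral M F W H I \<longleftrightarrow>
     adapted F H \<and>
     (AE \<omega> in M. \<forall>T\<ge>0. set_borel_measurable lborel {0..T} (\<lambda>s. H s \<omega>) \<and>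
                        (\<integral>\<^sup>+s\<in>{0..T}. ennreal ((H s \<omega>)\<^sup>2) \<partial>lborel) < \<infinity>) \<and>
     adapted F I \<and> continuous_paths M I \<and>
     (\<forall>T\<ge>0. \<exists>n \<tau> \<xi>.
        (\<forall>k. simple_integrand M F (n k) (\<tau> k) (\<xi> k)) \<and>
        tendsto_zero_in_prob M
          (\<lambda>k \<omega>. \<integral>\<^sup>+s\<in>{0..T}. ennreal ((simple_process (n k) (\<tau> k) (\<xi> k) s \<omega> - H s \<omega>)\<^sup>2) \<partial>lborel) \<and>
        tendsto_zero_in_prob M
          (\<lambda>k \<omega>. ennreal \<bar>simple_ito_integral W (n k) (\<tau> k) (\<xi> k) T \<omega> - I T \<omega>\<bar>))"

section \<open>The diffusion\<close>

text \<open>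
  Since \<open>Y t \<omega>\<close> is a real number for every \<open>t \<ge> 0\<close>, solutions are non-explosive by construction.
\<close>

definition sde_solution ::
    "'w measure \<Rightarrow> (real \<Rightarrow> 'w measure) \<Rightarrow> (real \<Rightarrow> 'w \<Rightarrow> real) \<Rightarrow>
     (real \<Rightarrow> real) \<Rightarrow> (real \<Rightarrow> real) \<Rightarrow> real \<Rightarrow> (real \<Rightarrow> 'w \<Rightarrow> real) \<Rightarrow> bool" where
  "sde_solution M F W a b x Y \<longleftrightarrow>
     adapted F Y \<and> continuous_paths M Y \<and> (AE \<omega> in M. Y 0 \<omega> = x) \<and>
     (\<exists>I. is_ito_integral M F W (\<lambda>s \<omega>. a (Y s \<omega>)) I \<and>
          (AE \<omega> in M. \<forall>t\<ge>0. set_integrable lborel {0..t} (\<lambda>s. b (Y s \<omega>)) \<and>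
             Y t \<omega> = x + (\<integral>s\<in>{0..t}. b (Y s \<omega>) \<partial>lborel) + I t \<omega>))"

definition phi :: "(real \<Rightarrow> real) \<Rightarrow> (real \<Rightarrow> real) \<Rightarrow> real \<Rightarrow> real \<Rightarrow> real" where
  "phi a b x0 x = exp (- 2 * (LBINT u=ereal x0..ereal x. b u / (a u)\<^sup>2))"

definition Phi :: "(real \<Rightarrow> real) \<Rightarrow> (real \<Rightarrow> real) \<Rightarrow> real \<Rightarrow> real \<Rightarrow> real" where
  "Phi a b x0 x = (LBINT z=ereal x0..ereal x. phi a b x0 z)"

text \<open>
  \<open>Phi a b x0\<close> is increasing, so the following limits always exist in the extended reals.
\<close>

definition Phi_top :: "(real \<Rightarrow> real) \<Rightarrow> (real \<Rightarrow> real) \<Rightarrow> real \<Rightarrow> ereal" where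
  "Phi_top a b x0 = Lim at_top (\<lambda>x. ereal (Phi a b x0 x))"

definition Phi_bot :: "(real \<Rightarrow> real) \<Rightarrow> (real \<Rightarrow> real) \<Rightarrow> real \<Rightarrow> ereal" where
  "Phi_bot a b x0 = Lim at_bot (\<lambda>x. ereal (Phi a b x0 x))"

definition locally_integrable :: "(real \<Rightarrow> real) \<Rightarrow> bool" where
  "locally_integrable g \<longleftrightarrow> (\<forall>K. compact K \<longrightarrow> set_integrable lborel K g)"

definition J_infinity :: "(real \<Rightarrow> real) \<Rightarrow> (real \<Rightarrow> 'w \<Rightarrow> real) \<Rightarrow> 'w \<Rightarrow> real" where
  "J_infinity f Y \<omega> = (\<integral>s\<in>{0..}. f (Y s \<omega>) \<partial>lborel)"

definition P0 :: "(real \<Rightarrow> real) \<Rightarrow> (real \<Rightarrow> real) \<Rightarrow> (real \<Rightarrow> real) \<Rightarrow> ennreal" where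
  "P0 a b f = 2 * (SUP x::real.
     (\<integral>\<^sup>+u\<in>{x..}. ennreal (\<bar>f u\<bar> / (a u)\<^sup>2) * e2ennreal (Phi_top a b u) \<partial>lborel)
     + e2ennreal (Phi_top a b x) *
       (\<integral>\<^sup>+u\<in>{..x}. ennreal (\<bar>f u\<bar> / (a u)\<^sup>2 * phi a b u x) \<partial>lborel))"

end

theory Submission
  imports Defs
begin

text \<open>
  Let \<open>G(x) = \<integral> k(x, u) \<bar>f(u)\<bar> du\<close> with the Green kernel \<open>k\<close> of the diffusion, so that \<open>0 \<le> G \<le> P0\<close> and
  \<open>a\<^sup>2 G'' / 2 + b G' = - \<bar>f\<bar>\<close>. It\^{o}'s formula would make \<open>G(X\<^sub>t) + A\<^sub>t\<close> with
  \<open>A\<^sub>t = \<integral>\<^sub>0\<^sup>t \<bar>f(X\<^sub>s)\<bar> ds\<close> a local martingale, whence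
  \<open>E[Z (A\<^sub>T - A\<^sub>s)] \<le> E[Z G(X\<^sub>s)] \<le> P0 E[Z]\<close> for bounded \<open>Z \<ge> 0\<close> known at time \<open>s\<close>; no Markov property is
  needed.

  For continuous \<open>f\<close> the first inequality is obtained from a Taylor expansion along an Euler scheme, which
  approximates \<open>X\<close> because the It\^{o} integral is a limit of integrals of simple integrands. Both sides
  are integrals of \<open>\<bar>f\<bar>\<close> with respect to measures on the line, and outer regularity carries the
  inequality over to measurable \<open>f\<close>.

  Finally, with \<open>e\<^sub>s = exp (c A\<^sub>s)\<close>, integration by parts gives
  \<open>e\<^sub>T - 1 = c A\<^sub>T + c \<integral>\<^sub>0\<^sup>T (A\<^sub>T - A\<^sub>s) de\<^sub>s\<close>. Taking expectations, the right-hand side is at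
  most \<open>c P0 E[e\<^sub>T]\<close>, that is, \<open>E[e\<^sub>T] \<le> 1 / (1 - c P0)\<close>; the argument is run on a time grid
  with \<open>f\<close> truncated, and \<open>T\<close> tends to infinity.
\<close>

text \<open>Only one inequality of Dynkin's formula is needed. The value of the test function at the
  final time is nonnegative and is dropped, so it suffices to have bounded, twice differentiable
  functions below the Green potential that solve the generator equation on a bounded range; the path
  is confined to that range, and the confinement is removed by monotone convergence.

  The Ito integral is given only through limits in probability, and the coefficients are merely
  continuous, so the Euler scheme is close to \<open>X\<close> in probability only, without a rate.
  Test functions with bounded derivatives tolerate this: an exceptional event contributes at most a
  fixed multiple of its probability.

  For discontinuous \<open>f\<close> the potential need not have a continuous second derivative;
  hence the Taylor argument is kept to continuous functions.

  The closing inequality \<open>E[e_T] - 1 \<le> c P0 E[e_T]\<close> says nothing if the expectation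
  is infinite. Truncating \<open>f\<close> and the time horizon makes it finite before it is solved
  for.\<close>

lemma taylor2_remainder_bound:
  fixes h h1 h2 :: "real \<Rightarrow> real"
  assumes d1: "\<And>x. (h has_real_derivative h1 x) (at x)"
    and d2: "\<And>x. (h1 has_real_derivative h2 x) (at x)"
    and uc: "uniformly_continuous_on UNIV h2"
    and bd: "\<And>x. \<bar>h2 x\<bar> \<le> B" and \<eta>: "\<eta> > 0"
  obtains C where "C \<ge> 0" "\<And>y d. h (y + d) - h y \<le> h1 y * d + h2 y * d\<^sup>2 / 2 + \<eta> * d\<^sup>2 + C * d ^ 4"
proof -
  \<comment> \<open>The oscillation \<open>2 * \<eta>\<close> is halved by the factor 1/2 of the
    Taylor remainder, which leaves the coefficient \<open>\<eta>\<close>.\<close>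
  obtain \<delta> where \<delta>: "\<delta> > 0" "\<And>u v. dist u v < \<delta> \<Longrightarrow> dist (h2 u) (h2 v) < 2 * \<eta>"
    using uc \<eta> unfolding uniformly_continuous_on_def by (metis UNIV_I mult_pos_pos zero_less_numeral)
  have B: "B \<ge> 0" using bd[of 0] by linarith
  have main: "h (y + d) - h y \<le> h1 y * d + h2 y * d\<^sup>2 / 2 + \<eta> * d\<^sup>2 + B / \<delta>\<^sup>2 * d ^ 4" for y d
  proof (cases "d = 0")
    case False
    define diff where "diff = (\<lambda>m::nat. if m = 0 then h else if m = 1 then h1 else h2)"
    have "\<exists>t. (if y + d < y then y + d < t \<and> t < y else y < t \<and> t < y + d) \<and>
       h (y + d) = (\<Sum>m<2. diff m y / fact m * (y + d - y) ^ m) + diff 2 t / fact 2 * (y + d - y) ^ 2"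
      by (rule Taylor[where a = "min y (y + d)" and b = "max y (y + d)"])
        (use False d1 d2 in \<open>auto simp: diff_def less_Suc_eq numeral_2_eq_2\<close>)
    then obtain t where t: "if d < 0 then y + d < t \<and> t < y else y < t \<and> t < y + d"
      "h (y + d) = h y + h1 y * d + h2 t / 2 * d\<^sup>2"
      by (auto simp: diff_def numeral_2_eq_2)
    have td: "\<bar>t - y\<bar> \<le> \<bar>d\<bar>" using t(1) by (auto split: if_splits)
    have eq: "h (y + d) - h y = h1 y * d + h2 y * d\<^sup>2 / 2 + (h2 t - h2 y) / 2 * d\<^sup>2"
      using t(2) by (simp add: field_simps)
    show ?thesis
    proof (cases "\<bar>d\<bar> < \<delta>")
      case True
      then have "\<bar>h2 t - h2 y\<bar> < 2 * \<eta>" using \<delta>(2)[of t y] td by (simp add: dist_real_def)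
      then have "(h2 t - h2 y) / 2 * d\<^sup>2 \<le> \<eta> * d\<^sup>2"
        by (intro mult_right_mono) auto
      moreover have "0 \<le> B / \<delta>\<^sup>2 * d ^ 4" using B by simp
      ultimately show ?thesis using eq by linarith
    next
      case False
      have "(h2 t - h2 y) / 2 \<le> B" using bd[of t] bd[of y] by (simp add: abs_le_iff)
      then have "(h2 t - h2 y) / 2 * d\<^sup>2 \<le> B * d\<^sup>2" by (intro mult_right_mono) auto
      \<comment> \<open>For increments of size at least \<open>\<delta>\<close> the crude bound
        \<open>B\<close> on the coefficient of the square is paid for by a fourth power. This is
        affordable: the fourth moment of a Wiener increment is quadratic in time and vanishes when
        summed over a fine grid.\<close>
      also have "\<dots> \<le> B * (d\<^sup>2 * (d\<^sup>2 / \<delta>\<^sup>2))"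
      proof -
        have "\<delta>\<^sup>2 \<le> d\<^sup>2" using False \<delta>(1) by (metis linorder_not_less power2_abs power_mono less_imp_le)
        then have "1 \<le> d\<^sup>2 / \<delta>\<^sup>2" using \<delta>(1) by (simp add: field_simps)
        then have "d\<^sup>2 * 1 \<le> d\<^sup>2 * (d\<^sup>2 / \<delta>\<^sup>2)" by (intro mult_left_mono) auto
        then show ?thesis using B by (intro mult_left_mono) auto
      qed
      also have "\<dots> = B / \<delta>\<^sup>2 * d ^ 4" by (simp add: power4_eq_xxxx power2_eq_square)
      finally have "(h2 t - h2 y) / 2 * d\<^sup>2 \<le> B / \<delta>\<^sup>2 * d ^ 4" .
      moreover have "0 \<le> \<eta> * d\<^sup>2" using \<eta> by simp
      ultimately show ?thesis using eq by linarith
    qed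
  qed simp
  show thesis by (rule that[OF _ main]) (use B in simp)
qed

lemma (in finite_measure) integrable_power_bounded:
  fixes U :: "'a \<Rightarrow> real"
  assumes "U \<in> borel_measurable M" "\<And>\<omega>. \<omega> \<in> space M \<Longrightarrow> \<bar>U \<omega>\<bar> \<le> C"
  shows "integrable M (\<lambda>\<omega>. U \<omega> ^ k)"
proof (rule integrable_const_bound)
  show "AE \<omega> in M. norm (U \<omega> ^ k) \<le> C ^ k"
    using assms(2) by (intro AE_I2) (simp add: power_abs power_mono)
qed (use assms in simp)

section \<open>Wiener increments and simple integrals\<close>

locale wiener_space = complete_filtered_prob_space M F
  for M :: "'w measure" and F :: "real \<Rightarrow> 'w measure" +
  fixes W :: "real \<Rightarrow> 'w \<Rightarrow> real"
  assumes W: "wiener_process M F W"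
begin

lemma measurable_F_M: "U \<in> measurable (F s) N \<Longrightarrow> U \<in> measurable M N"
  by (rule measurable_from_subalg[OF subalgebra_F])

lemma measurable_F_mono: "s \<le> t \<Longrightarrow> U \<in> measurable (F s) N \<Longrightarrow> U \<in> measurable (F t) N"
  by (rule measurable_from_subalg[where M = "F t"]) (auto simp: subalgebra_def space_F sets_F_mono)

lemma W_measurable: "0 \<le> s \<Longrightarrow> s \<le> t \<Longrightarrow> W s \<in> borel_measurable (F t)"
  using W by (auto simp: wiener_process_def adapted_def intro: measurable_F_mono)

lemma W_borel [measurable]: "0 \<le> s \<Longrightarrow> W s \<in> borel_measurable M"
  using W_measurable measurable_F_M by blast

text \<open>The preimages of Borel sets under the increment already form a sigma-algebra, and the
  sigma-algebra generated by \<open>U\<close> is contained in \<open>F s\<close>. The independence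
  of set systems in \<open>wiener_process\<close> therefore restricts to independence of random
  variables, the form in which expectations of products factor.\<close>

lemma increment_indep:
  assumes "0 \<le> s" "s < t" and U: "U \<in> borel_measurable (F s)"
  shows "indep_var borel U borel (\<lambda>\<omega>. W t \<omega> - W s \<omega>)"
proof -
  let ?V = "\<lambda>\<omega>. W t \<omega> - W s \<omega>"
  have i: "indep_set (sets (F s)) {?V -` B \<inter> space M | B. B \<in> sets borel}"
    using W assms by (auto simp: wiener_process_def)
  have sub: "sigma_sets (space M) {U -` A \<inter> space M | A. A \<in> sets borel} \<subseteq> sets (F s)"
    using sets.sigma_sets_subset[of "{U -` A \<inter> space M | A. A \<in> sets borel}" "F s"]
      measurable_sets[OF U] by (auto simp: space_F)
  have sg: "sigma_sets (space M) {?V -` A \<inter> space M | A. A \<in> sets borel}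
      = {?V -` A \<inter> space M | A. A \<in> sets borel}"
    using sigma_algebra.sigma_sets_eq[OF sets.sigma_algebra_axioms, of "vimage_algebra (space M) ?V borel"]
    by (simp add: sets_vimage_algebra2)
  show ?thesis
    unfolding indep_var_eq
  proof (intro conjI)
    show "indep_set (sigma_sets (space M) {U -` A \<inter> space M |A. A \<in> sets borel})
     (sigma_sets (space M) {?V -` A \<inter> space M |A. A \<in> sets borel})"
      unfolding sg using i sub unfolding indep_set_def
      by (elim indep_sets_mono_sets) (auto split: bool.splits)
  qed (use assms measurable_F_M in \<open>auto intro!: W_borel borel_measurable_diff\<close>)
qed

lemma increment_moments:
  assumes "0 \<le> s" "s < t"
  shows "has_bochner_integral M (\<lambda>\<omega>. W t \<omega> - W s \<omega>) 0"
    "has_bochner_integral M (\<lambda>\<omega>. (W t \<omega> - W s \<omega>)\<^sup>2) (t - s)"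
    "has_bochner_integral M (\<lambda>\<omega>. (W t \<omega> - W s \<omega>) ^ 4) (3 * (t - s)\<^sup>2)"
proof -
  let ?V = "\<lambda>\<omega>. W t \<omega> - W s \<omega>"
  have D: "distributed M lborel ?V (\<lambda>y. ennreal (normal_density 0 (sqrt (t - s)) y))"
    using W assms by (auto simp: wiener_process_def)
  have pos: "0 < sqrt (t - s)" using assms by simp
  have tr: "has_bochner_integral M (\<lambda>\<omega>. g (?V \<omega>)) c"
    if "has_bochner_integral lborel (\<lambda>x. normal_density 0 (sqrt (t - s)) x * g x) c"
      "g \<in> borel_measurable borel" for g :: "real \<Rightarrow> real" and c
    using that distributed_integrable[OF D, of g] distributed_integral[OF D, of g]
    by (simp add: has_bochner_integral_iff)
  show "has_bochner_integral M ?V 0"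
    using tr[of "\<lambda>x. x" 0] normal_moment_odd[OF pos, of 0 0] by simp
  have f4: "fact 4 = (24::real)" by (simp add: fact_numeral)
  show "has_bochner_integral M (\<lambda>\<omega>. (?V \<omega>)\<^sup>2) (t - s)"
    using tr[of "\<lambda>x. x\<^sup>2" "t - s"] normal_moment_even[OF pos, of 0 1] assms
    by (simp add: diff_divide_distrib)
  show "has_bochner_integral M (\<lambda>\<omega>. (?V \<omega>) ^ 4) (3 * (t - s)\<^sup>2)"
    using tr[of "\<lambda>x. x ^ 4" "3 * (t - s)\<^sup>2"] normal_moment_even[OF pos, of 0 2] assms
    by (simp add: f4 power_divide fact_numeral field_simps)
qed

lemma increment_product:
  assumes "0 \<le> s" "s \<le> t" and U: "U \<in> borel_measurable (F s)" "integrable M U"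
  shows "has_bochner_integral M (\<lambda>\<omega>. U \<omega> * (W t \<omega> - W s \<omega>)) 0"
    "has_bochner_integral M (\<lambda>\<omega>. U \<omega> * (W t \<omega> - W s \<omega>)\<^sup>2) ((t - s) * expectation U)"
    "has_bochner_integral M (\<lambda>\<omega>. U \<omega> * (W t \<omega> - W s \<omega>) ^ 4) (3 * (t - s)\<^sup>2 * expectation U)"
proof -
  have *: "has_bochner_integral M (\<lambda>\<omega>. U \<omega> * g (W t \<omega> - W s \<omega>)) (c * expectation U)"
    if "has_bochner_integral M (\<lambda>\<omega>. g (W t \<omega> - W s \<omega>)) c" "s < t" and g: "g \<in> borel_measurable borel"
    for g :: "real \<Rightarrow> real" and c
  proof -
    have "indep_var borel ((\<lambda>x. x) \<circ> U) borel (g \<circ> (\<lambda>\<omega>. W t \<omega> - W s \<omega>))"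
      by (rule indep_var_compose[OF increment_indep]) (use assms that in auto)
    then have i: "indep_var borel U borel (\<lambda>\<omega>. g (W t \<omega> - W s \<omega>))" by (simp add: comp_def)
    show ?thesis
      using indep_var_lebesgue_integral[OF i U(2)] indep_var_integrable[OF i U(2)] that
      by (simp add: has_bochner_integral_iff)
  qed
  \<comment> \<open>For \<open>s = t\<close> the increment and all three right-hand sides vanish.
    The case does occur, because a grid stopped at a fixed time repeats that time.\<close>
  have "s = t \<or> s < t" using assms by auto
  then show "has_bochner_integral M (\<lambda>\<omega>. U \<omega> * (W t \<omega> - W s \<omega>)) 0"
    "has_bochner_integral M (\<lambda>\<omega>. U \<omega> * (W t \<omega> - W s \<omega>)\<^sup>2) ((t - s) * expectation U)"
    "has_bochner_integral M (\<lambda>\<omega>. U \<omega> * (W t \<omega> - W s \<omega>) ^ 4) (3 * (t - s)\<^sup>2 * expectation U)"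
    using *[of "\<lambda>x. x" 0] *[of "\<lambda>x. x\<^sup>2" "t - s"] *[of "\<lambda>x. x ^ 4" "3 * (t - s)\<^sup>2"]
      increment_moments[OF assms(1), of t]
    by (auto simp: has_bochner_integral_zero)
qed

text \<open>Induction on the number of steps. In the square of the next partial sum, the cross term
  carries a coefficient known at the left endpoint and has mean zero; the diagonal term contributes
  the length of the step times a second moment. Measurability of the partial sum is part of the
  induction because the cross term needs it.\<close>

lemma step_integral_isometry:
  fixes q :: "nat \<Rightarrow> real" and \<xi> :: "nat \<Rightarrow> 'w \<Rightarrow> real"
  assumes q: "0 \<le> q 0" "\<And>i. i < n \<Longrightarrow> q i \<le> q (Suc i)"
    and \<xi>: "\<And>i. i < n \<Longrightarrow> \<xi> i \<in> borel_measurable (F (q i))"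
    and bd: "\<And>i. i < n \<Longrightarrow> \<exists>C. \<forall>\<omega>\<in>space M. \<bar>\<xi> i \<omega>\<bar> \<le> C"
  defines "S \<equiv> \<lambda>n \<omega>. \<Sum>i<n. \<xi> i \<omega> * (W (q (Suc i)) \<omega> - W (q i) \<omega>)"
  shows "0 \<le> q n \<and> S n \<in> borel_measurable (F (q n)) \<and>
    has_bochner_integral M (\<lambda>\<omega>. (S n \<omega>)\<^sup>2) (\<Sum>i<n. (q (Suc i) - q i) * expectation (\<lambda>\<omega>. (\<xi> i \<omega>)\<^sup>2))"
  using q \<xi> bd
proof (induction n)
  case 0
  then show ?case by (simp add: S_def has_bochner_integral_zero)
next
  case (Suc n)
  let ?V = "\<lambda>\<omega>. W (q (Suc n)) \<omega> - W (q n) \<omega>"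
  have IH: "0 \<le> q n" "S n \<in> borel_measurable (F (q n))"
    "has_bochner_integral M (\<lambda>\<omega>. (S n \<omega>)\<^sup>2) (\<Sum>i<n. (q (Suc i) - q i) * expectation (\<lambda>\<omega>. (\<xi> i \<omega>)\<^sup>2))"
    using Suc by auto
  have qn: "q n \<le> q (Suc n)" and \<xi>n: "\<xi> n \<in> borel_measurable (F (q n))" using Suc.prems by auto
  have \<xi>M: "\<xi> n \<in> borel_measurable M" and SM: "S n \<in> borel_measurable M"
    using \<xi>n IH measurable_F_M by auto
  obtain C where C: "\<And>\<omega>. \<omega> \<in> space M \<Longrightarrow> \<bar>\<xi> n \<omega>\<bar> \<le> C" using Suc.prems(4)[of n] by auto
  have iS: "integrable M (S n)"
    by (rule square_integrable_imp_integrable) (use IH(3) SM in \<open>auto simp: has_bochner_integral_iff\<close>)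
  have i1: "integrable M (\<lambda>\<omega>. 2 * S n \<omega> * \<xi> n \<omega>)"
  proof (rule Bochner_Integration.integrable_bound[of _ "\<lambda>\<omega>. 2 * C * \<bar>S n \<omega>\<bar>"])
    show "AE \<omega> in M. norm (2 * S n \<omega> * \<xi> n \<omega>) \<le> norm (2 * C * \<bar>S n \<omega>\<bar>)"
    proof (rule AE_I2)
      fix \<omega> assume "\<omega> \<in> space M"
      then have "\<bar>\<xi> n \<omega>\<bar> \<le> \<bar>C\<bar>" using C[of \<omega>] by linarith
      then have "\<bar>S n \<omega>\<bar> * \<bar>\<xi> n \<omega>\<bar> \<le> \<bar>S n \<omega>\<bar> * \<bar>C\<bar>"
        by (intro mult_left_mono) auto
      then show "norm (2 * S n \<omega> * \<xi> n \<omega>) \<le> norm (2 * C * \<bar>S n \<omega>\<bar>)"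
        by (simp add: abs_mult mult.commute)
    qed
  qed (use iS SM \<xi>M in auto)
  have i2: "integrable M (\<lambda>\<omega>. (\<xi> n \<omega>)\<^sup>2)"
    using \<xi>M C by (rule integrable_power_bounded)
  have a1: "has_bochner_integral M (\<lambda>\<omega>. 2 * S n \<omega> * \<xi> n \<omega> * ?V \<omega>) 0"
    using increment_product(1)[OF IH(1) qn, of "\<lambda>\<omega>. 2 * S n \<omega> * \<xi> n \<omega>"] i1 IH(2) \<xi>n by auto
  have a2: "has_bochner_integral M (\<lambda>\<omega>. (\<xi> n \<omega>)\<^sup>2 * (?V \<omega>)\<^sup>2) ((q (Suc n) - q n) * expectation (\<lambda>\<omega>. (\<xi> n \<omega>)\<^sup>2))"
    using increment_product(2)[OF IH(1) qn, of "\<lambda>\<omega>. (\<xi> n \<omega>)\<^sup>2"] i2 \<xi>n by auto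
  have SS: "(\<lambda>\<omega>. (S (Suc n) \<omega>)\<^sup>2) = (\<lambda>\<omega>. (S n \<omega>)\<^sup>2 + 2 * S n \<omega> * \<xi> n \<omega> * ?V \<omega> + (\<xi> n \<omega>)\<^sup>2 * (?V \<omega>)\<^sup>2)"
    by (auto simp: S_def power2_eq_square algebra_simps)
  have "has_bochner_integral M (\<lambda>\<omega>. (S (Suc n) \<omega>)\<^sup>2)
      ((\<Sum>i<n. (q (Suc i) - q i) * expectation (\<lambda>\<omega>. (\<xi> i \<omega>)\<^sup>2)) + 0 + (q (Suc n) - q n) * expectation (\<lambda>\<omega>. (\<xi> n \<omega>)\<^sup>2))"
    unfolding SS by (intro has_bochner_integral_add IH a1 a2)
  moreover have "S (Suc n) \<in> borel_measurable (F (q (Suc n)))"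
  proof -
    have "S (Suc n) = (\<lambda>\<omega>. S n \<omega> + \<xi> n \<omega> * ?V \<omega>)" by (auto simp: S_def)
    then show ?thesis
      using measurable_F_mono[OF qn IH(2)] measurable_F_mono[OF qn \<xi>n] W_measurable[OF IH(1) qn]
        W_measurable[of "q (Suc n)" "q (Suc n)"] IH(1) qn by auto
  qed
  ultimately show ?case using IH(1) qn by simp
qed

text \<open>
  The integrand is switched off as soon as the running sum of squares, including the current step,
  exceeds \<open>\<eta>\<close>. The decision for a step is known at its left endpoint, so the isometry still applies.
\<close>

lemma step_integral_truncation:
  fixes q :: "nat \<Rightarrow> real" and \<xi> :: "nat \<Rightarrow> 'w \<Rightarrow> real"
  assumes q: "0 \<le> q 0" "\<And>i. i < n \<Longrightarrow> q i \<le> q (Suc i)"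
    and \<xi>: "\<And>i. i < n \<Longrightarrow> \<xi> i \<in> borel_measurable (F (q i))"
    and bd: "\<And>i. i < n \<Longrightarrow> \<exists>C. \<forall>\<omega>\<in>space M. \<bar>\<xi> i \<omega>\<bar> \<le> C"
    and pos: "\<epsilon> > 0" "\<eta> \<ge> 0"
  shows "prob {\<omega> \<in> space M. \<bar>\<Sum>i<n. \<xi> i \<omega> * (W (q (Suc i)) \<omega> - W (q i) \<omega>)\<bar> > \<epsilon> \<and>
      (\<Sum>i<n. (\<xi> i \<omega>)\<^sup>2 * (q (Suc i) - q i)) \<le> \<eta>} \<le> \<eta> / \<epsilon>\<^sup>2"
proof -
  define \<Delta> where "\<Delta> i = q (Suc i) - q i" for i
  define \<xi>' where "\<xi>' i \<omega> = (if (\<Sum>j<Suc i. (\<xi> j \<omega>)\<^sup>2 * \<Delta> j) \<le> \<eta> then \<xi> i \<omega> else 0)" for i \<omega>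
  define S where "S \<omega> = (\<Sum>i<n. \<xi>' i \<omega> * (W (q (Suc i)) \<omega> - W (q i) \<omega>))" for \<omega>
  have qm: "q i \<le> q j" if "i \<le> j" "j \<le> n" for i j
    using that q(2) by (induction j) (auto simp: le_Suc_eq intro: order_trans)
  have \<Delta>0: "0 \<le> \<Delta> i" if "i < n" for i using q that by (auto simp: \<Delta>_def)
  have m': "\<xi>' i \<in> borel_measurable (F (q i))" if "i < n" for i
  proof -
    have "\<xi> j \<in> borel_measurable (F (q i))" if "j \<le> i" for j
      using \<open>i < n\<close> that by (intro measurable_F_mono[OF qm \<xi>]) auto
    then have [measurable]: "\<And>j. j < Suc i \<Longrightarrow> \<xi> j \<in> borel_measurable (F (q i))" by simp
    show ?thesis unfolding \<xi>'_def by measurable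
  qed
  have b': "\<exists>C. \<forall>\<omega>\<in>space M. \<bar>\<xi>' i \<omega>\<bar> \<le> C" if i: "i < n" for i
  proof -
    obtain C where "\<forall>\<omega>\<in>space M. \<bar>\<xi> i \<omega>\<bar> \<le> C" using bd[OF i] by blast
    then show ?thesis by (intro exI[of _ "\<bar>C\<bar>"]) (auto simp: \<xi>'_def intro: order_trans)
  qed
  have sq_le: "(\<Sum>i<k. (\<xi>' i \<omega>)\<^sup>2 * \<Delta> i) \<le> \<eta>" if "k \<le> n" for k \<omega>
    using that
  proof (induction k)
    case 0 then show ?case using pos by simp
  next
    case (Suc k)
    show ?case
    proof (cases "(\<Sum>j<Suc k. (\<xi> j \<omega>)\<^sup>2 * \<Delta> j) \<le> \<eta>")
      case True
      have "(\<Sum>i<Suc k. (\<xi>' i \<omega>)\<^sup>2 * \<Delta> i) \<le> (\<Sum>j<Suc k. (\<xi> j \<omega>)\<^sup>2 * \<Delta> j)"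
        by (rule sum_mono) (use Suc.prems \<Delta>0 in \<open>auto simp: \<xi>'_def\<close>)
      then show ?thesis using True by linarith
    next
      case False
      then have "\<xi>' k \<omega> = 0" by (simp add: \<xi>'_def)
      then show ?thesis using Suc by simp
    qed
  qed
  have iso: "has_bochner_integral M (\<lambda>\<omega>. (S \<omega>)\<^sup>2) (\<Sum>i<n. \<Delta> i * expectation (\<lambda>\<omega>. (\<xi>' i \<omega>)\<^sup>2))"
    and Sm: "S \<in> borel_measurable (F (q n))"
    unfolding S_def[abs_def] \<Delta>_def
    using step_integral_isometry[OF q m' b', of n] by auto
  have SM: "S \<in> borel_measurable M" using Sm measurable_F_M by blast
  have ii: "integrable M (\<lambda>\<omega>. (\<xi>' i \<omega>)\<^sup>2)" if i: "i < n" for i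
  proof -
    obtain C where "\<And>\<omega>. \<omega>\<in>space M \<Longrightarrow> \<bar>\<xi>' i \<omega>\<bar> \<le> C" using b'[OF i] by blast
    with measurable_F_M[OF m'[OF i]] show ?thesis by (rule integrable_power_bounded)
  qed
  have "expectation (\<lambda>\<omega>. (S \<omega>)\<^sup>2) = (\<Sum>i<n. expectation (\<lambda>\<omega>. (\<xi>' i \<omega>)\<^sup>2 * \<Delta> i))"
    using iso by (simp add: has_bochner_integral_iff mult.commute)
  also have "\<dots> = expectation (\<lambda>\<omega>. \<Sum>i<n. (\<xi>' i \<omega>)\<^sup>2 * \<Delta> i)"
    by (subst Bochner_Integration.integral_sum) (auto intro: ii)
  also have "\<dots> \<le> expectation (\<lambda>\<omega>. \<eta>)"
    by (rule integral_mono) (use sq_le ii in \<open>auto intro!: Bochner_Integration.integrable_sum\<close>)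
  finally have ES: "expectation (\<lambda>\<omega>. (S \<omega>)\<^sup>2) \<le> \<eta>" by (simp add: prob_space)
  \<comment> \<open>Where the full sum of squares stays below \<open>\<eta>\<close>, the truncation
    never acts and the integral equals \<open>S\<close>. What remains is Chebyshev's inequality for
    \<open>S\<close>, whose second moment is at most \<open>\<eta>\<close>.\<close>
  have "prob {\<omega> \<in> space M. \<bar>\<Sum>i<n. \<xi> i \<omega> * (W (q (Suc i)) \<omega> - W (q i) \<omega>)\<bar> > \<epsilon> \<and>
      (\<Sum>i<n. (\<xi> i \<omega>)\<^sup>2 * (q (Suc i) - q i)) \<le> \<eta>} \<le> prob {\<omega> \<in> space M. (S \<omega>)\<^sup>2 \<ge> \<epsilon>\<^sup>2}"
  proof (rule finite_measure_mono)
    show "{\<omega> \<in> space M. (S \<omega>)\<^sup>2 \<ge> \<epsilon>\<^sup>2} \<in> events" using SM by measurable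
    show "{\<omega> \<in> space M. \<bar>\<Sum>i<n. \<xi> i \<omega> * (W (q (Suc i)) \<omega> - W (q i) \<omega>)\<bar> > \<epsilon> \<and>
      (\<Sum>i<n. (\<xi> i \<omega>)\<^sup>2 * (q (Suc i) - q i)) \<le> \<eta>} \<subseteq> {\<omega> \<in> space M. (S \<omega>)\<^sup>2 \<ge> \<epsilon>\<^sup>2}"
    proof safe
      fix \<omega> assume \<omega>: "\<omega> \<in> space M" "\<bar>\<Sum>i<n. \<xi> i \<omega> * (W (q (Suc i)) \<omega> - W (q i) \<omega>)\<bar> > \<epsilon>"
        "(\<Sum>i<n. (\<xi> i \<omega>)\<^sup>2 * (q (Suc i) - q i)) \<le> \<eta>"
      have "\<xi>' i \<omega> = \<xi> i \<omega>" if i: "i < n" for i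
      proof -
        have "(\<Sum>j<Suc i. (\<xi> j \<omega>)\<^sup>2 * \<Delta> j) \<le> (\<Sum>j<n. (\<xi> j \<omega>)\<^sup>2 * \<Delta> j)"
          by (rule sum_mono2) (use i \<Delta>0 in auto)
        then show ?thesis using \<omega>(3) by (simp add: \<xi>'_def \<Delta>_def)
      qed
      then have "\<bar>S \<omega>\<bar> > \<epsilon>" using \<omega>(2) by (simp add: S_def)
      then have "\<epsilon>\<^sup>2 \<le> \<bar>S \<omega>\<bar>\<^sup>2" using pos by (intro power_mono) auto
      then show "\<epsilon>\<^sup>2 \<le> (S \<omega>)\<^sup>2" by simp
    qed
  qed
  also have "\<dots> \<le> expectation (\<lambda>\<omega>. (S \<omega>)\<^sup>2) / \<epsilon>\<^sup>2"
    by (rule integral_Markov_inequality_measure[where A = "space M"])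
       (use iso pos in \<open>auto simp: has_bochner_integral_iff\<close>)
  also have "\<dots> \<le> \<eta> / \<epsilon>\<^sup>2" using ES by (simp add: divide_right_mono)
  finally show ?thesis .
qed

end

section \<open>Simple integrands on a common grid\<close>

lemma grid_less_iff:
  fixes p :: "nat \<Rightarrow> real"
  assumes p: "\<And>j. j < N \<Longrightarrow> p j < p (Suc j)"
  shows "k \<le> N \<Longrightarrow> l \<le> N \<Longrightarrow> p k < p l \<longleftrightarrow> k < l"
proof -
  have *: "p k < p l" if "k < l" "l \<le> N" for k l
    using that
  proof (induction l)
    case (Suc l)
    then show ?case using p[of l] by (cases "k = l") (auto simp: less_Suc_eq)
  qed simp
  assume "k \<le> N" "l \<le> N"
  then show ?thesis using *[of k l] *[of l k] by (cases k l rule: linorder_cases) auto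
qed

lemma grid_le_iff:
  fixes p :: "nat \<Rightarrow> real"
  assumes p: "\<And>j. j < N \<Longrightarrow> p j < p (Suc j)"
  shows "k \<le> N \<Longrightarrow> l \<le> N \<Longrightarrow> p k \<le> p l \<longleftrightarrow> k \<le> l"
  using grid_less_iff[of N p l k, OF p] by (simp add: not_less[symmetric])

context
  fixes p \<tau> :: "nat \<Rightarrow> real" and n N :: nat
  assumes p: "\<And>j. j < N \<Longrightarrow> p j < p (Suc j)" and \<tau>p: "\<tau> ` {..n} \<subseteq> p ` {..N}"
begin

private lemmas less_iff = grid_less_iff[of N p, OF p] and le_iff = grid_le_iff[of N p, OF p]

text \<open>Every partition point of the integrand is a grid point, so none lies strictly inside a
  cell: each \<open>\<tau> i\<close> is on the same side of \<open>s\<close> as of the right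
  endpoint of the cell.\<close>

lemma simple_process_refine:
  assumes "j < N" "s \<in> {p j<..p (Suc j)}"
  shows "simple_process n \<tau> \<xi> s \<omega> = simple_process n \<tau> \<xi> (p (Suc j)) \<omega>"
proof -
  have *: "(\<tau> i < s \<longleftrightarrow> \<tau> i < p (Suc j)) \<and> (s \<le> \<tau> i \<longleftrightarrow> p (Suc j) \<le> \<tau> i)" if i: "i \<le> n" for i
  proof -
    obtain k where k: "k \<le> N" "\<tau> i = p k" using \<tau>p i by blast
    show ?thesis
    proof (cases "k \<le> j")
      case True
      then have "p k \<le> p j" "p k < p (Suc j)" using assms k le_iff[of k j] less_iff[of k "Suc j"] by auto
      then show ?thesis using assms k by auto
    next
      case False
      then have "p (Suc j) \<le> p k" using assms k le_iff[of "Suc j" k] by auto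
      then show ?thesis using assms k by auto
    qed
  qed
  show ?thesis unfolding simple_process_def
    by (intro sum.cong refl) (use * in \<open>auto simp: indicator_def\<close>)
qed

text \<open>Each interval of the partition is a union of consecutive cells, over which the
  increments of \<open>w\<close> telescope; then the two sums are exchanged. The function
  \<open>w\<close> is arbitrary because it will be a Wiener path stopped at a fixed time.\<close>

lemma simple_integral_refine:
  assumes mono: "\<And>i. i < n \<Longrightarrow> \<tau> i \<le> \<tau> (Suc i)"
  shows "(\<Sum>i<n. \<xi> i \<omega> * (w (\<tau> (Suc i)) - w (\<tau> i)))
    = (\<Sum>j<N. simple_process n \<tau> \<xi> (p (Suc j)) \<omega> * (w (p (Suc j)) - w (p j)))"
proof -
  have *: "(\<Sum>j<N. indicator {\<tau> i<..\<tau> (Suc i)} (p (Suc j)) * (w (p (Suc j)) - w (p j)))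
      = w (\<tau> (Suc i)) - w (\<tau> i)" if i: "i < n" for i
  proof -
    obtain k where k: "k \<le> N" "\<tau> i = p k" using \<tau>p i by (metis atMost_iff imageE image_subset_iff less_imp_le)
    obtain l where l: "l \<le> N" "\<tau> (Suc i) = p l" using \<tau>p i by (metis Suc_leI atMost_iff imageE image_subset_iff)
    have kl: "k \<le> l" using mono[OF i] k l le_iff by auto
    have "(\<Sum>j<N. indicator {\<tau> i<..\<tau> (Suc i)} (p (Suc j)) * (w (p (Suc j)) - w (p j)))
      = (\<Sum>j=k..<l. w (p (Suc j)) - w (p j))"
    proof (rule sum.mono_neutral_cong_right)
      show "{k..<l} \<subseteq> {..<N}" using l by auto
      show "\<forall>j\<in>{..<N} - {k..<l}. indicator {\<tau> i<..\<tau> (Suc i)} (p (Suc j)) * (w (p (Suc j)) - w (p j)) = 0"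
        using k l less_iff le_iff by (auto simp: indicator_def)
      show "\<And>j. j \<in> {k..<l} \<Longrightarrow> indicator {\<tau> i<..\<tau> (Suc i)} (p (Suc j)) * (w (p (Suc j)) - w (p j))
          = w (p (Suc j)) - w (p j)"
        using k l less_iff le_iff by (auto simp: indicator_def)
    qed simp
    also have "\<dots> = w (p l) - w (p k)" by (rule sum_Suc_diff'[OF kl])
    finally show ?thesis using k l by simp
  qed
  have "(\<Sum>j<N. simple_process n \<tau> \<xi> (p (Suc j)) \<omega> * (w (p (Suc j)) - w (p j)))
     = (\<Sum>j<N. \<Sum>i<n. \<xi> i \<omega> * (indicator {\<tau> i<..\<tau> (Suc i)} (p (Suc j)) * (w (p (Suc j)) - w (p j))))"
    unfolding simple_process_def sum_distrib_right by (simp only: mult.assoc)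
  also have "\<dots> = (\<Sum>i<n. \<xi> i \<omega> * (\<Sum>j<N. indicator {\<tau> i<..\<tau> (Suc i)} (p (Suc j)) * (w (p (Suc j)) - w (p j))))"
    by (subst sum.swap) (simp only: sum_distrib_left)
  finally show ?thesis using * by simp
qed

end

lemma simple_process_borel [measurable]: "(\<lambda>s. simple_process n \<tau> \<xi> s \<omega>) \<in> borel_measurable borel"
  unfolding simple_process_def by measurable

lemma simple_process_bounded:
  assumes "simple_integrand M F n \<tau> \<xi>"
  shows "\<exists>C. \<forall>\<omega>\<in>space M. \<bar>simple_process n \<tau> \<xi> s \<omega>\<bar> \<le> C"
proof -
  have "\<forall>i. \<exists>C. i < n \<longrightarrow> (\<forall>\<omega>\<in>space M. \<bar>\<xi> i \<omega>\<bar> \<le> C)" using assms by (auto simp: simple_integrand_def)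
  then obtain C where C: "\<And>i \<omega>. i < n \<Longrightarrow> \<omega> \<in> space M \<Longrightarrow> \<bar>\<xi> i \<omega>\<bar> \<le> C i" by metis
  show ?thesis
  proof (intro exI ballI)
    fix \<omega> assume \<omega>: "\<omega> \<in> space M"
    have "\<bar>simple_process n \<tau> \<xi> s \<omega>\<bar> \<le> (\<Sum>i<n. \<bar>\<xi> i \<omega> * indicator {\<tau> i<..\<tau> (Suc i)} s\<bar>)"
      unfolding simple_process_def by (rule sum_abs)
    also have "\<dots> \<le> (\<Sum>i<n. C i)"
      using C[OF _ \<omega>] by (intro sum_mono) (auto simp: indicator_def intro: order_trans[OF abs_ge_zero])
    finally show "\<bar>simple_process n \<tau> \<xi> s \<omega>\<bar> \<le> (\<Sum>i<n. C i)" .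
  qed
qed

context wiener_space
begin

text \<open>At time \<open>s\<close> the terms with \<open>\<tau> i \<ge> s\<close> vanish, and the
  others are already known at \<open>r\<close>. Applied with \<open>r\<close> and \<open>s\<close>
  the two endpoints of a grid cell, it makes the value on the cell known at its left
  endpoint.\<close>

lemma simple_process_measurable:
  assumes "simple_integrand M F n \<tau> \<xi>" "\<And>i. i < n \<Longrightarrow> \<tau> i < s \<Longrightarrow> \<tau> i \<le> r"
  shows "simple_process n \<tau> \<xi> s \<in> borel_measurable (F r)"
proof -
  have "(\<lambda>\<omega>. \<xi> i \<omega> * indicator {\<tau> i<..\<tau> (Suc i)} s) \<in> borel_measurable (F r)" if i: "i < n" for i
  proof (cases "\<tau> i < s")
    case True
    then have "\<xi> i \<in> borel_measurable (F r)"
      using assms i by (intro measurable_F_mono[of "\<tau> i" r]) (auto simp: simple_integrand_def)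
    then show ?thesis by measurable
  qed simp
  then show ?thesis unfolding simple_process_def[abs_def] by (intro borel_measurable_sum) auto
qed

lemma simple_ito_integral_borel:
  assumes "simple_integrand M F n \<tau> \<xi>" "0 \<le> t"
  shows "simple_ito_integral W n \<tau> \<xi> t \<in> borel_measurable M"
proof -
  have mono: "\<And>i. i < n \<Longrightarrow> \<tau> i \<le> \<tau> (Suc i)" and \<tau>0: "0 \<le> \<tau> 0"
    using assms by (auto simp: simple_integrand_def)
  have pos: "0 \<le> \<tau> i" if "i \<le> n" for i
    using that \<tau>0 mono by (induction i) (auto intro: order_trans)
  have "\<xi> i \<in> borel_measurable M" if "i < n" for i
    using assms that measurable_F_M by (auto simp: simple_integrand_def)
  then show ?thesis unfolding simple_ito_integral_def[abs_def]
    using pos assms(2) by (intro borel_measurable_sum borel_measurable_times borel_measurable_diff W_borel) auto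
qed

text \<open>On the common refinement of both partitions the difference of the integrals is a single
  step integral, to which the truncation estimate applies. The result provides an event
  \<open>B\<close> instead of the probability of a set, so that measurability of the
  \<open>L\<^sup>2\<close> distance in \<open>\<omega>\<close> is never at issue.\<close>

lemma simple_integral_difference_tail:
  assumes s1: "simple_integrand M F n \<tau> \<xi>" and s2: "simple_integrand M F n' \<tau>' \<xi>'"
    and t: "0 \<le> t" and pos: "\<epsilon> > 0" "\<eta> \<ge> 0"
  obtains B where "B \<in> events" "prob B \<le> \<eta> / \<epsilon>\<^sup>2"
    "\<And>\<omega>. \<omega> \<in> space M \<Longrightarrow> \<bar>simple_ito_integral W n \<tau> \<xi> t \<omega> - simple_ito_integral W n' \<tau>' \<xi>' t \<omega>\<bar> > \<epsilon> \<Longrightarrow>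
      (\<integral>\<^sup>+s\<in>{0..t}. ennreal ((simple_process n \<tau> \<xi> s \<omega> - simple_process n' \<tau>' \<xi>' s \<omega>)\<^sup>2) \<partial>lborel) \<le> ennreal \<eta> \<Longrightarrow> \<omega> \<in> B"
proof -
  define P where "P = \<tau> ` {..n} \<union> \<tau>' ` {..n'}"
  define N where "N = card P - 1"
  define p where "p j = sorted_list_of_set P ! j" for j
  have finP: "finite P" and neP: "P \<noteq> {}" by (auto simp: P_def)
  have lenN: "length (sorted_list_of_set P) = Suc N"
    using finP neP by (simp add: N_def Suc_pred' card_gt_0_iff)
  have pN: "p j < p (Suc j)" if "j < N" for j
    using that lenN sorted_wrt_nth_less[OF strict_sorted_list_of_set[of P], of j "Suc j"]
    by (auto simp: p_def)
  have pP: "p ` {..N} = P"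
  proof -
    have "p ` {..<length (sorted_list_of_set P)} = set (sorted_list_of_set P)"
      unfolding p_def set_conv_nth by auto
    then show ?thesis using lenN finP by (simp add: lessThan_Suc_atMost)
  qed
  have nn: "0 \<le> \<tau> i" if "simple_integrand M F n \<tau> \<xi>" "i \<le> n" for i n \<tau> and \<xi> :: "nat \<Rightarrow> 'w \<Rightarrow> real"
    using that(2) that(1) by (induction i) (auto simp: simple_integrand_def intro: order_trans)
  have p0: "0 \<le> p j" if "j \<le> N" for j
  proof -
    have "p j \<in> P" using pP that by auto
    then show ?thesis using nn[OF s1] nn[OF s2] by (auto simp: P_def)
  qed
  have sub1: "\<tau> ` {..n} \<subseteq> p ` {..N}" and sub2: "\<tau>' ` {..n'} \<subseteq> p ` {..N}" using pP by (auto simp: P_def)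
  define H where "H s \<omega> = simple_process n \<tau> \<xi> s \<omega> - simple_process n' \<tau>' \<xi>' s \<omega>" for s \<omega>
  define q where "q j = min t (p j)" for j
  \<comment> \<open>Steps that begin at \<open>t\<close> or later have zero increments after
    stopping. Their coefficients must be set to zero: the stopped left endpoint is then
    \<open>t\<close>, and the original coefficient need not be known that early.\<close>
  define \<zeta> where "\<zeta> j \<omega> = (if p j < t then H (p (Suc j)) \<omega> else 0)" for j \<omega>
  have Hm: "H (p (Suc j)) \<in> borel_measurable (F (p j))" if j: "j < N" for j
  proof -
    have *: "\<tau> i \<le> p j" if \<tau>: "\<tau> ` {..n} \<subseteq> p ` {..N}" "i < n" "\<tau> i < p (Suc j)" for \<tau> :: "nat \<Rightarrow> real" and n i
    proof -
      obtain k where k: "k \<le> N" "\<tau> i = p k"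
        using \<tau>(1,2) by (metis atMost_iff imageE image_subset_iff less_imp_le)
      then have "k < Suc j" using \<tau>(3) j grid_less_iff[of N p k "Suc j", OF pN] by auto
      then show ?thesis using k j grid_le_iff[of N p k j, OF pN] by auto
    qed
    show ?thesis unfolding H_def[abs_def]
      by (intro borel_measurable_diff simple_process_measurable[OF s1] simple_process_measurable[OF s2])
        (use * sub1 sub2 in auto)
  qed
  have Hb: "\<exists>C. \<forall>\<omega>\<in>space M. \<bar>H s \<omega>\<bar> \<le> C" for s
  proof -
    obtain C1 C2 where "\<forall>\<omega>\<in>space M. \<bar>simple_process n \<tau> \<xi> s \<omega>\<bar> \<le> C1" "\<forall>\<omega>\<in>space M. \<bar>simple_process n' \<tau>' \<xi>' s \<omega>\<bar> \<le> C2"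
      using simple_process_bounded[OF s1] simple_process_bounded[OF s2] by meson
    then have "\<forall>\<omega>\<in>space M. \<bar>H s \<omega>\<bar> \<le> C1 + C2" by (force simp: H_def)
    then show ?thesis ..
  qed
  have \<zeta>m: "\<zeta> j \<in> borel_measurable (F (q j))" if "j < N" for j
    using Hm[OF that] by (cases "p j < t") (auto simp: \<zeta>_def[abs_def] q_def min_def)
  have \<zeta>b: "\<exists>C. \<forall>\<omega>\<in>space M. \<bar>\<zeta> j \<omega>\<bar> \<le> C" for j
    using Hb[of "p (Suc j)"] by (cases "p j < t") (auto simp: \<zeta>_def)
  have q0: "0 \<le> q 0" using p0 t by (simp add: q_def)
  have qm: "q j \<le> q (Suc j)" if "j < N" for j using pN[OF that] by (auto simp: q_def)
  define B where "B = {\<omega> \<in> space M. \<bar>\<Sum>i<N. \<zeta> i \<omega> * (W (q (Suc i)) \<omega> - W (q i) \<omega>)\<bar> > \<epsilon> \<and>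
      (\<Sum>i<N. (\<zeta> i \<omega>)\<^sup>2 * (q (Suc i) - q i)) \<le> \<eta>}"
  show thesis
  proof
    show "prob B \<le> \<eta> / \<epsilon>\<^sup>2" unfolding B_def
      by (rule step_integral_truncation) (use q0 qm \<zeta>m \<zeta>b pos in auto)
    have [measurable]: "\<And>i. i < N \<Longrightarrow> \<zeta> i \<in> borel_measurable M"
      using \<zeta>m measurable_F_M by blast
    have [measurable]: "\<And>i. i \<le> N \<Longrightarrow> W (q i) \<in> borel_measurable M"
      using p0 t by (intro W_borel) (auto simp: q_def)
    show "B \<in> events" unfolding B_def by measurable
    fix \<omega> assume \<omega>: "\<omega> \<in> space M"
      and big: "\<bar>simple_ito_integral W n \<tau> \<xi> t \<omega> - simple_ito_integral W n' \<tau>' \<xi>' t \<omega>\<bar> > \<epsilon>"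
      and small: "(\<integral>\<^sup>+s\<in>{0..t}. ennreal ((simple_process n \<tau> \<xi> s \<omega> - simple_process n' \<tau>' \<xi>' s \<omega>)\<^sup>2) \<partial>lborel) \<le> ennreal \<eta>"
    have "simple_ito_integral W n \<tau> \<xi> t \<omega> - simple_ito_integral W n' \<tau>' \<xi>' t \<omega>
        = (\<Sum>j<N. H (p (Suc j)) \<omega> * (W (q (Suc j)) \<omega> - W (q j) \<omega>))"
    proof -
      have "simple_ito_integral W n \<tau> \<xi> t \<omega>
          = (\<Sum>j<N. simple_process n \<tau> \<xi> (p (Suc j)) \<omega> * (W (q (Suc j)) \<omega> - W (q j) \<omega>))"
        unfolding simple_ito_integral_def q_def
        by (rule simple_integral_refine[OF pN sub1]) (use s1 in \<open>auto simp: simple_integrand_def\<close>)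
      moreover have "simple_ito_integral W n' \<tau>' \<xi>' t \<omega>
          = (\<Sum>j<N. simple_process n' \<tau>' \<xi>' (p (Suc j)) \<omega> * (W (q (Suc j)) \<omega> - W (q j) \<omega>))"
        unfolding simple_ito_integral_def q_def
        by (rule simple_integral_refine[OF pN sub2]) (use s2 in \<open>auto simp: simple_integrand_def\<close>)
      ultimately show ?thesis by (simp add: H_def sum_subtractf left_diff_distrib)
    qed
    also have "\<dots> = (\<Sum>j<N. \<zeta> j \<omega> * (W (q (Suc j)) \<omega> - W (q j) \<omega>))"
    proof (intro sum.cong refl)
      fix j assume "j \<in> {..<N}"
      then have "p j < p (Suc j)" using pN by auto
      then show "H (p (Suc j)) \<omega> * (W (q (Suc j)) \<omega> - W (q j) \<omega>) = \<zeta> j \<omega> * (W (q (Suc j)) \<omega> - W (q j) \<omega>)"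
        by (auto simp: \<zeta>_def q_def min_def)
    qed
    finally have 1: "\<bar>\<Sum>j<N. \<zeta> j \<omega> * (W (q (Suc j)) \<omega> - W (q j) \<omega>)\<bar> > \<epsilon>" using big by simp
    \<comment> \<open>At most one stopped cell contains \<open>u\<close>, and on it \<open>H\<close>
      is constant, so the sum of squares of the steps is dominated by the \<open>L\<^sup>2\<close>
      norm of \<open>H\<close> on \<open>[0, t]\<close>.\<close>
    have pt: "(\<Sum>j<N. ennreal ((\<zeta> j \<omega>)\<^sup>2) * indicator {q j<..q (Suc j)} u) \<le> ennreal ((H u \<omega>)\<^sup>2) * indicator {0..t} u" for u
    proof (cases "\<exists>j<N. u \<in> {q j<..q (Suc j)}")
      case True
      then obtain j where j: "j < N" "u \<in> {q j<..q (Suc j)}" by blast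
      have uj: "u \<in> {p i<..p (Suc i)} \<and> u \<le> t \<and> p i < t" if "u \<in> {q i<..q (Suc i)}" for i
        using that by (auto simp: q_def min_def split: if_splits)
      have uniq: "i = j" if "i < N" "u \<in> {q i<..q (Suc i)}" for i
      proof -
        have "p i < p (Suc j)" "p j < p (Suc i)" using uj[OF that(2)] uj[OF j(2)] by auto
        then show ?thesis using that j grid_less_iff[of N p i "Suc j", OF pN] grid_less_iff[of N p j "Suc i", OF pN] by auto
      qed
      have "(\<Sum>i<N. ennreal ((\<zeta> i \<omega>)\<^sup>2) * indicator {q i<..q (Suc i)} u)
          = (\<Sum>i\<in>{j}. ennreal ((\<zeta> i \<omega>)\<^sup>2) * indicator {q i<..q (Suc i)} u)"
      proof (rule sum.mono_neutral_right)
        show "\<forall>i\<in>{..<N} - {j}. ennreal ((\<zeta> i \<omega>)\<^sup>2) * indicator {q i<..q (Suc i)} u = 0"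
        proof
          fix i assume "i \<in> {..<N} - {j}"
          then have "u \<notin> {q i<..q (Suc i)}" using uniq[of i] by blast
          then show "ennreal ((\<zeta> i \<omega>)\<^sup>2) * indicator {q i<..q (Suc i)} u = 0" by simp
        qed
      qed (use j in auto)
      also have "\<dots> = ennreal ((H (p (Suc j)) \<omega>)\<^sup>2)" using j(2) uj[OF j(2)] by (simp add: \<zeta>_def)
      also have "H (p (Suc j)) \<omega> = H u \<omega>"
        using simple_process_refine[OF pN sub1 j(1), of u \<xi> \<omega>] simple_process_refine[OF pN sub2 j(1), of u \<xi>' \<omega>] uj[OF j(2)]
        by (simp add: H_def)
      finally show ?thesis using uj[OF j(2)] p0[of j] j(1) by (simp add: indicator_def)
    next
      case False
      then have "(\<Sum>j<N. ennreal ((\<zeta> j \<omega>)\<^sup>2) * indicator {q j<..q (Suc j)} u) = 0"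
        by (intro sum.neutral) (auto simp: indicator_def)
      then show ?thesis by simp
    qed
    have "ennreal (\<Sum>j<N. (\<zeta> j \<omega>)\<^sup>2 * (q (Suc j) - q j)) = (\<Sum>j<N. ennreal ((\<zeta> j \<omega>)\<^sup>2) * emeasure lborel {q j<..q (Suc j)})"
      using qm by (subst sum_ennreal[symmetric]) (auto simp: ennreal_mult intro!: sum.cong)
    also have "\<dots> = (\<integral>\<^sup>+u. (\<Sum>j<N. ennreal ((\<zeta> j \<omega>)\<^sup>2) * indicator {q j<..q (Suc j)} u) \<partial>lborel)"
      by (subst nn_integral_sum) (auto simp: nn_integral_cmult_indicator)
    also have "\<dots> \<le> (\<integral>\<^sup>+u. ennreal ((H u \<omega>)\<^sup>2) * indicator {0..t} u \<partial>lborel)"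
      by (rule nn_integral_mono) (rule pt)
    also have "\<dots> \<le> ennreal \<eta>" using small by (simp add: H_def)
    finally have "(\<Sum>j<N. (\<zeta> j \<omega>)\<^sup>2 * (q (Suc j) - q j)) \<le> \<eta>" using pos by simp
    then show "\<omega> \<in> B" using 1 \<omega> by (simp add: B_def)
  qed
qed

text \<open>Off small events, both the given simple process and the approximating sequence from the
  definition of the integral are within \<open>\<eta>\<close> of \<open>A\<close> in squared
  \<open>L\<^sup>2\<close> distance, hence within \<open>4 * \<eta>\<close> of each other. The tail
  estimate with \<open>\<epsilon> / 2\<close> then gives
  \<open>4 * \<eta> / (\<epsilon> / 2)\<^sup>2\<close>, which is the last term; the probabilities
  that belong to the sequence vanish in the limit. The event \<open>G\<close> localizes: the
  approximation need only be good there.\<close>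

lemma ito_integral_step_error:
  assumes I: "is_ito_integral M F W A I" and t: "0 \<le> t"
    and s: "simple_integrand M F n \<tau> \<xi>" and pos: "\<epsilon> > 0" "\<eta> > 0"
    and Q: "Q \<in> borel_measurable M" and G: "G \<in> events"
    and le: "AE \<omega> in M. \<omega> \<in> G \<longrightarrow>
      (\<integral>\<^sup>+s\<in>{0..t}. ennreal ((simple_process n \<tau> \<xi> s \<omega> - A s \<omega>)\<^sup>2) \<partial>lborel) \<le> ennreal (Q \<omega>)"
  shows "prob {\<omega> \<in> G. \<bar>simple_ito_integral W n \<tau> \<xi> t \<omega> - I t \<omega>\<bar> > \<epsilon>}
    \<le> prob {\<omega> \<in> space M. Q \<omega> > \<eta>} + 16 * \<eta> / \<epsilon>\<^sup>2"
proof -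
  note I' = I[unfolded is_ito_integral_def]
  from I'[THEN conjunct2, THEN conjunct2, THEN conjunct2, THEN conjunct2, THEN spec, THEN mp, OF t]
  obtain n' \<tau>' \<xi>' where
    sk: "\<And>k. simple_integrand M F (n' k) (\<tau>' k) (\<xi>' k)" and
    Hk: "tendsto_zero_in_prob M
          (\<lambda>k \<omega>. \<integral>\<^sup>+s\<in>{0..t}. ennreal ((simple_process (n' k) (\<tau>' k) (\<xi>' k) s \<omega> - A s \<omega>)\<^sup>2) \<partial>lborel)" and
    Sk: "tendsto_zero_in_prob M
          (\<lambda>k \<omega>. ennreal \<bar>simple_ito_integral W (n' k) (\<tau>' k) (\<xi>' k) t \<omega> - I t \<omega>\<bar>)"
    by blast
  let ?S = "simple_ito_integral W n \<tau> \<xi> t"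
  let ?H = "simple_process n \<tau> \<xi>"
  define S' where "S' k = simple_ito_integral W (n' k) (\<tau>' k) (\<xi>' k) t" for k
  define H' where "H' k = simple_process (n' k) (\<tau>' k) (\<xi>' k)" for k
  define E where "E = {\<omega> \<in> G. \<bar>?S \<omega> - I t \<omega>\<bar> > \<epsilon>}"
  define Ak where "Ak k = {\<omega> \<in> space M. ennreal \<bar>S' k \<omega> - I t \<omega>\<bar> > ennreal (\<epsilon> / 2)}" for k
  define Bk where "Bk k = {\<omega> \<in> space M. (\<integral>\<^sup>+s\<in>{0..t}. ennreal ((H' k s \<omega> - A s \<omega>)\<^sup>2) \<partial>lborel) > ennreal \<eta>}" for k
  define D where "D = {\<omega> \<in> space M. Q \<omega> > \<eta>}"
  have "AE \<omega> in M. set_borel_measurable lborel {0..t} (\<lambda>s. A s \<omega>)"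
  proof -
    have "AE \<omega> in M. \<forall>T\<ge>0. set_borel_measurable lborel {0..T} (\<lambda>s. A s \<omega>) \<and>
        (\<integral>\<^sup>+s\<in>{0..T}. ennreal ((A s \<omega>)\<^sup>2) \<partial>lborel) < \<infinity>"
      by (rule I'[THEN conjunct2, THEN conjunct1])
    then show ?thesis by (rule eventually_mono) (use t in simp)
  qed
  with le have "AE \<omega> in M. set_borel_measurable lborel {0..t} (\<lambda>s. A s \<omega>) \<and> (\<omega> \<in> G \<longrightarrow>
      (\<integral>\<^sup>+s\<in>{0..t}. ennreal ((simple_process n \<tau> \<xi> s \<omega> - A s \<omega>)\<^sup>2) \<partial>lborel) \<le> ennreal (Q \<omega>))"
    by (simp add: AE_conj_iff)
  then obtain Z where Z: "Z \<in> null_sets M"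
    "\<And>\<omega>. \<omega> \<in> space M - Z \<Longrightarrow> set_borel_measurable lborel {0..t} (\<lambda>s. A s \<omega>)"
    "\<And>\<omega>. \<omega> \<in> space M - Z \<Longrightarrow> \<omega> \<in> G \<Longrightarrow>
      (\<integral>\<^sup>+s\<in>{0..t}. ennreal ((simple_process n \<tau> \<xi> s \<omega> - A s \<omega>)\<^sup>2) \<partial>lborel) \<le> ennreal (Q \<omega>)"
    by (elim AE_E3) blast
  have Am: "Ak k \<in> events" and Bm: "Bk k \<in> events" and Dm: "D \<in> events" for k
    using Hk Sk Q unfolding tendsto_zero_in_prob_def Ak_def Bk_def D_def S'_def H'_def
    by (auto intro!: borel_measurable_less)
  have bound: "prob E \<le> prob (Ak k) + prob (Bk k) + prob D + 16 * \<eta> / \<epsilon>\<^sup>2" for k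
  proof -
    obtain C where C: "C \<in> events" "prob C \<le> 4 * \<eta> / (\<epsilon> / 2)\<^sup>2"
      "\<And>\<omega>. \<omega> \<in> space M \<Longrightarrow> \<bar>?S \<omega> - S' k \<omega>\<bar> > \<epsilon> / 2 \<Longrightarrow>
      (\<integral>\<^sup>+s\<in>{0..t}. ennreal ((?H s \<omega> - H' k s \<omega>)\<^sup>2) \<partial>lborel) \<le> ennreal (4 * \<eta>) \<Longrightarrow> \<omega> \<in> C"
      unfolding S'_def H'_def
      by (rule simple_integral_difference_tail[OF s sk[of k] t, of "\<epsilon> / 2" "4 * \<eta>"]) (use pos in auto)
    have "E \<subseteq> Z \<union> Ak k \<union> Bk k \<union> D \<union> C"
    proof
      fix \<omega> assume \<omega>: "\<omega> \<in> E"
      have sp: "\<omega> \<in> space M" using \<omega> G sets.sets_into_space by (auto simp: E_def)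
      show "\<omega> \<in> Z \<union> Ak k \<union> Bk k \<union> D \<union> C"
      proof (rule ccontr)
        assume n: "\<omega> \<notin> Z \<union> Ak k \<union> Bk k \<union> D \<union> C"
        have a: "\<bar>S' k \<omega> - I t \<omega>\<bar> \<le> \<epsilon> / 2" using n sp pos by (simp add: Ak_def ennreal_less_iff not_less)
        have b: "(\<integral>\<^sup>+s\<in>{0..t}. ennreal ((H' k s \<omega> - A s \<omega>)\<^sup>2) \<partial>lborel) \<le> ennreal \<eta>"
          using n sp by (auto simp: Bk_def not_less)
        have d: "(\<integral>\<^sup>+s\<in>{0..t}. ennreal ((?H s \<omega> - A s \<omega>)\<^sup>2) \<partial>lborel) \<le> ennreal \<eta>"
          using n sp Z(3)[of \<omega>] \<omega> by (auto simp: D_def E_def not_less intro: order_trans[OF _ ennreal_leI])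
        have m: "(\<lambda>s. indicator {0..t} s * A s \<omega>) \<in> borel_measurable borel"
          using Z(2)[of \<omega>] n sp by (simp add: set_borel_measurable_def)
        \<comment> \<open>The path of \<open>A\<close> is known to be measurable only after
          restriction to \<open>[0, t]\<close>, so the indicator is moved inside the square.\<close>
        have mm: "(\<lambda>s. ennreal ((K s - A s \<omega>)\<^sup>2) * indicator {0..t} s) \<in> borel_measurable borel"
          if [measurable]: "K \<in> borel_measurable borel" for K :: "real \<Rightarrow> real"
        proof -
          have "(\<lambda>s. ennreal ((K s - A s \<omega>)\<^sup>2) * indicator {0..t} s) =
            (\<lambda>s. ennreal ((indicator {0..t} s * K s - indicator {0..t} s * A s \<omega>)\<^sup>2))"
            by (auto simp: indicator_def)
          also have "\<dots> \<in> borel_measurable borel" using m by measurable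
          finally show ?thesis .
        qed
        have "(\<integral>\<^sup>+s\<in>{0..t}. ennreal ((?H s \<omega> - H' k s \<omega>)\<^sup>2) \<partial>lborel)
          \<le> (\<integral>\<^sup>+s. 2 * (ennreal ((?H s \<omega> - A s \<omega>)\<^sup>2) * indicator {0..t} s) + 2 * (ennreal ((H' k s \<omega> - A s \<omega>)\<^sup>2) * indicator {0..t} s) \<partial>lborel)"
        proof (rule nn_integral_mono)
          fix s
          have "(?H s \<omega> - H' k s \<omega>)\<^sup>2 \<le> 2 * (?H s \<omega> - A s \<omega>)\<^sup>2 + 2 * (H' k s \<omega> - A s \<omega>)\<^sup>2"
            using sum_squares_bound[of "?H s \<omega> - A s \<omega>" "-(H' k s \<omega> - A s \<omega>)"]
            by (simp add: power2_eq_square algebra_simps)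
          then have "ennreal ((?H s \<omega> - H' k s \<omega>)\<^sup>2) \<le> ennreal (2 * (?H s \<omega> - A s \<omega>)\<^sup>2 + 2 * (H' k s \<omega> - A s \<omega>)\<^sup>2)"
            by (rule ennreal_leI)
          also have "\<dots> = 2 * ennreal ((?H s \<omega> - A s \<omega>)\<^sup>2) + 2 * ennreal ((H' k s \<omega> - A s \<omega>)\<^sup>2)"
            by (simp add: ennreal_mult)
          finally show "ennreal ((?H s \<omega> - H' k s \<omega>)\<^sup>2) * indicator {0..t} s \<le> 2 * (ennreal ((?H s \<omega> - A s \<omega>)\<^sup>2) * indicator {0..t} s) + 2 * (ennreal ((H' k s \<omega> - A s \<omega>)\<^sup>2) * indicator {0..t} s)"
            by (auto simp: indicator_def)
        qed
        also have "\<dots> = 2 * (\<integral>\<^sup>+s\<in>{0..t}. ennreal ((?H s \<omega> - A s \<omega>)\<^sup>2) \<partial>lborel) + 2 * (\<integral>\<^sup>+s\<in>{0..t}. ennreal ((H' k s \<omega> - A s \<omega>)\<^sup>2) \<partial>lborel)"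
          using mm unfolding H'_def by (simp add: nn_integral_add nn_integral_cmult)
        also have "\<dots> \<le> 2 * ennreal \<eta> + 2 * ennreal \<eta>"
          using b d by (intro add_mono mult_left_mono) auto
        also have "\<dots> = ennreal (4 * \<eta>)"
          using pos by (simp add: ennreal_mult[symmetric] ennreal_plus[symmetric] del: ennreal_plus flip: ennreal_numeral)
        finally have e: "(\<integral>\<^sup>+s\<in>{0..t}. ennreal ((?H s \<omega> - H' k s \<omega>)\<^sup>2) \<partial>lborel) \<le> ennreal (4 * \<eta>)" .
        have "\<bar>?S \<omega> - I t \<omega>\<bar> > \<epsilon>" using \<omega> by (simp add: E_def)
        then have "\<bar>?S \<omega> - S' k \<omega>\<bar> > \<epsilon> / 2" using a by arith
        then show False using C(3)[OF sp _ e] n by auto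
      qed
    qed
    then have "prob E \<le> prob (Z \<union> Ak k \<union> Bk k \<union> D \<union> C)"
      using Z(1) Am Bm Dm C(1) by (intro finite_measure_mono) auto
    also have "\<dots> \<le> prob Z + prob (Ak k) + prob (Bk k) + prob D + prob C"
      using Z(1) Am Bm Dm C(1)
      by (intro order_trans[OF measure_Un_le] add_mono order_refl) auto
    also have "prob Z = 0" using Z(1) by (simp add: null_sets_def measure_def)
    also have "prob C \<le> 16 * \<eta> / \<epsilon>\<^sup>2" using C(2) by (simp add: power_divide)
    finally show ?thesis by simp
  qed
  have "(\<lambda>k. prob (Ak k) + prob (Bk k) + prob D + 16 * \<eta> / \<epsilon>\<^sup>2) \<longlonglongrightarrow> 0 + 0 + prob D + 16 * \<eta> / \<epsilon>\<^sup>2"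
    using Hk Sk pos unfolding tendsto_zero_in_prob_def Ak_def Bk_def S'_def H'_def
    by (intro tendsto_add tendsto_const) auto
  then have "prob E \<le> 0 + 0 + prob D + 16 * \<eta> / \<epsilon>\<^sup>2"
    using bound by (intro LIMSEQ_le_const) auto
  then show ?thesis by (simp add: E_def D_def)
qed

end

section \<open>Calculus on the real line\<close>

text \<open>The fundamental theorem on a compact interval yields a derivative within that interval;
  padding by 1 on both sides makes \<open>x\<close> an interior point.\<close>

lemma has_real_derivative_LBINT:
  fixes g :: "real \<Rightarrow> real"
  assumes "continuous_on UNIV g"
  shows "((\<lambda>x. LBINT u=ereal c..ereal x. g u) has_real_derivative g x) (at x)"
proof -
  have "((\<lambda>x. LBINT u=ereal c..ereal x. g u) has_vector_derivative g x) (at x within {min c x - 1..max c x + 1})"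
    by (rule interval_integral_FTC2) (use assms in \<open>auto intro: continuous_on_subset\<close>)
  moreover have "x \<in> interior {min c x - 1..max c x + 1}" by (auto simp: min_def max_def)
  then have "at x within {min c x - 1..max c x + 1} = at x" by (rule at_within_interior)
  ultimately show ?thesis
    by (simp only: has_real_derivative_iff_has_vector_derivative)
qed

lemma LBINT_eq_0:
  fixes g :: "real \<Rightarrow> real"
  assumes "\<And>u. min x y \<le> u \<Longrightarrow> u \<le> max x y \<Longrightarrow> g u = 0"
  shows "(LBINT u=ereal x..ereal y. g u) = 0"
proof -
  have "(LBINT u=ereal x..ereal y. g u) = (\<lambda>_. 0) y - (\<lambda>_. 0::real) x"
  proof (rule interval_integral_FTC_finite)
    show "continuous_on {min x y..max x y} g"
      by (rule continuous_on_eq[of _ "\<lambda>_. 0"]) (use assms in auto)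
  qed (use assms in auto)
  then show ?thesis by simp
qed

lemma continuous_compact_support_bounded:
  fixes g :: "real \<Rightarrow> real"
  assumes "continuous_on UNIV g" "\<And>x. x \<notin> {l..r} \<Longrightarrow> g x = 0"
  shows "\<exists>B. \<forall>x. \<bar>g x\<bar> \<le> B"
proof -
  have "compact (g ` {l..r})"
    using assms(1) by (intro compact_continuous_image) (auto intro: continuous_on_subset)
  then have "bounded (g ` {l..r})" by (rule compact_imp_bounded)
  then obtain B where B: "\<And>y. y \<in> g ` {l..r} \<Longrightarrow> \<bar>y\<bar> \<le> B"
    unfolding bounded_iff real_norm_def by blast
  have "\<bar>g x\<bar> \<le> \<bar>B\<bar>" for x
    using assms(2)[of x] B[of "g x"] by (cases "x \<in> {l..r}") auto
  then show ?thesis by blast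
qed

text \<open>Clamping the argument to \<open>[l, r]\<close> does not change \<open>g\<close>, since
  \<open>g\<close> vanishes at the endpoints as well; the interval in the hypothesis is open for
  this reason. The clamp is 1-Lipschitz and \<open>g\<close> is uniformly continuous on the compact
  interval.\<close>

lemma continuous_compact_support_uniformly:
  fixes g :: "real \<Rightarrow> real"
  assumes g: "continuous_on UNIV g" and "l \<le> r" and 0: "\<And>x. x \<notin> {l<..<r} \<Longrightarrow> g x = 0"
  shows "uniformly_continuous_on UNIV g"
proof -
  define q where "q x = max l (min r x)" for x
  have "g = (\<lambda>x. g (q x))"
  proof
    show "g x = g (q x)" for x
      using 0[of x] 0[of "q x"] \<open>l \<le> r\<close> by (cases "x \<in> {l<..<r}") (auto simp: q_def min_def max_def)
  qed
  moreover have "uniformly_continuous_on UNIV (\<lambda>x. g (q x))"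
  proof (rule uniformly_continuous_on_compose[of UNIV q g])
    show "uniformly_continuous_on UNIV q"
      unfolding uniformly_continuous_on_def q_def dist_real_def by (auto simp: min_def max_def)
    show "uniformly_continuous_on (range q) g"
    proof -
      have "uniformly_continuous_on {l..r} g"
        using g by (intro compact_uniformly_continuous) (auto intro: continuous_on_subset)
      moreover have "range q \<subseteq> {l..r}" using \<open>l \<le> r\<close> by (auto simp: q_def)
      ultimately show ?thesis unfolding uniformly_continuous_on_def by (meson subsetD)
    qed
  qed
  ultimately show ?thesis by simp
qed

text \<open>At 0 the difference quotient of the squared positive part is the positive part itself
  and tends to 0. Squared positive parts are the building blocks of the differentiable cut-off used
  for the test function.\<close>

lemma has_real_derivative_max0_square:
  fixes f :: "real \<Rightarrow> real"
  assumes "(f has_real_derivative d) (at x)"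
  shows "((\<lambda>x. (max 0 (f x))\<^sup>2) has_real_derivative 2 * max 0 (f x) * d) (at x)"
proof -
  have "((\<lambda>y::real. (max 0 y)\<^sup>2) has_real_derivative 2 * max 0 y) (at y)" for y :: real
  proof (cases y "0 :: real" rule: linorder_cases)
    case less
    have "((\<lambda>y::real. 0) has_real_derivative 2 * max 0 y) (at y)" using less by (auto intro!: derivative_eq_intros)
    then show ?thesis
      by (rule DERIV_cong_ev[THEN iffD1, OF refl _ refl, rotated])
        (use eventually_nhds_in_open[of "{..<0}" y] less in \<open>auto elim: eventually_mono\<close>)
  next
    case greater
    have "((\<lambda>y::real. y\<^sup>2) has_real_derivative 2 * max 0 y) (at y)" using greater by (auto intro!: derivative_eq_intros)
    then show ?thesis
      by (rule DERIV_cong_ev[THEN iffD1, OF refl _ refl, rotated])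
        (use eventually_nhds_in_open[of "{0<..}" y] greater in \<open>auto elim: eventually_mono\<close>)
  next
    case equal
    have "((\<lambda>h::real. max 0 h) \<longlongrightarrow> max 0 0) (at 0)" by (intro tendsto_intros)
    moreover have "\<forall>\<^sub>F h::real in at 0. max 0 h = (max 0 h)\<^sup>2 / h"
      by (auto simp: eventually_at_filter max_def power2_eq_square)
    ultimately have "((\<lambda>h::real. (max 0 h)\<^sup>2 / h) \<longlongrightarrow> max 0 0) (at 0)"
      by (rule Lim_transform_eventually)
    then show ?thesis using equal by (simp add: DERIV_def)
  qed
  from DERIV_chain2[OF this assms] show ?thesis by simp
qed

section \<open>Scale function and Green kernel\<close>

locale transient_coefficients =
  fixes a b :: "real \<Rightarrow> real"
  assumes cont_a: "continuous_on UNIV a" and cont_b: "continuous_on UNIV b" and a_nz: "\<And>y. a y \<noteq> 0"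
    and top_finite: "Phi_top a b 0 < \<infinity>"
begin

definition psi (\<open>\<psi>\<close>) where "\<psi> x = phi a b 0 x"

lemma psi_pos: "0 < \<psi> x" by (simp add: psi_def phi_def)

lemma cont_drift: "continuous_on UNIV (\<lambda>u. b u / (a u)\<^sup>2)"
  using a_nz by (intro continuous_on_divide continuous_on_power cont_a cont_b) auto

text \<open>Moving the base point of the exponent only multiplies by a constant. All functions of
  two variables in the theorem thus become products and quotients of functions of one
  variable.\<close>

lemma phi_eq: "phi a b u x = \<psi> x / \<psi> u"
proof -
  define B where "B x = (LBINT u=ereal 0..ereal x. b u / (a u)\<^sup>2)" for x
  have "(LBINT v=ereal u..ereal x. b v / (a v)\<^sup>2) = B x - B u"
  proof (rule interval_integral_FTC_finite)
    show "continuous_on {min u x..max u x} (\<lambda>u. b u / (a u)\<^sup>2)"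
      using cont_drift continuous_on_subset by blast
    have "(B has_real_derivative b y / (a y)\<^sup>2) (at y)" for y
      unfolding B_def[abs_def] by (rule has_real_derivative_LBINT[OF cont_drift])
    then show "(B has_vector_derivative b y / (a y)\<^sup>2) (at y within {min u x..max u x})" for y
      by (simp add: has_field_derivative_at_within flip: has_real_derivative_iff_has_vector_derivative)
  qed
  then show ?thesis
    by (simp add: psi_def phi_def B_def exp_diff[symmetric] algebra_simps)
qed

lemma psi_deriv: "(\<psi> has_real_derivative - 2 * (b x / (a x)\<^sup>2) * \<psi> x) (at x)"
proof -
  define B where "B x = (LBINT u=ereal 0..ereal x. b u / (a u)\<^sup>2)" for x
  have dB: "(B has_real_derivative b x / (a x)\<^sup>2) (at x)"
    unfolding B_def[abs_def] by (rule has_real_derivative_LBINT[OF cont_drift])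
  have "\<psi> = (\<lambda>x. exp (- 2 * B x))" by (simp add: psi_def phi_def B_def fun_eq_iff)
  then show ?thesis by (simp only:) (rule derivative_eq_intros dB refl | simp)+
qed

lemma cont_psi: "continuous_on UNIV \<psi>"
  by (rule DERIV_continuous_on) (rule psi_deriv)

lemma Phi0_deriv: "(Phi a b 0 has_real_derivative \<psi> x) (at x)"
proof -
  have "Phi a b 0 = (\<lambda>x. LBINT z=ereal 0..ereal x. \<psi> z)" by (simp add: Phi_def psi_def fun_eq_iff)
  then show ?thesis using has_real_derivative_LBINT[OF cont_psi, of 0 x] by simp
qed

lemma Phi_eq: "Phi a b u x = (Phi a b 0 x - Phi a b 0 u) / \<psi> u"
proof -
  have "(LBINT z=ereal u..ereal x. phi a b u z) = Phi a b 0 x / \<psi> u - Phi a b 0 u / \<psi> u"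
  proof (rule interval_integral_FTC_finite)
    show "continuous_on {min u x..max u x} (phi a b u)"
      unfolding phi_eq[abs_def] using psi_pos[of u]
      by (intro continuous_on_divide continuous_on_const continuous_on_subset[OF cont_psi]) auto
    have "((\<lambda>x. Phi a b 0 x / \<psi> u) has_real_derivative phi a b u y) (at y)" for y
      unfolding phi_eq[of u y] by (rule DERIV_cdivide[OF Phi0_deriv])
    then show "((\<lambda>x. Phi a b 0 x / \<psi> u) has_vector_derivative phi a b u y) (at y within {min u x..max u x})" for y
      by (simp add: has_field_derivative_at_within flip: has_real_derivative_iff_has_vector_derivative)
  qed
  then show ?thesis by (simp add: Phi_def diff_divide_distrib)
qed

lemma Phi0_mono:
  assumes "x \<le> y"
  shows "Phi a b 0 x \<le> Phi a b 0 y"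
proof (rule DERIV_nonneg_imp_nondecreasing[OF assms])
  show "\<exists>d. (Phi a b 0 has_real_derivative d) (at z) \<and> 0 \<le> d" for z
    using Phi0_deriv[of z] psi_pos[of z] by (intro exI[of _ "\<psi> z"]) simp
qed

definition scale_limit where "scale_limit = real_of_ereal (Phi_top a b 0)"

text \<open>\<open>Phi_top\<close> is an operator \<open>Lim\<close>, which is informative only if
  the limit exists. Monotonicity supplies the limit as a supremum; it is finite because it is below
  infinity by assumption and at least the value at 0.\<close>

lemma Phi0_tendsto: "(Phi a b 0 \<longlongrightarrow> scale_limit) at_top"
proof -
  define L where "L = (SUP x. ereal (Phi a b 0 x))"
  have lim: "((\<lambda>x. ereal (Phi a b 0 x)) \<longlongrightarrow> L) at_top"
  proof (rule order_tendstoI)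
    fix c assume "c < L"
    then obtain x0 where "c < ereal (Phi a b 0 x0)" by (auto simp: L_def less_SUP_iff)
    then have "c < ereal (Phi a b 0 x)" if "x0 \<le> x" for x
      using Phi0_mono[OF that] by (meson ereal_less_eq(3) less_le_trans)
    then show "\<forall>\<^sub>F x in at_top. c < ereal (Phi a b 0 x)"
      unfolding eventually_at_top_linorder by blast
  next
    fix c assume "L < c"
    then have "ereal (Phi a b 0 x) < c" for x
      unfolding L_def by (meson SUP_upper UNIV_I le_less_trans)
    then show "\<forall>\<^sub>F x in at_top. ereal (Phi a b 0 x) < c" by simp
  qed
  then have L: "Phi_top a b 0 = L" unfolding Phi_top_def by (rule tendsto_Lim[rotated]) simp
  have "ereal (Phi a b 0 0) \<le> L" unfolding L_def by (rule SUP_upper) simp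
  then have "L = ereal scale_limit" using top_finite L by (cases L) (auto simp: scale_limit_def)
  then show ?thesis using lim by simp
qed

definition scale_tail where "scale_tail x = scale_limit - Phi a b 0 x"

lemma scale_tail_nonneg: "0 \<le> scale_tail x"
proof -
  have "\<forall>\<^sub>F y in at_top. Phi a b 0 x \<le> Phi a b 0 y"
    unfolding eventually_at_top_linorder by (intro exI[of _ x] allI impI Phi0_mono)
  then have "Phi a b 0 x \<le> scale_limit" by (intro tendsto_lowerbound[OF Phi0_tendsto]) simp_all
  then show ?thesis by (simp add: scale_tail_def)
qed

lemma scale_tail_antimono: "x \<le> y \<Longrightarrow> scale_tail y \<le> scale_tail x" using Phi0_mono by (simp add: scale_tail_def)

lemma cont_scale_tail: "continuous_on UNIV scale_tail"
  unfolding scale_tail_def[abs_def]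
  by (rule continuous_on_diff[OF continuous_on_const DERIV_continuous_on]) (rule Phi0_deriv)

lemma Phi_top_eq: "Phi_top a b u = ereal (scale_tail u / \<psi> u)"
proof -
  have "((\<lambda>x. ereal (Phi a b u x)) \<longlongrightarrow> ereal ((scale_limit - Phi a b 0 u) / \<psi> u)) at_top"
    unfolding Phi_eq[of u] using psi_pos[of u] by (intro tendsto_intros Phi0_tendsto) auto
  then show ?thesis unfolding Phi_top_def scale_tail_def by (intro tendsto_Lim) auto
qed

lemma nn_integral_psi_tail: "(\<integral>\<^sup>+z\<in>{x..}. ennreal (\<psi> z) \<partial>lborel) = ennreal (scale_tail x)"
  unfolding scale_tail_def
proof (rule nn_integral_FTC_atLeast)
  show "\<psi> \<in> borel_measurable borel" using cont_psi by (rule borel_measurable_continuous_onI)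
qed (use Phi0_deriv psi_pos Phi0_tendsto in \<open>auto intro: less_imp_le\<close>)

text \<open>
  \<open>green_kernel x u\<close> equals \<open>2 / a(u)\<^sup>2\<close> times the integral of \<open>\<phi>(u, z)\<close> over \<open>z \<ge> max x u\<close>.
\<close>

definition green_kernel where "green_kernel x u = 2 * scale_tail (max x u) / ((a u)\<^sup>2 * \<psi> u)"

text \<open>Values in \<open>[0, \<infinity>]\<close> make the potential defined and monotone for
  every nonnegative function, before anything is known about its finiteness.\<close>

definition green where "green g x = (\<integral>\<^sup>+u. g u * ennreal (green_kernel x u) \<partial>lborel)"

lemma green_kernel_nonneg: "0 \<le> green_kernel x u"
  using scale_tail_nonneg psi_pos[of u] by (auto simp: green_kernel_def intro!: divide_nonneg_nonneg mult_nonneg_nonneg less_imp_le)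

lemma green_kernel_continuous: "continuous_on UNIV (\<lambda>p. green_kernel (fst p) (snd p))"
proof -
  have "continuous_on UNIV (\<lambda>p. scale_tail (max (fst p) (snd p)))"
    by (rule continuous_on_compose2[OF cont_scale_tail]) (auto intro!: continuous_intros)
  moreover have "continuous_on UNIV (\<lambda>p. a (snd p))" "continuous_on UNIV (\<lambda>p. \<psi> (snd p))"
    by (auto intro!: continuous_on_compose2[OF cont_a] continuous_on_compose2[OF cont_psi] continuous_intros)
  ultimately show ?thesis
    unfolding green_kernel_def using a_nz psi_pos by (intro continuous_intros) (auto simp: less_le)
qed

lemma green_kernel_measurable [measurable]:
  "case_prod green_kernel \<in> borel_measurable (borel \<Otimes>\<^sub>M borel)"
  using borel_measurable_continuous_onI[OF green_kernel_continuous]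
  by (simp add: borel_prod case_prod_beta')

text \<open>The tail of the scale function decreases and is evaluated at a point not smaller than
  \<open>- c\<close>, so the bound is uniform in the starting point \<open>x\<close>. This
  uniformity makes the averaged Green measure of a random starting point locally finite, as outer
  regularity requires.\<close>

lemma green_kernel_locally_bounded: "\<exists>C. \<forall>x u. u \<in> {-c..c} \<longrightarrow> green_kernel x u \<le> C"
proof -
  have "continuous_on {-c..c} (\<lambda>u. 2 / ((a u)\<^sup>2 * \<psi> u))"
    using continuous_on_subset[OF cont_a] continuous_on_subset[OF cont_psi] a_nz psi_pos
    by (intro continuous_intros) (auto simp: less_le)
  then have "compact ((\<lambda>u. 2 / ((a u)\<^sup>2 * \<psi> u)) ` {-c..c})" by (intro compact_continuous_image) auto
  then have "bounded ((\<lambda>u. 2 / ((a u)\<^sup>2 * \<psi> u)) ` {-c..c})" by (rule compact_imp_bounded)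
  then obtain B where B: "\<And>u. u \<in> {-c..c} \<Longrightarrow> \<bar>2 / ((a u)\<^sup>2 * \<psi> u)\<bar> \<le> B"
    unfolding bounded_iff real_norm_def by blast
  have "green_kernel x u \<le> B * scale_tail (- c)" if u: "u \<in> {-c..c}" for x u
  proof -
    have "green_kernel x u = 2 / ((a u)\<^sup>2 * \<psi> u) * scale_tail (max x u)" by (simp add: green_kernel_def)
    also have "\<dots> \<le> B * scale_tail (- c)"
      by (intro mult_mono scale_tail_antimono scale_tail_nonneg abs_le_D1[OF B[OF u]] order_trans[OF abs_ge_zero B[OF u]]) (use u in auto)
    finally show ?thesis .
  qed
  then show ?thesis by blast
qed

text \<open>The kernel splits at \<open>u = x\<close>. To the right the maximum is \<open>u\<close>,
  and the scale tail over \<open>\<psi> u\<close> is the first integrand of \<open>P0\<close>; to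
  the left the tail is constant in \<open>u\<close> and factors through \<open>\<psi> x\<close> into
  the second one. The factor 2 of the kernel is the leading 2 of \<open>P0\<close>. Pointwise there
  is only an inequality, since \<open>u = x\<close> belongs to both ranges.\<close>

lemma green_le_P0:
  assumes f: "f \<in> borel_measurable borel"
  shows "green (\<lambda>u. ennreal \<bar>f u\<bar>) x \<le> P0 a b f"
proof -
  have [measurable]: "a \<in> borel_measurable borel" "\<psi> \<in> borel_measurable borel" "scale_tail \<in> borel_measurable borel"
    using cont_a cont_psi cont_scale_tail by (auto intro: borel_measurable_continuous_onI)
  note f[measurable]
  let ?A = "\<lambda>u. ennreal (\<bar>f u\<bar> / (a u)\<^sup>2) * e2ennreal (Phi_top a b u) * indicator {x..} u"
  let ?B = "\<lambda>u. ennreal (\<bar>f u\<bar> / (a u)\<^sup>2 * phi a b u x) * indicator {..x} u"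
  have double: "ennreal (2 * (y * z)) = 2 * (ennreal y * ennreal z)" if "0 \<le> y" "0 \<le> z" for y z :: real
    using that by (simp add: ennreal_mult)
  have pt: "ennreal \<bar>f u\<bar> * ennreal (green_kernel x u) \<le> 2 * (?A u + e2ennreal (Phi_top a b x) * ?B u)" for u
  proof (cases "x \<le> u")
    case True
    have "ennreal \<bar>f u\<bar> * ennreal (green_kernel x u) = ennreal (2 * (\<bar>f u\<bar> / (a u)\<^sup>2 * (scale_tail u / \<psi> u)))"
      using True green_kernel_nonneg[of x u] scale_tail_nonneg psi_pos
      by (simp add: ennreal_mult[symmetric] green_kernel_def max_def field_simps)
    also have "\<dots> = 2 * (ennreal (\<bar>f u\<bar> / (a u)\<^sup>2) * ennreal (scale_tail u / \<psi> u))"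
      by (rule double) (use scale_tail_nonneg[of u] psi_pos[of u] in auto)
    also have "\<dots> = 2 * ?A u" using True by (simp add: Phi_top_eq)
    also have "\<dots> \<le> 2 * (?A u + e2ennreal (Phi_top a b x) * ?B u)" by (intro mult_left_mono) auto
    finally show ?thesis .
  next
    case False
    have "ennreal \<bar>f u\<bar> * ennreal (green_kernel x u) = ennreal (2 * ((scale_tail x / \<psi> x) * (\<bar>f u\<bar> / (a u)\<^sup>2 * (\<psi> x / \<psi> u))))"
      using False green_kernel_nonneg[of x u] scale_tail_nonneg psi_pos[of x] psi_pos[of u]
      by (simp add: ennreal_mult[symmetric] green_kernel_def max_def field_simps)
    also have "\<dots> = 2 * (ennreal (scale_tail x / \<psi> x) * ennreal (\<bar>f u\<bar> / (a u)\<^sup>2 * (\<psi> x / \<psi> u)))"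
      by (rule double) (use scale_tail_nonneg[of x] psi_pos[of u] psi_pos[of x] in auto)
    also have "\<dots> = 2 * (e2ennreal (Phi_top a b x) * ?B u)" using False by (simp add: Phi_top_eq phi_eq)
    also have "\<dots> \<le> 2 * (?A u + e2ennreal (Phi_top a b x) * ?B u)" by (intro mult_left_mono) auto
    finally show ?thesis .
  qed
  have [measurable]: "?A \<in> borel_measurable borel" "?B \<in> borel_measurable borel"
    unfolding Phi_top_eq phi_eq by measurable
  have "green (\<lambda>u. ennreal \<bar>f u\<bar>) x \<le> (\<integral>\<^sup>+u. 2 * (?A u + e2ennreal (Phi_top a b x) * ?B u) \<partial>lborel)"
    unfolding green_def by (rule nn_integral_mono) (rule pt)
  also have "\<dots> = 2 * ((\<integral>\<^sup>+u. ?A u \<partial>lborel) + e2ennreal (Phi_top a b x) * (\<integral>\<^sup>+u. ?B u \<partial>lborel))"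
  proof -
    have "(\<integral>\<^sup>+u. 2 * (?A u + e2ennreal (Phi_top a b x) * ?B u) \<partial>lborel) = 2 * (\<integral>\<^sup>+u. ?A u + e2ennreal (Phi_top a b x) * ?B u \<partial>lborel)"
      by (rule nn_integral_cmult) measurable
    also have "(\<integral>\<^sup>+u. ?A u + e2ennreal (Phi_top a b x) * ?B u \<partial>lborel) = (\<integral>\<^sup>+u. ?A u \<partial>lborel) + (\<integral>\<^sup>+u. e2ennreal (Phi_top a b x) * ?B u \<partial>lborel)"
      by (rule nn_integral_add) measurable
    also have "(\<integral>\<^sup>+u. e2ennreal (Phi_top a b x) * ?B u \<partial>lborel) = e2ennreal (Phi_top a b x) * (\<integral>\<^sup>+u. ?B u \<partial>lborel)"
      by (rule nn_integral_cmult) measurable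
    finally show ?thesis .
  qed
  also have "\<dots> \<le> P0 a b f" unfolding P0_def by (intro mult_left_mono SUP_upper) auto
  finally show ?thesis .
qed

text \<open>
  \<open>h'\<close> is the derivative of the Green potential of \<open>g\<close>, cut off to the right of \<open>R\<close>; it vanishes by
  itself to the left of the support of \<open>g\<close>. As \<open>h' \<le> 0\<close> and \<open>h\<close> vanishes near \<open>\<infinity>\<close>, the cut-off only
  decreases \<open>h\<close>.
\<close>

lemma green_test_function:
  fixes g :: "real \<Rightarrow> real" and c R :: real
  assumes g: "continuous_on UNIV g" "\<And>u. 0 \<le> g u" "\<And>u. u \<notin> {-c..c} \<Longrightarrow> g u = 0" and c: "0 < c" "0 < R"
  obtains h h1 h2 :: "real \<Rightarrow> real" and B :: real where
    "\<And>x. (h has_real_derivative h1 x) (at x)" "\<And>x. (h1 has_real_derivative h2 x) (at x)"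
    "uniformly_continuous_on UNIV h2" "\<And>x. \<bar>h1 x\<bar> \<le> B" "\<And>x. \<bar>h2 x\<bar> \<le> B" "\<And>x. h x \<le> B"
    "\<And>x. 0 \<le> h x" "\<And>x. ennreal (h x) \<le> green (\<lambda>u. ennreal (g u)) x"
    "\<And>x. x \<le> R \<Longrightarrow> b x * h1 x + (a x)\<^sup>2 * h2 x / 2 = - g x"
proof -
  \<comment> \<open>The form of \<open>w\<close> comes from solving the generator equation for
    \<open>h1 = - 2 * \<psi> * K\<close>: the derivative of \<open>\<psi>\<close> cancels the drift
    term and leaves \<open>- (a x)\<^sup>2 * \<psi> x * K' x\<close>, where \<open>K'\<close> is the
    derivative of \<open>K\<close>. This equals \<open>- g x\<close> exactly when
    \<open>K' = w\<close>.\<close>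
  define w where "w u = g u / ((a u)\<^sup>2 * \<psi> u)" for u
  have cw: "continuous_on UNIV w"
    unfolding w_def[abs_def] using g cont_a cont_psi a_nz psi_pos
    by (intro continuous_intros) (auto simp: less_le)
  have w0: "0 \<le> w u" for u using g(2)[of u] psi_pos[of u] by (simp add: w_def)
  define K where "K z = (LBINT u=ereal (- c)..ereal z. w u)" for z
  have dK: "(K has_real_derivative w z) (at z)" for z
    unfolding K_def[abs_def] by (rule has_real_derivative_LBINT) (rule cw)
  have K_left: "K z = 0" if "z < - c" for z
    unfolding K_def
  proof (rule LBINT_eq_0)
    have gz: "g u = 0" if "u < - c" for u using g(3) that by auto
    \<comment> \<open>The hypothesis gives zeros only outside the closed interval; continuity from
      the left covers its endpoint.\<close>
    have "g (-c) = 0"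
    proof -
      have "(g \<longlongrightarrow> g (-c)) (at_left (-c))"
        using g(1) by (simp add: continuous_on_eq_continuous_at isCont_def filterlim_at_split)
      moreover have "\<forall>\<^sub>F u in at_left (-c). g u = 0"
        using gz by (auto simp: eventually_at_filter)
      ultimately have "((\<lambda>_. 0::real) \<longlongrightarrow> g (-c)) (at_left (-c))"
        by (rule Lim_transform_eventually)
      then show ?thesis by (simp add: tendsto_const_iff)
    qed
    then have "g u = 0" if "u \<le> - c" for u using gz[of u] that by (cases "u = -c") auto
    then show "w u = 0" if "u \<le> max (- c) z" for u using that \<open>z < - c\<close> by (simp add: w_def)
  qed
  have Kmono: "K x \<le> K y" if "x \<le> y" for x y
    by (rule DERIV_nonneg_imp_nondecreasing[OF that]) (use dK w0 in \<open>auto intro!: exI\<close>)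
  have K0: "0 \<le> K z" for z
    using K_left[of "min z (- c - 1)"] Kmono[of "min z (- c - 1)" z] by simp
  have K_le: "ennreal (K z) \<le> (\<integral>\<^sup>+u\<in>{..z}. ennreal (w u) \<partial>lborel)" for z
  proof (cases "- c \<le> z")
    case True
    have "(\<integral>\<^sup>+u. ennreal (w u) * indicator {- c..z} u \<partial>lborel) = ennreal (K z - K (- c))"
      by (rule nn_integral_FTC_Icc)
        (use True dK w0 cw in \<open>auto intro: borel_measurable_continuous_onI has_vector_derivative_at_within
           simp flip: has_real_derivative_iff_has_vector_derivative\<close>)
    moreover have "K (- c) = 0" by (simp add: K_def)
    ultimately have "ennreal (K z) = (\<integral>\<^sup>+u. ennreal (w u) * indicator {- c..z} u \<partial>lborel)" by simp
    also have "\<dots> \<le> (\<integral>\<^sup>+u\<in>{..z}. ennreal (w u) \<partial>lborel)"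
      by (intro nn_integral_mono) (auto simp: indicator_def)
    finally show ?thesis .
  qed (simp add: K_left)
  \<comment> \<open>The cut-off \<open>\<theta>\<close> is 1 up to \<open>R\<close> and 0 from
    \<open>R + 1\<close> on. Both positive parts occur squared, which makes it continuously
    differentiable. Its derivative \<open>\<theta>'\<close> is written in the unsimplified shape
    that the differentiation rules produce.\<close>
  define \<kappa> where "\<kappa> x = max 0 (1 - (max 0 (x - R))\<^sup>2)" for x
  define \<theta> where "\<theta> x = (\<kappa> x)\<^sup>2" for x
  define \<theta>' where "\<theta>' x = 2 * \<kappa> x * (0 - 2 * max 0 (x - R) * (1 - 0))" for x
  have d\<theta>: "(\<theta> has_real_derivative \<theta>' x) (at x)" for x
    unfolding \<theta>_def[abs_def] \<theta>'_def \<kappa>_def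
    by (intro has_real_derivative_max0_square DERIV_diff DERIV_const DERIV_ident)
  have \<theta>1: "\<theta> x = 1" "\<theta>' x = 0" if "x \<le> R" for x using that by (auto simp: \<theta>_def \<theta>'_def \<kappa>_def)
  have \<theta>0: "\<theta> x = 0" "\<theta>' x = 0" if "R + 1 \<le> x" for x
  proof -
    have "1 \<le> (x - R)\<^sup>2" using that by (simp add: one_le_power)
    then have "\<kappa> x = 0" using that by (auto simp: \<kappa>_def)
    then show "\<theta> x = 0" "\<theta>' x = 0" by (auto simp: \<theta>_def \<theta>'_def)
  qed
  have \<kappa>b: "0 \<le> \<kappa> x" "\<kappa> x \<le> 1" for x by (auto simp: \<kappa>_def)
  have \<theta>b: "0 \<le> \<theta> x" "\<theta> x \<le> 1" for x using \<kappa>b[of x] by (auto simp: \<theta>_def power_le_one)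
  have c\<theta>: "continuous_on UNIV \<theta>" "continuous_on UNIV \<theta>'"
    unfolding \<theta>_def[abs_def] \<theta>'_def[abs_def] \<kappa>_def[abs_def] by (auto intro!: continuous_intros)
  have cK: "continuous_on UNIV K"
    by (rule DERIV_continuous_on) (rule dK)
  define m where "m z = 2 * \<psi> z * K z * \<theta> z" for z
  have cm: "continuous_on UNIV m" unfolding m_def[abs_def] by (intro continuous_intros cont_psi cK c\<theta>)
  have m0: "0 \<le> m z" for z using psi_pos[of z] K0 \<theta>b by (simp add: m_def)
  define h where "h x = - (LBINT z=ereal (R + 1)..ereal x. m z)" for x
  define h1 where "h1 x = - m x" for x
  define h2 where "h2 x = - 2 * ((- 2 * (b x / (a x)\<^sup>2) * \<psi> x) * K x * \<theta> x + \<psi> x * w x * \<theta> x + \<psi> x * K x * \<theta>' x)" for x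
  have dh: "(h has_real_derivative h1 x) (at x)" for x
    unfolding h_def[abs_def] h1_def by (intro DERIV_minus has_real_derivative_LBINT cm)
  have dh1: "(h1 has_real_derivative h2 x) (at x)" for x
    unfolding h1_def[abs_def] m_def[abs_def] h2_def
    by (rule derivative_eq_intros psi_deriv dK d\<theta> refl)+ (simp add: algebra_simps)
  have ch2: "continuous_on UNIV h2"
    unfolding h2_def[abs_def] by (intro continuous_intros cont_psi cK c\<theta> cw cont_a cont_b) (use a_nz in auto)
  have supp: "m x = 0" "h2 x = 0" if x: "x \<notin> {- c - 1<..<R + 1}" for x
  proof -
    have "(K x = 0 \<and> w x = 0) \<or> (\<theta> x = 0 \<and> \<theta>' x = 0)"
    proof (cases "x < - c")
      case True then show ?thesis using K_left[OF True] g(3)[of x] by (simp add: w_def)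
    next
      case False then show ?thesis using \<theta>0 x c by auto
    qed
    then show "m x = 0" "h2 x = 0" by (auto simp: m_def h2_def)
  qed
  have "continuous_on UNIV h1" unfolding h1_def[abs_def] by (intro continuous_on_minus cm)
  moreover have "h1 x = 0" if "x \<notin> {- c - 1..R + 1}" for x using supp(1)[of x] that by (auto simp: h1_def)
  ultimately obtain B1 where B1: "\<And>x. \<bar>h1 x\<bar> \<le> B1"
    using continuous_compact_support_bounded[of h1 "- c - 1" "R + 1"] by blast
  have "h2 x = 0" if "x \<notin> {- c - 1..R + 1}" for x using supp(2)[of x] that by auto
  with ch2 obtain B2 where B2: "\<And>x. \<bar>h2 x\<bar> \<le> B2"
    using continuous_compact_support_bounded[of h2 "- c - 1" "R + 1"] by blast
  have hmono: "h y \<le> h x" if "x \<le> y" for x y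
    by (rule DERIV_nonpos_imp_nonincreasing[OF that]) (use dh m0 in \<open>auto simp: h1_def intro!: exI\<close>)
  have h_right: "h x = 0" if "R + 1 \<le> x" for x
    unfolding h_def using supp(1) that LBINT_eq_0[of "R + 1" x m] by simp
  have h0: "0 \<le> h x" for x
    using h_right[of "max x (R + 1)"] hmono[of x "max x (R + 1)"] by simp
  have hB: "h x \<le> h (- c - 1)" for x
  proof (cases "x < - c - 1")
    case True
    have "h x = h (- c - 1)"
    proof (rule ccontr)
      assume "h x \<noteq> h (- c - 1)"
      obtain z where "z > x" "z < - c - 1" "h (- c - 1) - h x = (- c - 1 - x) * h1 z"
        using MVT2[OF True, of h h1] dh by blast
      then show False using supp(1)[of z] \<open>h x \<noteq> h (- c - 1)\<close> by (simp add: h1_def)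
    qed
    then show ?thesis by simp
  qed (use hmono in auto)
  have [measurable]: "\<psi> \<in> borel_measurable borel" "w \<in> borel_measurable borel"
    using cont_psi cw by (auto intro: borel_measurable_continuous_onI)
  have hgreen: "ennreal (h x) \<le> green (\<lambda>u. ennreal (g u)) x" for x
  proof (cases "x \<le> R + 1")
    case True
    have "(\<integral>\<^sup>+z. ennreal (m z) * indicator {x..R + 1} z \<partial>lborel) = ennreal (- h (R + 1) - (- h x))"
      by (rule nn_integral_FTC_Icc)
        (use True DERIV_minus[OF dh] m0 cm in \<open>auto simp: h1_def intro: borel_measurable_continuous_onI has_vector_derivative_at_within
           simp flip: has_real_derivative_iff_has_vector_derivative\<close>)
    then have "ennreal (h x) = (\<integral>\<^sup>+z. ennreal (m z) * indicator {x..R + 1} z \<partial>lborel)"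
      using h_right[of "R + 1"] by simp
    \<comment> \<open>Omitting \<open>\<theta>\<close> and extending the range of \<open>z\<close>
      beyond \<open>R + 1\<close> only increase the integral. With \<open>K\<close> written as an
      integral over \<open>u \<le> z\<close>, exchanging the order leaves \<open>\<psi>\<close>
      integrated over \<open>z \<ge> max x u\<close>, the scale tail of the Green kernel.\<close>
    also have "\<dots> \<le> (\<integral>\<^sup>+z. \<integral>\<^sup>+u. 2 * ennreal (w u) * (ennreal (\<psi> z) * indicator {max x u..} z) \<partial>lborel \<partial>lborel)"
    proof (rule nn_integral_mono)
      fix z
      have "ennreal (m z) \<le> ennreal (2 * \<psi> z * K z)"
        using \<theta>b[of z] psi_pos[of z] K0[of z] by (intro ennreal_leI) (simp add: m_def mult_left_le)
      also have "\<dots> = 2 * ennreal (\<psi> z) * ennreal (K z)"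
        using psi_pos[of z] K0[of z] by (simp add: ennreal_mult)
      also have "\<dots> \<le> 2 * ennreal (\<psi> z) * (\<integral>\<^sup>+u\<in>{..z}. ennreal (w u) \<partial>lborel)"
        by (intro mult_left_mono K_le) auto
      finally have "ennreal (m z) * indicator {x..R + 1} z \<le>
          2 * ennreal (\<psi> z) * indicator {x..} z * (\<integral>\<^sup>+u\<in>{..z}. ennreal (w u) \<partial>lborel)"
        by (auto simp: indicator_def)
      also have "\<dots> = (\<integral>\<^sup>+u. (2 * ennreal (\<psi> z) * indicator {x..} z) * (ennreal (w u) * indicator {..z} u) \<partial>lborel)"
        by (rule nn_integral_cmult[symmetric]) measurable
      also have "\<dots> = (\<integral>\<^sup>+u. 2 * ennreal (w u) * (ennreal (\<psi> z) * indicator {max x u..} z) \<partial>lborel)"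
        by (rule nn_integral_cong) (auto simp: indicator_def mult_ac)
      finally show "ennreal (m z) * indicator {x..R + 1} z
        \<le> (\<integral>\<^sup>+u. 2 * ennreal (w u) * (ennreal (\<psi> z) * indicator {max x u..} z) \<partial>lborel)" .
    qed
    also have "\<dots> = (\<integral>\<^sup>+u. \<integral>\<^sup>+z. 2 * ennreal (w u) * (ennreal (\<psi> z) * indicator {max x u..} z) \<partial>lborel \<partial>lborel)"
      by (rule lborel_pair.Fubini') (simp add: atLeast_def case_prod_beta')
    also have "\<dots> = (\<integral>\<^sup>+u. 2 * ennreal (w u) * ennreal (scale_tail (max x u)) \<partial>lborel)"
      by (rule nn_integral_cong) (simp add: nn_integral_cmult nn_integral_psi_tail)
    also have "\<dots> = green (\<lambda>u. ennreal (g u)) x"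
      unfolding green_def
    proof (rule nn_integral_cong)
      fix u
      have "2 * ennreal (w u) * ennreal (scale_tail (max x u)) = ennreal (2 * w u * scale_tail (max x u))"
        using w0 scale_tail_nonneg by (simp add: ennreal_mult)
      also have "2 * w u * scale_tail (max x u) = g u * green_kernel x u" by (simp add: w_def green_kernel_def)
      finally show "2 * ennreal (w u) * ennreal (scale_tail (max x u)) = ennreal (g u) * ennreal (green_kernel x u)"
        using g(2) green_kernel_nonneg by (simp add: ennreal_mult)
    qed
    finally show ?thesis .
  qed (simp add: h_right)
  have gen: "b x * h1 x + (a x)\<^sup>2 * h2 x / 2 = - g x" if "x \<le> R" for x
    using \<theta>1[OF that] a_nz[of x] psi_pos[of x]
    by (simp add: h1_def h2_def m_def w_def field_simps)
  let ?B = "max B1 (max B2 (h (- c - 1)))"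
  have uc: "uniformly_continuous_on UNIV h2"
    using ch2 supp(2) c by (intro continuous_compact_support_uniformly[of h2 "- c - 1" "R + 1"]) auto
  have "\<bar>h1 x\<bar> \<le> ?B" "\<bar>h2 x\<bar> \<le> ?B" "h x \<le> ?B" for x
    using B1[of x] B2[of x] hB[of x] by linarith+
  then show thesis by (rule that[OF dh dh1 uc _ _ _ h0 hgreen gen])
qed

end

section \<open>Step functions along a path\<close>

lemma step_function_value:
  fixes t :: "nat \<Rightarrow> real"
  assumes t: "\<And>k. t k \<le> t (Suc k)" and j: "j < n" "s \<in> {t j<..t (Suc j)}"
  shows "(\<Sum>k<n. c k * indicator {t k<..t (Suc k)} s) = (c j :: real)"
proof -
  have mono: "t k \<le> t l" if "k \<le> l" for k l using t that by (rule lift_Suc_mono_le)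
  have "(\<Sum>k<n. c k * indicator {t k<..t (Suc k)} s) = (\<Sum>k\<in>{j}. c k * indicator {t k<..t (Suc k)} s)"
  proof (rule sum.mono_neutral_right)
    show "\<forall>k\<in>{..<n} - {j}. c k * indicator {t k<..t (Suc k)} s = 0"
    proof
      fix k assume "k \<in> {..<n} - {j}"
      then have "Suc k \<le> j \<or> Suc j \<le> k" by auto
      then have "s \<notin> {t k<..t (Suc k)}" using mono[of "Suc k" j] mono[of "Suc j" k] j(2) by auto
      then show "c k * indicator {t k<..t (Suc k)} s = 0" by simp
    qed
  qed (use j in auto)
  also have "\<dots> = c j * indicator {t j<..t (Suc j)} s"
    using sum.insert[of "{}" j "\<lambda>k. c k * indicator {t k<..t (Suc k)} s"] by (simp only: finite.emptyI sum.empty empty_iff not_False_eq_True add_0_right)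
  finally show ?thesis using j(2) by (simp only: indicator_simps mult_1_right)
qed

lemma grid_cell:
  fixes T s :: real and N :: nat
  assumes "0 < T" "0 < N" "0 < s" "s \<le> T"
  obtains k where "k < N" "s \<in> {real k * T / real N<..real (Suc k) * T / real N}"
proof -
  \<comment> \<open>The cells are open on the left and closed on the right, hence the ceiling minus
    1 and not the floor.\<close>
  define k where "k = nat (\<lceil>s * N / T\<rceil> - 1)"
  have "0 < s * N / T" using assms by simp
  then have "1 \<le> \<lceil>s * N / T\<rceil>" by (simp add: one_le_ceiling)
  then have k: "real k = of_int \<lceil>s * N / T\<rceil> - 1" by (simp add: k_def of_nat_nat)
  have 1: "real k < s * N / T" "s * N / T \<le> real k + 1" using k by linarith+
  have "s * N / T \<le> N" using assms by (simp add: field_simps)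
  then have "\<lceil>s * N / T\<rceil> \<le> int N" by (simp add: ceiling_le_iff)
  moreover have "int k = \<lceil>s * N / T\<rceil> - 1" using k by linarith
  ultimately have "k < N" by linarith
  moreover have "s \<in> {real k * T / real N<..real (Suc k) * T / real N}"
    using 1 assms by (auto simp: field_simps)
  ultimately show thesis by (rule that)
qed

text \<open>Sampling at the left endpoint on a left-open cell gives the shape of
  \<open>simple_process\<close>, so the sampled coefficient along the path is a simple
  integrand.\<close>

definition path_step :: "real \<Rightarrow> nat \<Rightarrow> (real \<Rightarrow> real) \<Rightarrow> real \<Rightarrow> real" where
  "path_step T N f s = (\<Sum>k<N. f (real k * T / real N) * indicator {real k * T / real N<..real (Suc k) * T / real N} s)"

lemma path_step_eq:
  assumes "0 < T" "k < N" "s \<in> {real k * T / real N<..real (Suc k) * T / real N}"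
  shows "path_step T N f s = f (real k * T / real N)"
  unfolding path_step_def
  by (rule step_function_value[of "\<lambda>k. real k * T / real N"]) (use assms in \<open>auto intro!: divide_right_mono mult_right_mono\<close>)

lemma path_step_measurable [measurable]: "path_step T N f \<in> borel_measurable borel"
  unfolding path_step_def[abs_def] by measurable

lemma path_step_tendsto:
  assumes T: "0 < T" and f: "continuous_on {0..T} f" and s: "0 < s" "s \<le> T"
  shows "(\<lambda>n. path_step T (Suc n) f s) \<longlonglongrightarrow> f s"
proof (rule LIMSEQ_I)
  fix r :: real assume "0 < r"
  have "s \<in> {0..T}" using s by auto
  with f \<open>0 < r\<close> obtain d where d: "0 < d" "\<And>u. u \<in> {0..T} \<Longrightarrow> dist u s < d \<Longrightarrow> dist (f u) (f s) < r"
    unfolding continuous_on_iff by blast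
  obtain n0 where n0: "T / d < real n0" using reals_Archimedean2 by blast
  show "\<exists>no. \<forall>n\<ge>no. norm (path_step T (Suc n) f s - f s) < r"
  proof (intro exI allI impI)
    fix n assume "n0 \<le> n"
    then have "T / d < real (Suc n)" using n0 by simp
    then have Td: "T / real (Suc n) < d" using d T by (simp add: field_simps)
    obtain k where k: "k < Suc n" "s \<in> {real k * T / real (Suc n)<..real (Suc k) * T / real (Suc n)}"
      using grid_cell[OF T _ s, of "Suc n"] by auto
    define u where "u = real k * T / real (Suc n)"
    have "real (Suc k) * T = real k * T + T" by (simp add: algebra_simps)
    then have "real (Suc k) * T / real (Suc n) = u + T / real (Suc n)"
      by (simp only: u_def add_divide_distrib)
    then have "u < s" "s < u + d" using k(2) Td by (auto simp: u_def)
    then have "dist u s < d" by (simp add: dist_real_def)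
    moreover have "u \<in> {0..T}" using \<open>u < s\<close> s T by (auto simp: u_def)
    ultimately show "norm (path_step T (Suc n) f s - f s) < r"
      using d(2) path_step_eq[OF T k] by (simp add: dist_real_def u_def)
  qed
qed

lemma path_step_bounded:
  assumes "0 < T" and "\<And>u. u \<in> {0..T} \<Longrightarrow> \<bar>f u\<bar> \<le> B" and "0 \<le> B"
  shows "\<bar>path_step T (Suc n) f s\<bar> \<le> B"
proof (cases "0 < s \<and> s \<le> T")
  case True
  then obtain k where k: "k < Suc n" "s \<in> {real k * T / real (Suc n)<..real (Suc k) * T / real (Suc n)}"
    using grid_cell[OF assms(1), of "Suc n" s] by auto
  have "real k * T / real (Suc n) \<in> {0..T}" using k(2) True assms(1) by auto
  then show ?thesis using path_step_eq[OF assms(1) k] assms(2) by simp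
next
  case False
  have "s \<notin> {real k * T / real (Suc n)<..real (Suc k) * T / real (Suc n)}" if "k < Suc n" for k
  proof -
    have "real (Suc k) * T / real (Suc n) \<le> T" "0 \<le> real k * T / real (Suc n)"
      using that assms(1) by (auto simp: field_simps mult_right_mono simp flip: of_nat_Suc)
    then show ?thesis using False by auto
  qed
  then have "path_step T (Suc n) f s = 0" unfolding path_step_def by (intro sum.neutral) (auto simp: indicator_def)
  then show ?thesis using assms by simp
qed

text \<open>Dominated convergence with the constant \<open>(2 * B) ^ p\<close>, where
  \<open>B\<close> bounds the path on \<open>[0, T]\<close>. The time 0 lies in no cell and is
  discarded as a null set.\<close>

lemma path_step_L:
  assumes T: "0 < T" and f: "continuous_on {0..T} f" and p: "0 < p"
  shows "(\<lambda>n. \<integral>s. indicator {0..T} s * \<bar>path_step T (Suc n) f s - f s\<bar> ^ p \<partial>lborel) \<longlonglongrightarrow> 0"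
    "integrable lborel (\<lambda>s. indicator {0..T} s * \<bar>path_step T (Suc n) f s - f s\<bar> ^ p)"
proof -
  have "compact (f ` {0..T})" using f by (intro compact_continuous_image) auto
  then have "bounded (f ` {0..T})" by (rule compact_imp_bounded)
  then obtain B0 where B0: "\<And>u. u \<in> {0..T} \<Longrightarrow> \<bar>f u\<bar> \<le> B0"
    unfolding bounded_iff real_norm_def by blast
  define B where "B = \<bar>B0\<bar>"
  have B: "\<And>u. u \<in> {0..T} \<Longrightarrow> \<bar>f u\<bar> \<le> B" "0 \<le> B" using B0 by (force simp: B_def)+
  have fm: "(\<lambda>s. indicator {0..T} s * f s) \<in> borel_measurable borel"
    using borel_measurable_continuous_on_indicator[OF _ f] by simp
  have eq: "indicator {0..T} s * \<bar>path_step T (Suc n) f s - f s\<bar> ^ p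
      = indicator {0..T} s * \<bar>path_step T (Suc n) f s - indicator {0..T} s * f s\<bar> ^ p" for s n
    by (auto simp: indicator_def)
  have m: "(\<lambda>s. indicator {0..T} s * \<bar>path_step T (Suc n) f s - f s\<bar> ^ p) \<in> borel_measurable lborel" for n
    unfolding eq using fm by measurable
  have w: "integrable lborel (\<lambda>s. indicator {0..T} s * (2 * B) ^ p :: real)"
    by (intro integrable_mult_left integrable_real_indicator) (auto simp: emeasure_lborel_Icc_eq)
  have dom: "norm (indicator {0..T} s * \<bar>path_step T (Suc n) f s - f s\<bar> ^ p) \<le> indicator {0..T} s * (2 * B) ^ p" for s n
  proof (cases "s \<in> {0..T}")
    case True
    have "\<bar>path_step T (Suc n) f s - f s\<bar> \<le> 2 * B"
      using B(1)[OF True] path_step_bounded[of T f B n s, OF T B] by linarith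
    from power_mono[OF this abs_ge_zero, of p] show ?thesis using True by simp
  qed simp
  have lim: "(\<lambda>n. indicator {0..T} s * \<bar>path_step T (Suc n) f s - f s\<bar> ^ p) \<longlonglongrightarrow> 0" if "s \<noteq> 0" for s
  proof (cases "s \<in> {0..T}")
    case True
    then have "(\<lambda>n. indicator {0..T} s * \<bar>path_step T (Suc n) f s - f s\<bar> ^ p) \<longlonglongrightarrow> indicator {0..T} s * \<bar>f s - f s\<bar> ^ p"
      using that by (intro tendsto_intros path_step_tendsto[OF T f]) auto
    then show ?thesis using p by (simp add: zero_power)
  qed simp
  have ae: "AE s in lborel. (\<lambda>n. indicator {0..T} s * \<bar>path_step T (Suc n) f s - f s\<bar> ^ p) \<longlonglongrightarrow> 0"
    using AE_lborel_singleton[of 0] by (rule AE_mp) (use lim in \<open>intro AE_I2, blast\<close>)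
  have d: "AE s in lborel. norm (indicator {0..T} s * \<bar>path_step T (Suc n) f s - f s\<bar> ^ p) \<le> indicator {0..T} s * (2 * B) ^ p" for n
    using dom by (intro AE_I2)
  show "integrable lborel (\<lambda>s. indicator {0..T} s * \<bar>path_step T (Suc n) f s - f s\<bar> ^ p)"
    by (rule Bochner_Integration.integrable_bound[OF w m])
      (intro AE_I2 order_trans[OF dom], simp only: real_norm_def abs_ge_self)
  have "(\<lambda>n. \<integral>s. indicator {0..T} s * \<bar>path_step T (Suc n) f s - f s\<bar> ^ p \<partial>lborel) \<longlonglongrightarrow> (\<integral>s. 0 \<partial>(lborel :: real measure))"
    by (rule integral_dominated_convergence[where w = "\<lambda>s. indicator {0..T} s * (2 * B) ^ p"]) (use m w ae d in auto)
  then show "(\<lambda>n. \<integral>s. indicator {0..T} s * \<bar>path_step T (Suc n) f s - f s\<bar> ^ p \<partial>lborel) \<longlonglongrightarrow> 0"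
    by simp
qed

text \<open>Writes a left-endpoint Riemann sum as an integral, so that its distance to the integral
  along the path is controlled by \<open>path_step_L\<close>. It serves both the drift and the
  occupation integral.\<close>

lemma path_step_integral:
  assumes T: "0 < T" and N: "0 < N" and ij: "i \<le> j" "j \<le> N"
  shows "has_bochner_integral lborel (\<lambda>s. indicator {real i * T / real N<..real j * T / real N} s * path_step T N f s)
    (\<Sum>k=i..<j. f (real k * T / real N) * (T / real N))"
proof -
  let ?t = "\<lambda>k. real k * T / real N"
  have mono: "k \<le> l \<Longrightarrow> ?t k \<le> ?t l" for k l using T by (intro divide_right_mono mult_right_mono) auto
  have "has_bochner_integral lborel (\<lambda>s. \<Sum>k=i..<j. f (?t k) * indicator {?t k<..?t (Suc k)} s)
      (\<Sum>k=i..<j. f (?t k) * (T / real N))"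
  proof (intro has_bochner_integral_sum has_bochner_integral_mult_right)
    fix k
    have "?t (Suc k) - ?t k = T / real N" using N by (simp add: field_simps)
    then show "has_bochner_integral lborel (indicator {?t k<..?t (Suc k)}) (T / real N)"
      using has_bochner_integral_real_indicator[of "{?t k<..?t (Suc k)}" lborel] mono[of k "Suc k"] by simp
  qed
  moreover have "(\<Sum>k=i..<j. f (?t k) * indicator {?t k<..?t (Suc k)} s) = indicator {?t i<..?t j} s * path_step T N f s" for s
  proof -
    have *: "indicator {?t i<..?t j} s * (f (?t k) * indicator {?t k<..?t (Suc k)} s) =
       (if k \<in> {i..<j} then f (?t k) * indicator {?t k<..?t (Suc k)} s else 0)" for k
    proof (cases "k \<in> {i..<j}")
      case True
      then have "{?t k<..?t (Suc k)} \<subseteq> {?t i<..?t j}" using mono[of i k] mono[of "Suc k" j] by auto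
      then show ?thesis using True by (auto simp: indicator_def)
    next
      case False
      then have "Suc k \<le> i \<or> j \<le> k" by auto
      then have "{?t k<..?t (Suc k)} \<inter> {?t i<..?t j} = {}" using mono[of "Suc k" i] mono[of j k] by auto
      then show ?thesis using False by (auto simp: indicator_def)
    qed
    have "indicator {?t i<..?t j} s * path_step T N f s = (\<Sum>k<N. if k \<in> {i..<j} then f (?t k) * indicator {?t k<..?t (Suc k)} s else 0)"
      unfolding path_step_def sum_distrib_left by (intro sum.cong refl *)
    also have "\<dots> = (\<Sum>k=i..<j. f (?t k) * indicator {?t k<..?t (Suc k)} s)"
      by (rule sum.mono_neutral_cong_right) (use ij in auto)
    finally show ?thesis by simp
  qed
  ultimately show ?thesis by simp
qed

section \<open>One Euler step in expectation\<close>

context wiener_space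
begin

text \<open>The class of coefficients that may stand in front of powers of a later Wiener increment:
  it is closed under sums and products, and all its members are integrable.\<close>

definition bounded_at :: "real \<Rightarrow> ('w \<Rightarrow> real) \<Rightarrow> bool" where
  "bounded_at s U \<longleftrightarrow> U \<in> borel_measurable (F s) \<and> (\<exists>C. \<forall>\<omega>\<in>space M. \<bar>U \<omega>\<bar> \<le> C)"

lemma bounded_at_const: "bounded_at s (\<lambda>_. c)"
  by (auto simp: bounded_at_def)

lemma bounded_at_add: "bounded_at s U \<Longrightarrow> bounded_at s V \<Longrightarrow> bounded_at s (\<lambda>\<omega>. U \<omega> + V \<omega>)"
proof -
  assume *: "bounded_at s U" "bounded_at s V"
  then obtain C D where "\<forall>\<omega>\<in>space M. \<bar>U \<omega>\<bar> \<le> C" "\<forall>\<omega>\<in>space M. \<bar>V \<omega>\<bar> \<le> D" unfolding bounded_at_def by blast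
  then have "\<forall>\<omega>\<in>space M. \<bar>U \<omega> + V \<omega>\<bar> \<le> C + D" by (meson abs_triangle_ineq add_mono order_trans)
  with * show ?thesis unfolding bounded_at_def by auto
qed

lemma bounded_at_mult: "bounded_at s U \<Longrightarrow> bounded_at s V \<Longrightarrow> bounded_at s (\<lambda>\<omega>. U \<omega> * V \<omega>)"
proof -
  assume *: "bounded_at s U" "bounded_at s V"
  then obtain C D where "\<forall>\<omega>\<in>space M. \<bar>U \<omega>\<bar> \<le> C" "\<forall>\<omega>\<in>space M. \<bar>V \<omega>\<bar> \<le> D" unfolding bounded_at_def by blast
  then have "\<forall>\<omega>\<in>space M. \<bar>U \<omega> * V \<omega>\<bar> \<le> C * D"
    unfolding abs_mult by (meson abs_ge_zero mult_mono order_trans)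
  with * show ?thesis unfolding bounded_at_def by auto
qed

lemma bounded_at_divide: "bounded_at s U \<Longrightarrow> bounded_at s (\<lambda>\<omega>. U \<omega> / c)"
  using bounded_at_mult[OF _ bounded_at_const[of s "1 / c"], of U] by simp

lemma bounded_at_power: "bounded_at s U \<Longrightarrow> bounded_at s (\<lambda>\<omega>. U \<omega> ^ k)"
  by (induction k) (simp_all add: bounded_at_const bounded_at_mult)

lemma bounded_at_compose:
  assumes "U \<in> borel_measurable (F s)" "h \<in> borel_measurable borel" "\<And>y. \<bar>h y\<bar> \<le> B"
  shows "bounded_at s (\<lambda>\<omega>. h (U \<omega>))"
  using assms by (auto simp: bounded_at_def)

lemma bounded_at_integrable: "bounded_at s U \<Longrightarrow> integrable M U"
proof -
  assume U: "bounded_at s U"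
  then obtain C where "\<forall>\<omega>\<in>space M. \<bar>U \<omega>\<bar> \<le> C" unfolding bounded_at_def by blast
  moreover have "U \<in> borel_measurable M" using U unfolding bounded_at_def by (blast intro: measurable_F_M)
  ultimately show ?thesis by (intro integrable_const_bound[of _ C] AE_I2) auto
qed

lemmas bounded_at_intros = bounded_at_const bounded_at_add bounded_at_mult bounded_at_divide bounded_at_power

text \<open>Taylor's bound is applied to the sum of a drift part and a Wiener part, multiplied by
  \<open>Z \<ge> 0\<close>, and integrated using independence of the increment from time
  \<open>s\<close>. The linear Wiener term has mean zero and the square contributes the second-order
  part of the generator. The error consists of \<open>\<eta>\<close> per unit time and of terms
  quadratic in the step length, which vanish after summation over a fine grid; 24 is 8 times the
  factor 3 of the Gaussian fourth moment.\<close>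

lemma expectation_taylor_step:
  fixes h h1 h2 :: "real \<Rightarrow> real"
  assumes st: "0 \<le> s" "s \<le> t" and K: "0 \<le> K" and \<eta>: "0 \<le> \<eta>" and C: "0 \<le> C"
    and m: "U \<in> borel_measurable (F s)" "Z \<in> borel_measurable (F s)" "\<alpha> \<in> borel_measurable (F s)" "\<beta> \<in> borel_measurable (F s)"
    and Z: "\<And>\<omega>. \<omega> \<in> space M \<Longrightarrow> 0 \<le> Z \<omega>" "\<And>\<omega>. \<omega> \<in> space M \<Longrightarrow> Z \<omega> \<le> K"
    and \<alpha>\<beta>: "\<And>\<omega>. \<omega> \<in> space M \<Longrightarrow> \<bar>\<alpha> \<omega>\<bar> \<le> K" "\<And>\<omega>. \<omega> \<in> space M \<Longrightarrow> \<bar>\<beta> \<omega>\<bar> \<le> K"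
    and hm: "h \<in> borel_measurable borel" "h1 \<in> borel_measurable borel" "h2 \<in> borel_measurable borel"
    and hb: "\<And>y. \<bar>h y\<bar> \<le> K" "\<And>y. \<bar>h1 y\<bar> \<le> K" "\<And>y. \<bar>h2 y\<bar> \<le> K"
    and taylor: "\<And>y d. h (y + d) - h y \<le> h1 y * d + h2 y * d\<^sup>2 / 2 + \<eta> * d\<^sup>2 + C * d ^ 4"
  shows "expectation (\<lambda>\<omega>. Z \<omega> * h (U \<omega> + \<beta> \<omega> * (t - s) + \<alpha> \<omega> * (W t \<omega> - W s \<omega>)))
    \<le> expectation (\<lambda>\<omega>. Z \<omega> * h (U \<omega>))
      + (t - s) * expectation (\<lambda>\<omega>. Z \<omega> * (h1 (U \<omega>) * \<beta> \<omega> + h2 (U \<omega>) * (\<alpha> \<omega>)\<^sup>2 / 2))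
      + (\<eta> * K ^ 3 * (t - s) + ((K / 2 + \<eta>) * K ^ 3 + 24 * C * K ^ 5 + 8 * C * K ^ 5 * (t - s)\<^sup>2) * (t - s)\<^sup>2)"
proof -
  define \<delta> where "\<delta> = t - s"
  have \<delta>: "0 \<le> \<delta>" using st by (simp add: \<delta>_def)
  define V where "V \<omega> = W t \<omega> - W s \<omega>" for \<omega>
  \<comment> \<open>\<open>U0\<close>, \<open>U1\<close>, \<open>U2\<close> and \<open>U4\<close>
    are the coefficients of the powers 0, 1, 2 and 4 of the increment in the upper bound, apart from
    the term \<open>Z * h U\<close>. All are known at time \<open>s\<close>.\<close>
  define U0 where "U0 \<omega> = Z \<omega> * (h1 (U \<omega>) * \<beta> \<omega> * \<delta> + (h2 (U \<omega>) / 2 + \<eta>) * (\<beta> \<omega>)\<^sup>2 * \<delta>\<^sup>2) + 8 * C * Z \<omega> * \<beta> \<omega> ^ 4 * \<delta> ^ 4" for \<omega>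
  define U1 where "U1 \<omega> = Z \<omega> * (h1 (U \<omega>) * \<alpha> \<omega> + (h2 (U \<omega>) + 2 * \<eta>) * \<beta> \<omega> * \<alpha> \<omega> * \<delta>)" for \<omega>
  define U2 where "U2 \<omega> = Z \<omega> * (h2 (U \<omega>) / 2 + \<eta>) * (\<alpha> \<omega>)\<^sup>2" for \<omega>
  define U4 where "U4 \<omega> = 8 * C * Z \<omega> * \<alpha> \<omega> ^ 4" for \<omega>
  define L where "L \<omega> = Z \<omega> * (h1 (U \<omega>) * \<beta> \<omega> + h2 (U \<omega>) * (\<alpha> \<omega>)\<^sup>2 / 2)" for \<omega>
  define err where "err = \<eta> * K ^ 3 * \<delta> + ((K / 2 + \<eta>) * K ^ 3 + 24 * C * K ^ 5 + 8 * C * K ^ 5 * \<delta>\<^sup>2) * \<delta>\<^sup>2"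
  have bZ: "bounded_at s Z" using m(2) Z by (auto simp: bounded_at_def intro!: exI[of _ K])
  have b\<alpha>: "bounded_at s \<alpha>" "bounded_at s \<beta>" using m \<alpha>\<beta> by (auto simp: bounded_at_def)
  have bh: "bounded_at s (\<lambda>\<omega>. h (U \<omega>))" "bounded_at s (\<lambda>\<omega>. h1 (U \<omega>))" "bounded_at s (\<lambda>\<omega>. h2 (U \<omega>))"
    using bounded_at_compose[OF m(1) hm(1) hb(1)] bounded_at_compose[OF m(1) hm(2) hb(2)]
      bounded_at_compose[OF m(1) hm(3) hb(3)] by auto
  have bU: "bounded_at s U0" "bounded_at s U1" "bounded_at s U2" "bounded_at s U4" "bounded_at s L"
    unfolding U0_def[abs_def] U1_def[abs_def] U2_def[abs_def] U4_def[abs_def] L_def[abs_def]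
    by (intro bounded_at_intros bZ b\<alpha> bh)+
  have bZh: "bounded_at s (\<lambda>\<omega>. Z \<omega> * h (U \<omega>))" by (intro bounded_at_intros bZ bh)
  note int = bounded_at_integrable
  have bm: "U1 \<in> borel_measurable (F s)" "U2 \<in> borel_measurable (F s)" "U4 \<in> borel_measurable (F s)"
    using bU unfolding bounded_at_def by blast+
  have prodI: "has_bochner_integral M (\<lambda>\<omega>. U1 \<omega> * V \<omega>) 0"
    "has_bochner_integral M (\<lambda>\<omega>. U2 \<omega> * (V \<omega>)\<^sup>2) (\<delta> * expectation U2)"
    "has_bochner_integral M (\<lambda>\<omega>. U4 \<omega> * (V \<omega>) ^ 4) (3 * \<delta>\<^sup>2 * expectation U4)"
    unfolding V_def \<delta>_def
    by (rule increment_product[OF st]; (rule int[OF bU(2)] int[OF bU(3)] int[OF bU(4)] bm))+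
  have I: "has_bochner_integral M (\<lambda>\<omega>. Z \<omega> * h (U \<omega>) + U0 \<omega> + U1 \<omega> * V \<omega> + U2 \<omega> * (V \<omega>)\<^sup>2 + U4 \<omega> * (V \<omega>) ^ 4)
      (expectation (\<lambda>\<omega>. Z \<omega> * h (U \<omega>)) + expectation U0 + 0 + \<delta> * expectation U2 + 3 * \<delta>\<^sup>2 * expectation U4)"
    by (intro has_bochner_integral_add prodI has_bochner_integral_integrable int[of s] bZh bU)
  have pt: "Z \<omega> * h (U \<omega> + \<beta> \<omega> * \<delta> + \<alpha> \<omega> * V \<omega>)
      \<le> Z \<omega> * h (U \<omega>) + U0 \<omega> + U1 \<omega> * V \<omega> + U2 \<omega> * (V \<omega>)\<^sup>2 + U4 \<omega> * (V \<omega>) ^ 4" if \<omega>: "\<omega> \<in> space M" for \<omega>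
  proof -
    define p q where "p = \<beta> \<omega> * \<delta>" and "q = \<alpha> \<omega> * V \<omega>"
    \<comment> \<open>Separating the fourth powers by convexity leaves no third power of the
      increment, so the moments of orders 1, 2 and 4 are enough.\<close>
    have "(p + q) ^ 4 \<le> 8 * (p ^ 4 + q ^ 4)"
    proof -
      have 1: "(p + q)\<^sup>2 \<le> 2 * (p\<^sup>2 + q\<^sup>2)"
        using sum_squares_bound[of p q] by (simp add: power2_sum)
      have 2: "(p\<^sup>2 + q\<^sup>2)\<^sup>2 \<le> 2 * ((p\<^sup>2)\<^sup>2 + (q\<^sup>2)\<^sup>2)"
        using sum_squares_bound[of "p\<^sup>2" "q\<^sup>2"] by (simp add: power2_sum)
      have "((p + q)\<^sup>2)\<^sup>2 \<le> (2 * (p\<^sup>2 + q\<^sup>2))\<^sup>2" using 1 by (rule power_mono) simp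
      then have "((p + q)\<^sup>2)\<^sup>2 \<le> 4 * (p\<^sup>2 + q\<^sup>2)\<^sup>2" by (simp only: power_mult_distrib) simp
      then show ?thesis using 2 by (simp flip: power_mult)
    qed
    then have "C * (p + q) ^ 4 \<le> C * (8 * (p ^ 4 + q ^ 4))" using C by (rule mult_left_mono)
    with taylor[of "U \<omega>" "p + q"]
    have "h (U \<omega> + (p + q)) \<le> h (U \<omega>) + (h1 (U \<omega>) * (p + q) + h2 (U \<omega>) * (p + q)\<^sup>2 / 2 + \<eta> * (p + q)\<^sup>2 + C * (8 * (p ^ 4 + q ^ 4)))"
      by linarith
    then have "Z \<omega> * h (U \<omega> + (p + q)) \<le> Z \<omega> * (h (U \<omega>) + (h1 (U \<omega>) * (p + q) + h2 (U \<omega>) * (p + q)\<^sup>2 / 2 + \<eta> * (p + q)\<^sup>2 + C * (8 * (p ^ 4 + q ^ 4))))"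
      using Z(1)[OF \<omega>] by (rule mult_left_mono)
    also have "\<dots> = Z \<omega> * h (U \<omega>) + U0 \<omega> + U1 \<omega> * V \<omega> + U2 \<omega> * (V \<omega>)\<^sup>2 + U4 \<omega> * (V \<omega>) ^ 4"
      unfolding U0_def U1_def U2_def U4_def p_def q_def by (simp add: field_simps power2_eq_square power4_eq_xxxx)
    finally show ?thesis by (simp add: p_def q_def add.assoc)
  qed
  have [measurable]: "W s \<in> borel_measurable M" "W t \<in> borel_measurable M" using st by (auto intro!: W_borel)
  note m[THEN measurable_F_M, measurable] hm[measurable]
  have "(\<lambda>\<omega>. h (U \<omega> + \<beta> \<omega> * \<delta> + \<alpha> \<omega> * V \<omega>)) \<in> borel_measurable M"
    unfolding V_def by measurable
  then have "integrable M (\<lambda>\<omega>. h (U \<omega> + \<beta> \<omega> * \<delta> + \<alpha> \<omega> * V \<omega>) * Z \<omega>)"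
    by (intro integrable_const_bound[of _ "K * K"])
      (use m[THEN measurable_F_M] Z hb(1) K in \<open>auto simp: abs_mult intro!: AE_I2 mult_mono\<close>)
  then have "expectation (\<lambda>\<omega>. Z \<omega> * h (U \<omega> + \<beta> \<omega> * \<delta> + \<alpha> \<omega> * V \<omega>))
     \<le> expectation (\<lambda>\<omega>. Z \<omega> * h (U \<omega>) + U0 \<omega> + U1 \<omega> * V \<omega> + U2 \<omega> * (V \<omega>)\<^sup>2 + U4 \<omega> * (V \<omega>) ^ 4)"
    by (intro integral_mono pt) (use I in \<open>auto simp: has_bochner_integral_iff mult.commute\<close>)
  also have "\<dots> = expectation (\<lambda>\<omega>. Z \<omega> * h (U \<omega>)) + (expectation U0 + \<delta> * expectation U2 + 3 * \<delta>\<^sup>2 * expectation U4)"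
    using I by (simp add: has_bochner_integral_iff)
  also have "expectation U0 + \<delta> * expectation U2 + 3 * \<delta>\<^sup>2 * expectation U4
      = expectation (\<lambda>\<omega>. U0 \<omega> + \<delta> * U2 \<omega> + 3 * \<delta>\<^sup>2 * U4 \<omega>)"
    using int[OF bU(1)] int[OF bU(3)] int[OF bU(4)] by simp
  also have "\<dots> \<le> expectation (\<lambda>\<omega>. \<delta> * L \<omega> + err)"
  proof (rule integral_mono)
    fix \<omega> assume \<omega>: "\<omega> \<in> space M"
    have \<alpha>2: "(\<alpha> \<omega>)\<^sup>2 \<le> K\<^sup>2" "(\<beta> \<omega>)\<^sup>2 \<le> K\<^sup>2" "\<alpha> \<omega> ^ 4 \<le> K ^ 4" "\<beta> \<omega> ^ 4 \<le> K ^ 4"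
      using power_mono[OF \<alpha>\<beta>(1)[OF \<omega>], of 2] power_mono[OF \<alpha>\<beta>(2)[OF \<omega>], of 2]
        power_mono[OF \<alpha>\<beta>(1)[OF \<omega>], of 4] power_mono[OF \<alpha>\<beta>(2)[OF \<omega>], of 4] by (auto simp: power_even_abs)
    have K3: "K * K\<^sup>2 = K ^ 3" "K * K ^ 4 = K ^ 5" by (simp_all add: eval_nat_numeral)
    have e1: "Z \<omega> * (\<alpha> \<omega>)\<^sup>2 \<le> K ^ 3" "Z \<omega> * (\<beta> \<omega>)\<^sup>2 \<le> K ^ 3" "Z \<omega> * \<alpha> \<omega> ^ 4 \<le> K ^ 5" "Z \<omega> * \<beta> \<omega> ^ 4 \<le> K ^ 5"
      unfolding K3[symmetric] using Z[OF \<omega>] K \<alpha>2 by (auto intro!: mult_mono)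
    have e2: "(h2 (U \<omega>) / 2 + \<eta>) * (Z \<omega> * (\<beta> \<omega>)\<^sup>2) \<le> (K / 2 + \<eta>) * K ^ 3"
      using hb(3)[of "U \<omega>"] e1(2) Z(1)[OF \<omega>] K \<eta> by (intro mult_mono) (auto simp: abs_le_iff)
    have "U0 \<omega> + \<delta> * U2 \<omega> + 3 * \<delta>\<^sup>2 * U4 \<omega> = \<delta> * L \<omega> + \<eta> * \<delta> * (Z \<omega> * (\<alpha> \<omega>)\<^sup>2)
       + ((h2 (U \<omega>) / 2 + \<eta>) * (Z \<omega> * (\<beta> \<omega>)\<^sup>2)) * \<delta>\<^sup>2 + 24 * C * \<delta>\<^sup>2 * (Z \<omega> * \<alpha> \<omega> ^ 4) + 8 * C * \<delta> ^ 4 * (Z \<omega> * \<beta> \<omega> ^ 4)"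
      unfolding U0_def U2_def U4_def L_def by (simp add: field_simps power2_eq_square power4_eq_xxxx)
    also have "\<dots> \<le> \<delta> * L \<omega> + \<eta> * \<delta> * K ^ 3
       + ((K / 2 + \<eta>) * K ^ 3) * \<delta>\<^sup>2 + 24 * C * \<delta>\<^sup>2 * K ^ 5 + 8 * C * \<delta> ^ 4 * K ^ 5"
      using e1 e2 \<eta> \<delta> C by (intro add_mono mult_left_mono mult_right_mono order_refl) auto
    also have "\<dots> = \<delta> * L \<omega> + err"
      unfolding err_def by (simp add: algebra_simps power2_eq_square power4_eq_xxxx)
    finally show "U0 \<omega> + \<delta> * U2 \<omega> + 3 * \<delta>\<^sup>2 * U4 \<omega> \<le> \<delta> * L \<omega> + err" .
  qed (use int[OF bU(1)] int[OF bU(3)] int[OF bU(4)] int[OF bU(5)] in auto)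
  also have "\<dots> = \<delta> * expectation L + err" using int[OF bU(5)] by (simp add: prob_space)
  finally show ?thesis unfolding L_def[abs_def] err_def \<delta>_def V_def by simp
qed

lemma prob_tendsto_0:
  assumes "\<And>n. Q n \<in> borel_measurable M" "\<And>\<omega>. \<omega> \<in> space M \<Longrightarrow> (\<lambda>n. Q n \<omega>) \<longlonglongrightarrow> (0::real)" "0 < \<epsilon>"
  shows "(\<lambda>n. prob {\<omega> \<in> space M. Q n \<omega> > \<epsilon>}) \<longlonglongrightarrow> 0"
proof -
  note assms(1)[measurable]
  have "(\<lambda>n. expectation (indicator {\<omega> \<in> space M. Q n \<omega> > \<epsilon>})) \<longlonglongrightarrow> expectation (\<lambda>_. 0 :: real)"
  proof (rule integral_dominated_convergence[where w = "\<lambda>_. 1"])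
    show "AE \<omega> in M. (\<lambda>n. indicat_real {\<omega> \<in> space M. Q n \<omega> > \<epsilon>} \<omega>) \<longlonglongrightarrow> 0"
    proof (rule AE_I2)
      fix \<omega> assume "\<omega> \<in> space M"
      from order_tendstoD(2)[OF assms(2)[OF this] assms(3)]
      have "\<forall>\<^sub>F n in sequentially. indicat_real {\<omega> \<in> space M. Q n \<omega> > \<epsilon>} \<omega> = 0"
        by (rule eventually_mono) simp
      then show "(\<lambda>n. indicat_real {\<omega> \<in> space M. Q n \<omega> > \<epsilon>} \<omega>) \<longlonglongrightarrow> 0"
        by (rule tendsto_eventually)
    qed
    show "AE \<omega> in M. norm (indicat_real {\<omega> \<in> space M. Q n \<omega> > \<epsilon>} \<omega>) \<le> 1" for n
      by (auto simp: indicator_def)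
  qed auto
  moreover have "expectation (indicat_real {\<omega> \<in> space M. Q n \<omega> > \<epsilon>}) = prob {\<omega> \<in> space M. Q n \<omega> > \<epsilon>}" for n
    by (simp add: Int_absorb2 subset_eq)
  ultimately show ?thesis by simp
qed

end

section \<open>A diffusion with everywhere continuous paths\<close>

text \<open>Continuity holds for every \<open>\<omega>\<close>, which is reached by changing a
  solution on a null set. The integrand \<open>A\<close> is kept apart from \<open>a\<close> along
  \<open>X\<close> because the given Ito integral belongs to the unchanged solution; the two agree
  almost surely for all times.\<close>

locale regular_diffusion = wiener_space M F W
  for M :: "'w measure" and F :: "real \<Rightarrow> 'w measure" and W :: "real \<Rightarrow> 'w \<Rightarrow> real" +
  fixes a b :: "real \<Rightarrow> real" and X A I :: "real \<Rightarrow> 'w \<Rightarrow> real" and x :: real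
  assumes cont_a: "continuous_on UNIV a" and cont_b: "continuous_on UNIV b"
    and X_adapted: "\<And>t. 0 \<le> t \<Longrightarrow> X t \<in> borel_measurable (F t)"
    and X_cont: "\<And>\<omega>. \<omega> \<in> space M \<Longrightarrow> continuous_on {0..} (\<lambda>t. X t \<omega>)"
    and ito: "is_ito_integral M F W A I"
    and A_eq: "AE \<omega> in M. \<forall>s\<ge>0. A s \<omega> = a (X s \<omega>)"
    and sde: "AE \<omega> in M. \<forall>t\<ge>0. X t \<omega> = x + (\<integral>s\<in>{0..t}. b (X s \<omega>) \<partial>lborel) + I t \<omega>"
begin

lemma X_measurable: "0 \<le> s \<Longrightarrow> s \<le> t \<Longrightarrow> X s \<in> borel_measurable (F t)"
  by (rule measurable_F_mono[OF _ X_adapted])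

lemma X_borel [measurable]: "0 \<le> s \<Longrightarrow> X s \<in> borel_measurable M"
  by (rule measurable_F_M[OF X_adapted])

lemma a_measurable [measurable]: "a \<in> borel_measurable borel" and b_measurable [measurable]: "b \<in> borel_measurable borel"
  using cont_a cont_b by (auto intro: borel_measurable_continuous_onI)

text \<open>A continuous adapted process is progressively measurable: rounding the time down to a
  multiple of \<open>1 / (n + 1)\<close> leaves countably many random variables, each known at
  \<open>T\<close> thanks to the clamp to \<open>[0, T]\<close>, and continuity of the path gives
  convergence.\<close>

lemma X_joint:
  assumes T: "0 \<le> T"
  shows "(\<lambda>p. X (max 0 (min T (snd p))) (fst p)) \<in> borel_measurable (F T \<Otimes>\<^sub>M borel)"
proof (rule borel_measurable_LIMSEQ_real)
  fix n :: nat
  define X' where "X' i p = X (max 0 (min T (of_int i / real (Suc n)))) (fst p)" for i :: int and p :: "'w \<times> real"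
  have "(\<lambda>p. X' \<lfloor>real (Suc n) * snd p\<rfloor> p) \<in> borel_measurable (F T \<Otimes>\<^sub>M borel)"
  proof (rule measurable_compose_countable)
    show "X' i \<in> borel_measurable (F T \<Otimes>\<^sub>M borel)" for i
      unfolding X'_def[abs_def] using T by (intro measurable_compose[OF measurable_fst X_measurable]) auto
  qed measurable
  then show "(\<lambda>p. X (max 0 (min T (of_int \<lfloor>real (Suc n) * snd p\<rfloor> / real (Suc n)))) (fst p)) \<in> borel_measurable (F T \<Otimes>\<^sub>M borel)"
    by (simp add: X'_def[abs_def])
next
  fix p :: "'w \<times> real" assume "p \<in> space (F T \<Otimes>\<^sub>M borel)"
  then have \<omega>: "fst p \<in> space M" by (auto simp: space_pair_measure space_F)
  have "(\<lambda>n. of_int \<lfloor>real (Suc n) * snd p\<rfloor> / real (Suc n)) \<longlonglongrightarrow> snd p"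
  proof (rule tendsto_sandwich)
    have *: "real (Suc n) * snd p - 1 \<le> of_int \<lfloor>real (Suc n) * snd p\<rfloor>" "of_int \<lfloor>real (Suc n) * snd p\<rfloor> \<le> real (Suc n) * snd p" for n
      by linarith+
    show "\<forall>\<^sub>F n in sequentially. snd p - 1 / real (Suc n) \<le> of_int \<lfloor>real (Suc n) * snd p\<rfloor> / real (Suc n)"
    proof (intro always_eventually allI)
      fix n
      have "(real (Suc n) * snd p - 1) / real (Suc n) \<le> of_int \<lfloor>real (Suc n) * snd p\<rfloor> / real (Suc n)"
        by (intro divide_right_mono *) simp
      then show "snd p - 1 / real (Suc n) \<le> of_int \<lfloor>real (Suc n) * snd p\<rfloor> / real (Suc n)"
        by (simp add: diff_divide_distrib del: of_nat_Suc)
    qed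
    show "\<forall>\<^sub>F n in sequentially. of_int \<lfloor>real (Suc n) * snd p\<rfloor> / real (Suc n) \<le> snd p"
      using *(2) by (intro always_eventually allI) (simp add: field_simps del: of_nat_Suc)
    show "(\<lambda>n. snd p - 1 / real (Suc n)) \<longlonglongrightarrow> snd p"
      using LIMSEQ_inverse_real_of_nat_add_minus[of "snd p"] by (simp add: inverse_eq_divide)
  qed simp
  then have "(\<lambda>n. max 0 (min T (of_int \<lfloor>real (Suc n) * snd p\<rfloor> / real (Suc n)))) \<longlonglongrightarrow> max 0 (min T (snd p))"
    by (intro tendsto_intros)
  from continuous_on_tendsto_compose[OF X_cont[OF \<omega>] this]
  show "(\<lambda>n. X (max 0 (min T (of_int \<lfloor>real (Suc n) * snd p\<rfloor> / real (Suc n)))) (fst p)) \<longlonglongrightarrow> X (max 0 (min T (snd p))) (fst p)"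
    by auto
qed

lemma path_continuous:
  "\<omega> \<in> space M \<Longrightarrow> continuous_on UNIV f \<Longrightarrow> 0 \<le> s \<Longrightarrow> continuous_on {s..t} (\<lambda>u. f (X u \<omega>))"
  by (rule continuous_on_compose2[of UNIV f]) (auto intro: continuous_on_subset[OF X_cont])

end

section \<open>Weak It\^{o} formula by an Euler scheme\<close>

context regular_diffusion
begin

lemma additive_functional_measurable:
  fixes g :: "real \<Rightarrow> real"
  assumes t: "0 \<le> t" and S: "S \<in> sets borel" "S \<subseteq> {0..t}" and g: "g \<in> borel_measurable borel"
  shows "(\<lambda>\<omega>. \<integral>u. indicator S u * g (X u \<omega>) \<partial>lborel) \<in> borel_measurable (F t)"
proof -
  note X_joint[OF t, measurable] g[measurable] S(1)[measurable]
  have "(\<lambda>p. indicator S (snd p) * g (X (max 0 (min t (snd p))) (fst p))) \<in> borel_measurable (F t \<Otimes>\<^sub>M lborel)"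
    by measurable
  then have "(\<lambda>\<omega>. \<integral>u. indicator S u * g (X (max 0 (min t u)) \<omega>) \<partial>lborel) \<in> borel_measurable (F t)"
    by (intro sigma_finite_measure.borel_measurable_lebesgue_integral[OF sigma_finite_lborel]) (simp add: case_prod_beta')
  moreover have "indicator S u * g (X (max 0 (min t u)) \<omega>) = indicator S u * g (X u \<omega>)" for u \<omega>
    using S(2) by (cases "u \<in> S") (auto simp: max_def min_def)
  ultimately show ?thesis by simp
qed

text \<open>Used with \<open>p = 1\<close> for the drift and the occupation integral and with
  \<open>p = 2\<close> for the Ito integral; it is the random sampling error that bounds the error
  of the scheme.\<close>

definition step_error :: "real \<Rightarrow> nat \<Rightarrow> (real \<Rightarrow> real) \<Rightarrow> nat \<Rightarrow> 'w \<Rightarrow> real" where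
  "step_error T N f p \<omega> = (\<integral>s. indicator {0..T} s * \<bar>path_step T N (\<lambda>u. f (X u \<omega>)) s - f (X s \<omega>)\<bar> ^ p \<partial>lborel)"

lemma step_error_measurable:
  assumes T: "0 < T" and f: "f \<in> borel_measurable borel"
  shows "step_error T N f p \<in> borel_measurable M"
proof -
  have T0: "0 \<le> T" using T by simp
  note X_joint[OF T0, measurable] f[measurable]
  have [measurable]: "X (real k * T / real N) \<in> borel_measurable (F T)" if "k < N" for k
    using T that by (intro X_measurable) (auto simp: field_simps)
  have "(\<lambda>q. indicator {0..T} (snd q) * \<bar>path_step T N (\<lambda>u. f (X u (fst q))) (snd q) - f (X (max 0 (min T (snd q))) (fst q))\<bar> ^ p)
      \<in> borel_measurable (F T \<Otimes>\<^sub>M lborel)"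
    unfolding path_step_def by measurable
  then have "(\<lambda>\<omega>. \<integral>s. indicator {0..T} s * \<bar>path_step T N (\<lambda>u. f (X u \<omega>)) s - f (X (max 0 (min T s)) \<omega>)\<bar> ^ p \<partial>lborel) \<in> borel_measurable (F T)"
    by (intro sigma_finite_measure.borel_measurable_lebesgue_integral[OF sigma_finite_lborel]) (simp add: case_prod_beta')
  moreover have "indicator {0..T} s * \<bar>path_step T N (\<lambda>u. f (X u \<omega>)) s - f (X (max 0 (min T s)) \<omega>)\<bar> ^ p
      = indicator {0..T} s * \<bar>path_step T N (\<lambda>u. f (X u \<omega>)) s - f (X s \<omega>)\<bar> ^ p" for s \<omega>
    by (cases "s \<in> {0..T}") (auto simp: max_def min_def)
  ultimately show ?thesis unfolding step_error_def[abs_def] by (simp add: measurable_F_M)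
qed

text \<open>As a product of indicators it is known at the grid time with index \<open>i\<close>, and
  once it is zero it stays zero.\<close>

definition inside :: "real \<Rightarrow> real \<Rightarrow> nat \<Rightarrow> nat \<Rightarrow> 'w \<Rightarrow> real" where
  "inside T R N i \<omega> = (\<Prod>j\<le>i. indicator {- R..R} (X (real j * T / real N) \<omega>))"

text \<open>
  The Euler scheme takes its coefficients from the path of \<open>X\<close>, not from the scheme itself, and is frozen
  once \<open>X\<close> is seen outside \<open>[- R, R]\<close> at a grid point; this keeps the increments bounded in all moments.
\<close>

fun euler :: "real \<Rightarrow> real \<Rightarrow> nat \<Rightarrow> nat \<Rightarrow> 'w \<Rightarrow> real" where
  "euler T R N 0 \<omega> = x"
| "euler T R N (Suc i) \<omega> = euler T R N i \<omega> + inside T R N i \<omega> * b (X (real i * T / real N) \<omega>) * (T / real N)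
     + inside T R N i \<omega> * a (X (real i * T / real N) \<omega>) * (W (real (Suc i) * T / real N) \<omega> - W (real i * T / real N) \<omega>)"

lemma inside_eq: "inside T R N i \<omega> = (if \<forall>j\<le>i. \<bar>X (real j * T / real N) \<omega>\<bar> \<le> R then 1 else 0)"
proof (cases "\<forall>j\<le>i. \<bar>X (real j * T / real N) \<omega>\<bar> \<le> R")
  case True
  then show ?thesis unfolding inside_def by (auto simp: abs_le_iff intro!: prod.neutral)
next
  case False
  then obtain j where j: "j \<le> i" "\<not> \<bar>X (real j * T / real N) \<omega>\<bar> \<le> R" by blast
  have "indicator {- R..R} (X (real j * T / real N) \<omega>) = (0::real)" using j(2) by (auto simp: abs_le_iff indicator_def)
  then have "inside T R N i \<omega> = 0" unfolding inside_def using j(1) by (intro prod_zero) auto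
  with False show ?thesis by auto
qed

lemma inside_range: "0 \<le> inside T R N i \<omega>" "inside T R N i \<omega> \<le> 1"
  by (auto simp: inside_eq)

context
  fixes T R K :: real and N :: nat
  assumes T: "0 < T" and N: "0 < N" and K0: "0 \<le> K"
    and Ka: "\<And>y. \<bar>y\<bar> \<le> R \<Longrightarrow> \<bar>a y\<bar> \<le> K" and Kb: "\<And>y. \<bar>y\<bar> \<le> R \<Longrightarrow> \<bar>b y\<bar> \<le> K"
begin

private abbreviation t where "t i \<equiv> real i * T / real N"
private abbreviation D where "D \<equiv> inside T R N"
private abbreviation Y where "Y \<equiv> euler T R N"
private abbreviation \<alpha> where "\<alpha> i \<omega> \<equiv> D i \<omega> * a (X (t i) \<omega>)"
private abbreviation \<beta> where "\<beta> i \<omega> \<equiv> D i \<omega> * b (X (t i) \<omega>)"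

lemma grid_nonneg: "0 \<le> t i" using T by simp

lemma grid_mono: "i \<le> j \<Longrightarrow> t i \<le> t j" using T by (intro divide_right_mono mult_right_mono) auto

lemma grid_step: "t (Suc i) - t i = T / real N" using N by (simp add: field_simps)

lemma inside_measurable: "D i \<in> borel_measurable (F (t i))"
proof -
  have "(\<lambda>\<omega>. indicator {- R..R} (X (t j) \<omega>)) \<in> borel_measurable (F (t i))" if "j \<le> i" for j
    using X_measurable[OF grid_nonneg grid_mono[OF that]] by measurable
  then show ?thesis unfolding inside_def[abs_def] by (intro borel_measurable_prod) auto
qed

lemma coeff_measurable: "\<alpha> i \<in> borel_measurable (F (t i))" "\<beta> i \<in> borel_measurable (F (t i))"
  using inside_measurable[of i] X_adapted[OF grid_nonneg[of i]] by measurable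

lemma coeff_bounded: "\<bar>\<alpha> i \<omega>\<bar> \<le> K" "\<bar>\<beta> i \<omega>\<bar> \<le> K"
  using Ka[of "X (t i) \<omega>"] Kb[of "X (t i) \<omega>"] K0 by (auto simp: inside_eq)

lemma euler_measurable: "Y i \<in> borel_measurable (F (t i))"
proof (induction i)
  case (Suc i)
  have le: "t i \<le> t (Suc i)" by (rule grid_mono) simp
  have [measurable]: "Y i \<in> borel_measurable (F (t (Suc i)))" "\<alpha> i \<in> borel_measurable (F (t (Suc i)))"
    "\<beta> i \<in> borel_measurable (F (t (Suc i)))" "W (t (Suc i)) \<in> borel_measurable (F (t (Suc i)))"
    "W (t i) \<in> borel_measurable (F (t (Suc i)))"
    by (rule measurable_F_mono[OF le] Suc coeff_measurable W_measurable grid_nonneg le order_refl)+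
  have "Y (Suc i) = (\<lambda>\<omega>. Y i \<omega> + \<beta> i \<omega> * (T / real N) + \<alpha> i \<omega> * (W (t (Suc i)) \<omega> - W (t i) \<omega>))"
    by (rule ext) simp
  then show ?case by (simp only:) measurable
qed simp

text \<open>While the path has stayed inside, the scheme equals \<open>x\<close> plus a left Riemann
  sum of the drift plus the integral of a simple integrand. Subtracting the equation for
  \<open>X\<close> at the same time leaves a drift error and an integral error, each allowed
  \<open>d / 2\<close>; the constant 64 is 16 divided by the square of 1/2.\<close>

lemma euler_error:
  assumes i: "i \<le> N" and pos: "0 < d" "0 < \<eta>"
  shows "prob {\<omega> \<in> space M. D i \<omega> = 1 \<and> \<bar>Y i \<omega> - X (t i) \<omega>\<bar> > d}
    \<le> prob {\<omega> \<in> space M. step_error T N b 1 \<omega> > d / 2} + (prob {\<omega> \<in> space M. step_error T N a 2 \<omega> > \<eta>} + 64 * \<eta> / d\<^sup>2)"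
proof -
  define S where "S = simple_ito_integral W N t \<alpha> (t i)"
  define G where "G = {\<omega> \<in> space M. D i \<omega> = 1}"
  have ti: "t i \<le> T" using i N T by (simp add: field_simps)
  have Dm [measurable]: "D i \<in> borel_measurable M" by (rule measurable_F_M[OF inside_measurable])
  have [measurable]: "Y i \<in> borel_measurable M" by (rule measurable_F_M[OF euler_measurable])
  have Gm: "G \<in> events" unfolding G_def by measurable
  have simple: "simple_integrand M F N t \<alpha>"
    unfolding simple_integrand_def
  proof (intro conjI allI impI)
    show "t k \<le> t (Suc k)" for k by (rule grid_mono) simp
    show "\<exists>C. \<forall>\<omega>\<in>space M. \<bar>\<alpha> k \<omega>\<bar> \<le> C" for k using coeff_bounded(1) by blast
  qed (use coeff_measurable(1) in auto)
  have inG: "D k \<omega> = 1" if "\<omega> \<in> G" "k \<le> i" for k \<omega>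
    using that by (auto simp: G_def inside_eq split: if_splits)
  \<comment> \<open>On \<open>G\<close> no freezing has happened up to the index \<open>i\<close>,
    and later cells begin at \<open>t i\<close> or after it, so they do not contain
    \<open>s\<close>.\<close>
  have stepH: "simple_process N t \<alpha> s \<omega> = path_step T N (\<lambda>u. a (X u \<omega>)) s" if "\<omega> \<in> G" "s \<le> t i" for s \<omega>
    unfolding simple_process_def path_step_def
  proof (intro sum.cong refl)
    fix k
    show "\<alpha> k \<omega> * indicator {t k<..t (Suc k)} s = a (X (t k) \<omega>) * indicator {t k<..t (Suc k)} s"
    proof (cases "k \<le> i")
      case False
      then have "s \<notin> {t k<..t (Suc k)}" using grid_mono[of i k] that by auto
      then show ?thesis by simp
    qed (use inG that in simp)
  qed
  have integ: "integrable lborel (\<lambda>s. indicator {0..T} s * \<bar>path_step T N (\<lambda>u. f (X u \<omega>)) s - f (X s \<omega>)\<bar> ^ p)"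
    if "\<omega> \<in> space M" "continuous_on UNIV f" "0 < p" for \<omega> f p
    using path_step_L(2)[OF T path_continuous[OF that(1,2)] that(3), of "N - 1"] N by simp
  have 1: "prob {\<omega> \<in> G. \<bar>S \<omega> - I (t i) \<omega>\<bar> > d / 2} \<le> prob {\<omega> \<in> space M. step_error T N a 2 \<omega> > \<eta>} + 16 * \<eta> / (d / 2)\<^sup>2"
    unfolding S_def
  proof (rule ito_integral_step_error[OF ito grid_nonneg simple _ pos(2) _ Gm])
    show "AE \<omega> in M. \<omega> \<in> G \<longrightarrow>
        (\<integral>\<^sup>+s\<in>{0..t i}. ennreal ((simple_process N t \<alpha> s \<omega> - A s \<omega>)\<^sup>2) \<partial>lborel) \<le> ennreal (step_error T N a 2 \<omega>)"
      using A_eq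
    proof (rule AE_mp, intro AE_I2 impI)
      fix \<omega> assume \<omega>: "\<omega> \<in> space M" "\<forall>s\<ge>0. A s \<omega> = a (X s \<omega>)" "\<omega> \<in> G"
      have "(\<integral>\<^sup>+s\<in>{0..t i}. ennreal ((simple_process N t \<alpha> s \<omega> - A s \<omega>)\<^sup>2) \<partial>lborel)
        \<le> (\<integral>\<^sup>+s. ennreal (indicator {0..T} s * \<bar>path_step T N (\<lambda>u. a (X u \<omega>)) s - a (X s \<omega>)\<bar> ^ 2) \<partial>lborel)"
        by (rule nn_integral_mono) (use \<omega> ti stepH in \<open>auto simp: indicator_def\<close>)
      also have "\<dots> = ennreal (step_error T N a 2 \<omega>)"
        unfolding step_error_def
        by (rule nn_integral_eq_integral) (use integ[OF \<omega>(1) cont_a, of 2] in auto)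
      finally show "(\<integral>\<^sup>+s\<in>{0..t i}. ennreal ((simple_process N t \<alpha> s \<omega> - A s \<omega>)\<^sup>2) \<partial>lborel) \<le> ennreal (step_error T N a 2 \<omega>)" .
    qed
  qed (use pos step_error_measurable[OF T] in auto)
  from sde obtain Z where Z: "Z \<in> null_sets M"
    "\<And>\<omega>. \<omega> \<in> space M - Z \<Longrightarrow> \<forall>t\<ge>0. X t \<omega> = x + (\<integral>s\<in>{0..t}. b (X s \<omega>) \<partial>lborel) + I t \<omega>"
    by (elim AE_E3) blast
  have Im [measurable]: "I (t i) \<in> borel_measurable M"
  proof -
    have "adapted F I" using ito unfolding is_ito_integral_def by (elim conjE)
    then have "I (t i) \<in> borel_measurable (F (t i))" using grid_nonneg unfolding adapted_def by blast
    then show ?thesis by (rule measurable_F_M)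
  qed
  have Sm [measurable]: "S \<in> borel_measurable M"
    unfolding S_def by (rule simple_ito_integral_borel[OF simple grid_nonneg])
  note step_error_measurable[OF T b_measurable, measurable]
  note Gm[measurable]
  let ?B = "{\<omega> \<in> space M. step_error T N b 1 \<omega> > d / 2}" and ?C = "{\<omega> \<in> G. \<bar>S \<omega> - I (t i) \<omega>\<bar> > d / 2}"
  have "?C = {\<omega> \<in> space M. \<omega> \<in> G \<and> \<bar>S \<omega> - I (t i) \<omega>\<bar> > d / 2}" by (auto simp: G_def)
  also have "\<dots> \<in> events" by measurable
  finally have Cm: "?C \<in> events" .
  have "{\<omega> \<in> space M. D i \<omega> = 1 \<and> \<bar>Y i \<omega> - X (t i) \<omega>\<bar> > d} \<subseteq> Z \<union> (?B \<union> ?C)"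
  proof (rule subsetI, rule ccontr)
    fix \<omega> assume \<omega>: "\<omega> \<in> {\<omega> \<in> space M. D i \<omega> = 1 \<and> \<bar>Y i \<omega> - X (t i) \<omega>\<bar> > d}" and n: "\<omega> \<notin> Z \<union> (?B \<union> ?C)"
    then have sp: "\<omega> \<in> space M" and G: "\<omega> \<in> G" and big: "\<bar>Y i \<omega> - X (t i) \<omega>\<bar> > d" by (auto simp: G_def)
    have Q1: "step_error T N b 1 \<omega> \<le> d / 2" and S2: "\<bar>S \<omega> - I (t i) \<omega>\<bar> \<le> d / 2" using n sp G by auto
    have "Y k \<omega> = x + (\<Sum>j<k. b (X (t j) \<omega>) * (T / real N)) + (\<Sum>j<k. \<alpha> j \<omega> * (W (t (Suc j)) \<omega> - W (t j) \<omega>))" if "k \<le> i" for k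
      using that by (induction k) (simp_all add: inG[OF G])
    then have Yi: "Y i \<omega> = x + (\<Sum>j=0..<i. b (X (t j) \<omega>) * (T / real N)) + (\<Sum>j<i. \<alpha> j \<omega> * (W (t (Suc j)) \<omega> - W (t j) \<omega>))"
      by (simp add: atLeast0LessThan)
    have Seq: "S \<omega> = (\<Sum>j<i. \<alpha> j \<omega> * (W (t (Suc j)) \<omega> - W (t j) \<omega>))"
      unfolding S_def simple_ito_integral_def
    proof (rule sum.mono_neutral_cong_right)
      show "\<forall>k\<in>{..<N} - {..<i}. \<alpha> k \<omega> * (W (min (t i) (t (Suc k))) \<omega> - W (min (t i) (t k)) \<omega>) = 0"
      proof
        fix k assume "k \<in> {..<N} - {..<i}"
        then have "t i \<le> t k" "t i \<le> t (Suc k)" using grid_mono[of i k] grid_mono[of i "Suc k"] by auto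
        then show "\<alpha> k \<omega> * (W (min (t i) (t (Suc k))) \<omega> - W (min (t i) (t k)) \<omega>) = 0" by (simp only: min_absorb1 diff_self mult_zero_right)
      qed
      fix k assume "k \<in> {..<i}"
      then have "t k \<le> t i" "t (Suc k) \<le> t i" using grid_mono[of k i] grid_mono[of "Suc k" i] by auto
      then show "\<alpha> k \<omega> * (W (min (t i) (t (Suc k))) \<omega> - W (min (t i) (t k)) \<omega>) = \<alpha> k \<omega> * (W (t (Suc k)) \<omega> - W (t k) \<omega>)"
        by (simp only: min_absorb2)
    qed (use i in auto)
    let ?p = "path_step T N (\<lambda>u. b (X u \<omega>))"
    have hb: "has_bochner_integral lborel (\<lambda>s. indicator {t 0<..t i} s * ?p s) (\<Sum>j=0..<i. b (X (t j) \<omega>) * (T / real N))"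
      by (rule path_step_integral[OF T N _ i]) simp
    have bX: "integrable lborel (\<lambda>s. indicator {0..t i} s *\<^sub>R b (X s \<omega>))"
      using borel_integrable_atLeastAtMost'[OF path_continuous[OF sp cont_b order_refl, of "t i"]]
      unfolding set_integrable_def .
    have eq: "(\<Sum>j=0..<i. b (X (t j) \<omega>) * (T / real N)) - (\<integral>s\<in>{0..t i}. b (X s \<omega>) \<partial>lborel)
        = (\<integral>s. indicator {t 0<..t i} s * ?p s - indicator {0..t i} s *\<^sub>R b (X s \<omega>) \<partial>lborel)"
      unfolding set_lebesgue_integral_def has_bochner_integral_integral_eq[OF hb, symmetric]
      by (rule Bochner_Integration.integral_diff[OF integrable.intros[OF hb] bX, symmetric])
    have "\<bar>(\<Sum>j=0..<i. b (X (t j) \<omega>) * (T / real N)) - (\<integral>s\<in>{0..t i}. b (X s \<omega>) \<partial>lborel)\<bar> \<le> (\<integral>s. \<bar>indicator {t 0<..t i} s * ?p s - indicator {0..t i} s *\<^sub>R b (X s \<omega>)\<bar> \<partial>lborel)"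
      unfolding eq by (rule integral_abs_bound)
    also have "\<dots> \<le> step_error T N b 1 \<omega>"
      unfolding step_error_def
    proof (rule integral_mono_AE)
      show "integrable lborel (\<lambda>s. \<bar>indicator {t 0<..t i} s * ?p s - indicator {0..t i} s *\<^sub>R b (X s \<omega>)\<bar>)"
        by (intro integrable_abs Bochner_Integration.integrable_diff bX integrable.intros[OF hb])
      show "integrable lborel (\<lambda>s. indicator {0..T} s * \<bar>?p s - b (X s \<omega>)\<bar> ^ 1)"
        by (rule integ[OF sp cont_b]) simp
      show "AE s in lborel. \<bar>indicator {t 0<..t i} s * ?p s - indicator {0..t i} s *\<^sub>R b (X s \<omega>)\<bar> \<le> indicator {0..T} s * \<bar>?p s - b (X s \<omega>)\<bar> ^ 1"
        using AE_lborel_singleton[of "0::real"]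
      proof (rule AE_mp, intro AE_I2 impI)
        fix s :: real assume "s \<noteq> 0"
        show "\<bar>indicator {t 0<..t i} s * ?p s - indicator {0..t i} s *\<^sub>R b (X s \<omega>)\<bar> \<le> indicator {0..T} s * \<bar>?p s - b (X s \<omega>)\<bar> ^ 1"
        proof (cases "0 < s \<and> s \<le> t i")
          case True
          then have "s \<in> {t 0<..t i}" "s \<in> {0..t i}" "s \<in> {0..T}" using ti by auto
          then show ?thesis by (simp only: indicator_simps mult_1 scaleR_one power_one_right)
        next
          case False
          then have "s \<notin> {t 0<..t i}" "s \<notin> {0..t i}" using \<open>s \<noteq> 0\<close> by auto
          then show ?thesis by simp
        qed
      qed
    qed
    finally have "\<bar>(\<Sum>j=0..<i. b (X (t j) \<omega>) * (T / real N)) - (\<integral>s\<in>{0..t i}. b (X s \<omega>) \<partial>lborel)\<bar> \<le> d / 2" using Q1 by linarith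
    moreover have "X (t i) \<omega> = x + (\<integral>s\<in>{0..t i}. b (X s \<omega>) \<partial>lborel) + I (t i) \<omega>"
    proof -
      have "\<omega> \<in> space M - Z" using n sp by blast
      from Z(2)[OF this, THEN spec, THEN mp, OF grid_nonneg] show ?thesis .
    qed
    ultimately show False using Yi Seq S2 big by linarith
  qed
  then have "prob {\<omega> \<in> space M. D i \<omega> = 1 \<and> \<bar>Y i \<omega> - X (t i) \<omega>\<bar> > d} \<le> prob (Z \<union> (?B \<union> ?C))"
    using Z(1) Cm by (intro finite_measure_mono) auto
  also have "\<dots> \<le> prob Z + (prob ?B + prob ?C)"
    using Z(1) Cm by (intro order_trans[OF measure_Un_le] add_mono order_refl) auto
  also have "prob Z = 0" using Z(1) by (simp add: null_sets_def measure_def)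
  finally show ?thesis using 1 by (simp add: power_divide)
qed

text \<open>The one-step estimate is summed from \<open>i0\<close> to \<open>N\<close>. The
  derivatives are then moved from the scheme to the path: this costs \<open>\<kappa>\<close> where
  the two are within \<open>d\<close> of each other, and a constant multiple of \<open>p\<close>
  elsewhere. At the path the generator equation turns the drift term into \<open>- g\<close>.
  Replacing the scheme by the path in the initial value costs
  \<open>K\<^sup>2 * d + K\<^sup>2 * p\<close>. All errors are explicit because the limit in
  \<open>N\<close> is taken with the other parameters fixed.\<close>

lemma euler_expectation_bound:
  fixes h h1 h2 g :: "real \<Rightarrow> real"
  assumes d1: "\<And>y. (h has_real_derivative h1 y) (at y)" and d2: "\<And>y. (h1 has_real_derivative h2 y) (at y)"
    and h2m: "h2 \<in> borel_measurable borel" and gm: "g \<in> borel_measurable borel"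
    and hb: "\<And>y. 0 \<le> h y" "\<And>y. h y \<le> K" "\<And>y. \<bar>h1 y\<bar> \<le> K" "\<And>y. \<bar>h2 y\<bar> \<le> K"
    and gb: "\<And>y. 0 \<le> g y" "\<And>y. g y \<le> K"
    and gen: "\<And>y. \<bar>y\<bar> \<le> R \<Longrightarrow> b y * h1 y + (a y)\<^sup>2 * h2 y / 2 = - g y"
    and taylor: "0 \<le> \<eta>" "0 \<le> C" "\<And>y d. h (y + d) - h y \<le> h1 y * d + h2 y * d\<^sup>2 / 2 + \<eta> * d\<^sup>2 + C * d ^ 4"
    and unif: "0 \<le> d" "0 \<le> \<kappa>" "\<And>u v. \<bar>u - v\<bar> \<le> d \<Longrightarrow> \<bar>h1 u - h1 v\<bar> \<le> \<kappa>" "\<And>u v. \<bar>u - v\<bar> \<le> d \<Longrightarrow> \<bar>h2 u - h2 v\<bar> \<le> \<kappa>"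
    and p: "\<And>k. k \<le> N \<Longrightarrow> prob {\<omega> \<in> space M. D k \<omega> = 1 \<and> \<bar>Y k \<omega> - X (t k) \<omega>\<bar> > d} \<le> p"
    and i0: "i0 \<le> N" and Z: "Z \<in> borel_measurable (F (t i0))" "\<And>\<omega>. \<omega> \<in> space M \<Longrightarrow> 0 \<le> Z \<omega>" "\<And>\<omega>. \<omega> \<in> space M \<Longrightarrow> Z \<omega> \<le> K"
  shows "(\<Sum>k=i0..<N. T / real N * expectation (\<lambda>\<omega>. Z \<omega> * D k \<omega> * g (X (t k) \<omega>)))
    \<le> expectation (\<lambda>\<omega>. Z \<omega> * h (X (t i0) \<omega>)) + (K\<^sup>2 * d + K\<^sup>2 * p)
      + T * (\<kappa> * (K\<^sup>2 + K ^ 3) + (2 * K ^ 3 + K ^ 4) * p + \<eta> * K ^ 3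
         + ((K / 2 + \<eta>) * K ^ 3 + 24 * C * K ^ 5 + 8 * C * K ^ 5 * (T / real N)\<^sup>2) * (T / real N))"
proof -
  define \<delta> where "\<delta> = T / real N"
  have \<delta>: "0 \<le> \<delta>" using T by (simp add: \<delta>_def)
  define E2 where "E2 = (K / 2 + \<eta>) * K ^ 3 + 24 * C * K ^ 5 + 8 * C * K ^ 5 * \<delta>\<^sup>2"
  \<comment> \<open>The weight is switched off if the path was outside at some grid time up to
    \<open>i0\<close>, since the scheme then need not be near the path. From \<open>i0\<close> on
    the extra factor is absorbed by \<open>D k\<close>.\<close>
  define Z' where "Z' \<omega> = Z \<omega> * D i0 \<omega>" for \<omega>
  define bad where "bad k = {\<omega> \<in> space M. D k \<omega> = 1 \<and> \<bar>Y k \<omega> - X (t k) \<omega>\<bar> > d}" for k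
  have hm: "h \<in> borel_measurable borel" "h1 \<in> borel_measurable borel"
    by (rule borel_measurable_continuous_onI, rule DERIV_continuous_on, rule d1)
       (rule borel_measurable_continuous_onI, rule DERIV_continuous_on, rule d2)
  have Z'b: "0 \<le> Z' \<omega>" "Z' \<omega> \<le> Z \<omega>" "Z' \<omega> \<le> K" if "\<omega> \<in> space M" for \<omega>
    using Z(2,3)[OF that] inside_range[of T R N i0 \<omega>] by (auto simp: Z'_def mult_left_le intro: order_trans[OF mult_left_le])
  have Z'm0: "Z' \<in> borel_measurable (F (t i0))"
    unfolding Z'_def[abs_def] using Z(1) inside_measurable[of i0] by measurable
  have Z'm: "Z' \<in> borel_measurable (F (t k))" if "i0 \<le> k" for k
    by (rule measurable_F_mono[OF grid_mono[OF that] Z'm0])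
  have Z'D: "Z' \<omega> * D k \<omega> = Z \<omega> * D k \<omega>" if "i0 \<le> k" for k \<omega>
    using that unfolding Z'_def by (auto simp: inside_eq)
  have badm: "bad k \<in> events" for k
    unfolding bad_def using measurable_F_M[OF euler_measurable[of k]] measurable_F_M[OF inside_measurable[of k]] X_borel[OF grid_nonneg[of k]]
    by measurable
  have Xm: "X (t k) \<in> borel_measurable (F (t k))" for k by (rule X_adapted[OF grid_nonneg])
  have bdZ: "bounded_at (t k) Z'" if "i0 \<le> k" for k
    using Z'm[OF that] Z'b unfolding bounded_at_def by (intro conjI exI[of _ K]) auto
  have bdD: "bounded_at (t k) (D k)" for k
    using inside_measurable[of k] inside_range unfolding bounded_at_def by (intro conjI exI[of _ 1]) auto
  have bdg: "bounded_at (t k) (\<lambda>\<omega>. g (X (t k) \<omega>))" for k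
    by (rule bounded_at_compose[OF Xm gm, of K]) (use gb in \<open>simp add: abs_of_nonneg\<close>)
  have bda: "bounded_at (t k) (\<alpha> k)" "bounded_at (t k) (\<beta> k)" for k
    using coeff_measurable[of k] coeff_bounded[of k] unfolding bounded_at_def by blast+
  have bdh: "bounded_at (t k) (\<lambda>\<omega>. h (Y k \<omega>))" "bounded_at (t k) (\<lambda>\<omega>. h (X (t k) \<omega>))"
     "bounded_at (t k) (\<lambda>\<omega>. h1 (Y k \<omega>))" "bounded_at (t k) (\<lambda>\<omega>. h2 (Y k \<omega>))" for k
    by (rule bounded_at_compose[of _ _ _ K] Xm euler_measurable hm h2m hb | simp add: hb abs_of_nonneg)+
  note int = bounded_at_integrable
  define L where "L k \<omega> = Z' \<omega> * (h1 (Y k \<omega>) * \<beta> k \<omega> + h2 (Y k \<omega>) * (\<alpha> k \<omega>)\<^sup>2 / 2)" for k \<omega>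
  have bdL: "bounded_at (t k) (L k)" if "i0 \<le> k" for k
    unfolding L_def[abs_def] by (intro bounded_at_intros bdZ[OF that] bdh bda)
  have step: "expectation (\<lambda>\<omega>. Z' \<omega> * h (Y (Suc k) \<omega>)) \<le> expectation (\<lambda>\<omega>. Z' \<omega> * h (Y k \<omega>)) + \<delta> * expectation (L k) + (\<eta> * K ^ 3 * \<delta> + E2 * \<delta>\<^sup>2)"
    if k: "i0 \<le> k" for k
  proof -
    have le: "t k \<le> t (Suc k)" by (rule grid_mono) simp
    have habs: "\<bar>h y\<bar> \<le> K" for y using hb(1,2)[of y] by (simp add: abs_of_nonneg)
    have "expectation (\<lambda>\<omega>. Z' \<omega> * h (Y k \<omega> + \<beta> k \<omega> * (t (Suc k) - t k) + \<alpha> k \<omega> * (W (t (Suc k)) \<omega> - W (t k) \<omega>)))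
    \<le> expectation (\<lambda>\<omega>. Z' \<omega> * h (Y k \<omega>))
      + (t (Suc k) - t k) * expectation (\<lambda>\<omega>. Z' \<omega> * (h1 (Y k \<omega>) * \<beta> k \<omega> + h2 (Y k \<omega>) * (\<alpha> k \<omega>)\<^sup>2 / 2))
      + (\<eta> * K ^ 3 * (t (Suc k) - t k) + ((K / 2 + \<eta>) * K ^ 3 + 24 * C * K ^ 5 + 8 * C * K ^ 5 * (t (Suc k) - t k)\<^sup>2) * (t (Suc k) - t k)\<^sup>2)"
      by (rule expectation_taylor_step[OF grid_nonneg le K0 taylor(1,2) euler_measurable Z'm[OF k] coeff_measurable Z'b(1,3) coeff_bounded hm h2m habs hb(3,4) taylor(3)])
    then show ?thesis
      unfolding grid_step L_def[abs_def] E2_def \<delta>_def by simp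
  qed
  have Lbound: "expectation (L k) \<le> - expectation (\<lambda>\<omega>. Z \<omega> * D k \<omega> * g (X (t k) \<omega>)) + (\<kappa> * (K\<^sup>2 + K ^ 3) + (2 * K ^ 3 + K ^ 4) * p)"
    if k: "i0 \<le> k" "k \<le> N" for k
  proof -
    let ?c = "2 * K ^ 3 + K ^ 4" and ?e = "\<kappa> * (K\<^sup>2 + K ^ 3)"
    have e0: "0 \<le> ?e" "0 \<le> ?c" using K0 unif by auto
    have pt: "L k \<omega> \<le> - (Z' \<omega> * D k \<omega> * g (X (t k) \<omega>)) + ?e + ?c * indicator (bad k) \<omega>" if \<omega>: "\<omega> \<in> space M" for \<omega>
    proof (cases "D k \<omega> = 1")
      case False
      then have "D k \<omega> = 0" by (auto simp: inside_eq split: if_splits)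
      then show ?thesis using e0 by (simp add: L_def)
    next
      case True
      let ?x = "X (t k) \<omega>" and ?y = "Y k \<omega>"
      have xR: "\<bar>?x\<bar> \<le> R" using True by (auto simp: inside_eq split: if_splits)
      \<comment> \<open>The scheme evaluates the derivatives at \<open>?y\<close> but takes the
        coefficients at \<open>?x\<close>, where the generator equation is available.
        \<open>A1\<close> is the price for moving the derivatives from \<open>?y\<close> to
        \<open>?x\<close>.\<close>
      define A1 where "A1 = (h1 ?y - h1 ?x) * b ?x + (h2 ?y - h2 ?x) * (a ?x)\<^sup>2 / 2"
      have "L k \<omega> = Z' \<omega> * (b ?x * h1 ?x + (a ?x)\<^sup>2 * h2 ?x / 2) + Z' \<omega> * A1"
        using True by (simp add: L_def A1_def field_simps)
      then have L1: "L k \<omega> = - (Z' \<omega> * D k \<omega> * g ?x) + Z' \<omega> * A1" using gen[OF xR] True by simp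
      have asq: "(a ?x)\<^sup>2 \<le> K\<^sup>2" using power_mono[OF Ka[OF xR], of 2] by simp
      have A1b: "\<bar>A1\<bar> \<le> m * K + m * K\<^sup>2 / 2" if "\<bar>h1 ?y - h1 ?x\<bar> \<le> m" "\<bar>h2 ?y - h2 ?x\<bar> \<le> m" for m
      proof -
        have m0: "0 \<le> m" using that(1) by linarith
        have "\<bar>A1\<bar> \<le> \<bar>h1 ?y - h1 ?x\<bar> * \<bar>b ?x\<bar> + \<bar>h2 ?y - h2 ?x\<bar> * (a ?x)\<^sup>2 / 2"
          unfolding A1_def by (rule order_trans[OF abs_triangle_ineq]) (simp add: abs_mult)
        also have "\<dots> \<le> m * K + m * K\<^sup>2 / 2"
          using that asq Kb[OF xR] m0 by (intro add_mono mult_mono divide_right_mono) auto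
        finally show ?thesis .
      qed
      have ZA: "Z' \<omega> * A1 \<le> K * (m * K + m * K\<^sup>2 / 2)" if "\<bar>h1 ?y - h1 ?x\<bar> \<le> m" "\<bar>h2 ?y - h2 ?x\<bar> \<le> m" for m
      proof -
        have "Z' \<omega> * A1 \<le> Z' \<omega> * \<bar>A1\<bar>" using Z'b[OF \<omega>] by (intro mult_left_mono) auto
        also have "\<dots> \<le> K * (m * K + m * K\<^sup>2 / 2)" using Z'b[OF \<omega>] A1b[OF that] K0 by (intro mult_mono) auto
        finally show ?thesis .
      qed
      show ?thesis
      proof (cases "\<bar>?y - ?x\<bar> \<le> d")
        case good: True
        have "Z' \<omega> * A1 \<le> K * (\<kappa> * K + \<kappa> * K\<^sup>2 / 2)" by (rule ZA) (use unif(3,4)[OF good] in auto)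
        also have "\<dots> = \<kappa> * (K\<^sup>2 + K ^ 3 / 2)" by (simp add: field_simps eval_nat_numeral)
        also have "\<dots> \<le> ?e" using K0 unif by (intro mult_left_mono) auto
        finally have "Z' \<omega> * A1 \<le> ?e" .
        moreover have "0 \<le> ?c * indicator (bad k) \<omega>" using e0 by (intro mult_nonneg_nonneg) auto
        ultimately show ?thesis using L1 by linarith
      next
        case False
        have "\<bar>h1 ?y - h1 ?x\<bar> \<le> 2 * K" "\<bar>h2 ?y - h2 ?x\<bar> \<le> 2 * K"
          using hb(3)[of ?y] hb(3)[of ?x] hb(4)[of ?y] hb(4)[of ?x] by linarith+
        then have "Z' \<omega> * A1 \<le> K * (2 * K * K + 2 * K * K\<^sup>2 / 2)" by (rule ZA)
        also have "\<dots> = ?c" by (simp add: field_simps eval_nat_numeral)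
        finally have "Z' \<omega> * A1 \<le> ?c" .
        moreover have "indicator (bad k) \<omega> = (1::real)" using \<omega> True False by (simp add: bad_def indicator_def)
        ultimately show ?thesis using L1 e0 by simp
      qed
    qed
    have i1: "integrable M (\<lambda>\<omega>. Z' \<omega> * D k \<omega> * g (X (t k) \<omega>))"
      by (rule int[of "t k"]) (intro bounded_at_intros bdZ[OF k(1)] bdD bdg)
    have i2: "integrable M (\<lambda>\<omega>. ?c * indicator (bad k) \<omega>)"
      using badm by (intro integrable_mult_right integrable_real_indicator) (auto simp: emeasure_eq_measure)
    have "expectation (L k) \<le> expectation (\<lambda>\<omega>. - (Z' \<omega> * D k \<omega> * g (X (t k) \<omega>)) + ?e + ?c * indicator (bad k) \<omega>)"
      by (rule integral_mono) (use int[OF bdL[OF k(1)]] i1 i2 pt in auto)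
    also have "\<dots> = - expectation (\<lambda>\<omega>. Z' \<omega> * D k \<omega> * g (X (t k) \<omega>)) + ?e + ?c * prob (bad k)"
    proof -
      have "bad k \<inter> space M = bad k" by (auto simp: bad_def)
      then show ?thesis using i1 i2 by (simp add: prob_space)
    qed
    also have "\<dots> \<le> - expectation (\<lambda>\<omega>. Z' \<omega> * D k \<omega> * g (X (t k) \<omega>)) + ?e + ?c * p"
      using p[OF k(2)] e0 unfolding bad_def by (intro add_left_mono mult_left_mono) auto
    finally show ?thesis by (simp add: Z'D[OF k(1)])
  qed
  define c where "c = \<kappa> * (K\<^sup>2 + K ^ 3) + (2 * K ^ 3 + K ^ 4) * p + \<eta> * K ^ 3 + E2 * \<delta>"
  define e where "e k = expectation (\<lambda>\<omega>. Z \<omega> * D k \<omega> * g (X (t k) \<omega>))" for k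
  have step': "expectation (\<lambda>\<omega>. Z' \<omega> * h (Y (Suc k) \<omega>)) \<le> expectation (\<lambda>\<omega>. Z' \<omega> * h (Y k \<omega>)) - \<delta> * e k + \<delta> * c"
    if "i0 \<le> k" "k \<le> N" for k
  proof -
    have "\<delta> * expectation (L k) \<le> \<delta> * (- e k + (\<kappa> * (K\<^sup>2 + K ^ 3) + (2 * K ^ 3 + K ^ 4) * p))"
      using Lbound[OF that] \<delta> unfolding e_def by (rule mult_left_mono)
    then show ?thesis using step[OF that(1)] unfolding c_def by (simp add: algebra_simps power2_eq_square)
  qed
  have tele: "expectation (\<lambda>\<omega>. Z' \<omega> * h (Y n \<omega>)) \<le> expectation (\<lambda>\<omega>. Z' \<omega> * h (Y i0 \<omega>)) - (\<Sum>k=i0..<n. \<delta> * e k) + real (n - i0) * (\<delta> * c)"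
    if "i0 \<le> n" "n \<le> N" for n
    using that
  proof (induction n rule: dec_induct)
    case (step n)
    then show ?case using step'[of n] by (simp add: Suc_diff_le algebra_simps)
  qed simp
  have c0: "0 \<le> c"
  proof -
    have "0 \<le> p" by (rule order_trans[OF measure_nonneg p[of 0]]) simp
    then show ?thesis unfolding c_def E2_def using K0 unif taylor \<delta> by (intro add_nonneg_nonneg mult_nonneg_nonneg) auto
  qed
  have "real (N - i0) * (\<delta> * c) \<le> real N * (\<delta> * c)" using c0 \<delta> by (intro mult_right_mono) auto
  also have "\<dots> = T * c" using N by (simp add: \<delta>_def)
  finally have Tc: "real (N - i0) * (\<delta> * c) \<le> T * c" .
  \<comment> \<open>The terminal value is discarded here; this is the only place where the equality
    of Dynkin's formula is given up for good reason, and it rests on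
    \<open>h \<ge> 0\<close>.\<close>
  have "0 \<le> expectation (\<lambda>\<omega>. Z' \<omega> * h (Y N \<omega>))"
    by (rule Bochner_Integration.integral_nonneg) (intro mult_nonneg_nonneg Z'b(1) hb(1))
  with tele[OF i0 order_refl] Tc
  have 1: "(\<Sum>k=i0..<N. \<delta> * e k) \<le> expectation (\<lambda>\<omega>. Z' \<omega> * h (Y i0 \<omega>)) + T * c" by linarith
  have "expectation (\<lambda>\<omega>. Z' \<omega> * h (Y i0 \<omega>)) \<le> expectation (\<lambda>\<omega>. Z \<omega> * h (X (t i0) \<omega>) + K\<^sup>2 * d + K\<^sup>2 * indicator (bad i0) \<omega>)"
  proof (rule integral_mono)
    fix \<omega> assume \<omega>: "\<omega> \<in> space M"
    let ?x = "X (t i0) \<omega>" and ?y = "Y i0 \<omega>"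
    have Z0: "0 \<le> Z \<omega> * h ?x" using Z(2)[OF \<omega>] hb by simp
    show "Z' \<omega> * h ?y \<le> Z \<omega> * h ?x + K\<^sup>2 * d + K\<^sup>2 * indicator (bad i0) \<omega>"
    proof (cases "D i0 \<omega> = 1")
      case False
      then have "D i0 \<omega> = 0" by (auto simp: inside_eq split: if_splits)
      then show ?thesis using Z0 unif by (simp add: Z'_def)
    next
      case True
      then have Z'Z: "Z' \<omega> = Z \<omega>" by (simp add: Z'_def)
      show ?thesis
      proof (cases "\<bar>?y - ?x\<bar> \<le> d")
        case good: True
        have "\<bar>h ?y - h ?x\<bar> \<le> K * \<bar>?y - ?x\<bar>"
        proof -
          have "norm (h ?y - h ?x) \<le> K * norm (?y - ?x)"
            by (rule field_differentiable_bound[of UNIV h h1]) (use d1 hb in \<open>auto intro: has_field_derivative_at_within\<close>)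
          then show ?thesis by simp
        qed
        also have "\<dots> \<le> K * d" using good K0 by (rule mult_left_mono)
        finally have "h ?y \<le> h ?x + K * d" by linarith
        then have "Z \<omega> * h ?y \<le> Z \<omega> * h ?x + Z \<omega> * (K * d)" using mult_left_mono[OF _ Z(2)[OF \<omega>]] by (simp flip: distrib_left)
        also have "Z \<omega> * (K * d) \<le> K * (K * d)" using Z(3)[OF \<omega>] K0 unif by (intro mult_right_mono) auto
        finally have "Z' \<omega> * h ?y \<le> Z \<omega> * h ?x + K\<^sup>2 * d" by (simp add: Z'Z power2_eq_square mult.assoc)
        moreover have "0 \<le> K\<^sup>2 * indicat_real (bad i0) \<omega>" by simp
        ultimately show ?thesis by linarith
      next
        case False
        have "Z \<omega> * h ?y \<le> K * K" using Z(2,3)[OF \<omega>] hb(1,2)[of ?y] K0 by (intro mult_mono) auto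
        moreover have "indicator (bad i0) \<omega> = (1::real)" using \<omega> True False by (simp add: bad_def indicator_def)
        moreover have "0 \<le> K * K * d" using unif(1) by simp
        ultimately show ?thesis using Z0 by (simp add: Z'Z power2_eq_square)
      qed
    qed
  next
    show "integrable M (\<lambda>\<omega>. Z' \<omega> * h (Y i0 \<omega>))"
      by (rule int[of "t i0"]) (intro bounded_at_intros bdZ[OF order_refl] bdh)
    show "integrable M (\<lambda>\<omega>. Z \<omega> * h (X (t i0) \<omega>) + K\<^sup>2 * d + K\<^sup>2 * indicator (bad i0) \<omega>)"
    proof (intro Bochner_Integration.integrable_add integrable_mult_right integrable_const)
      show "integrable M (indicat_real (bad i0))" using badm by (intro integrable_real_indicator) (auto simp: emeasure_eq_measure)
      have "bounded_at (t i0) Z" using Z unfolding bounded_at_def by (intro conjI exI[of _ K]) auto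
      then show "integrable M (\<lambda>\<omega>. Z \<omega> * h (X (t i0) \<omega>))" by (intro int[of "t i0"] bounded_at_intros bdh)
    qed
  qed
  also have "\<dots> = expectation (\<lambda>\<omega>. Z \<omega> * h (X (t i0) \<omega>)) + K\<^sup>2 * d + K\<^sup>2 * prob (bad i0)"
  proof -
    have "bounded_at (t i0) Z" using Z unfolding bounded_at_def by (intro conjI exI[of _ K]) auto
    then have "integrable M (\<lambda>\<omega>. Z \<omega> * h (X (t i0) \<omega>))" by (intro int[of "t i0"] bounded_at_intros bdh)
    moreover have "integrable M (indicat_real (bad i0))" using badm by (intro integrable_real_indicator) (auto simp: emeasure_eq_measure)
    moreover have "bad i0 \<inter> space M = bad i0" by (auto simp: bad_def)
    ultimately show ?thesis by (simp add: prob_space)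
  qed
  also have "\<dots> \<le> expectation (\<lambda>\<omega>. Z \<omega> * h (X (t i0) \<omega>)) + K\<^sup>2 * d + K\<^sup>2 * p"
    using p[OF i0] unfolding bad_def by (intro add_left_mono mult_left_mono) auto
  finally show ?thesis using 1 unfolding e_def c_def E2_def \<delta>_def by linarith
qed

end

end

section \<open>Comparison of measures on the line\<close>

text \<open>For a bounded open set the functions \<open>min 1 (n * dist)\<close>, with
  \<open>dist\<close> the distance to the complement, increase to the indicator. Outer regularity of
  \<open>\<nu>\<close> carries the comparison to bounded Borel sets, and exhaustion by intervals to
  all. Local finiteness is asked of \<open>\<nu>\<close> because it is \<open>\<nu>\<close> that is
  approximated from outside.\<close>

lemma real_measure_le_of_continuous:
  fixes \<mu> \<nu> :: "real measure"
  assumes s: "sets \<mu> = sets borel" "sets \<nu> = sets borel"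
    and fin: "\<And>c. emeasure \<nu> {-c<..<c} < \<infinity>"
    and le: "\<And>(g :: real \<Rightarrow> real) c. continuous_on UNIV g \<Longrightarrow> (\<And>u. 0 \<le> g u) \<Longrightarrow> (\<And>u. g u \<le> 1) \<Longrightarrow> 0 < c \<Longrightarrow>
      (\<And>u. u \<notin> {-c..c} \<Longrightarrow> g u = 0) \<Longrightarrow> (\<integral>\<^sup>+u. ennreal (g u) \<partial>\<mu>) \<le> (\<integral>\<^sup>+u. ennreal (g u) \<partial>\<nu>)"
    and g: "g \<in> borel_measurable borel"
  shows "(\<integral>\<^sup>+u. g u \<partial>\<mu>) \<le> (\<integral>\<^sup>+u. g u \<partial>\<nu>)"
proof -
  have opn: "emeasure \<mu> U \<le> emeasure \<nu> U" if U: "open U" "U \<subseteq> {-c<..<c}" "0 < c" for U c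
  proof -
    \<comment> \<open>By convention the distance to the empty set is 0, which would make every
      \<open>h n\<close> vanish; boundedness of \<open>U\<close> excludes this.\<close>
    have ne: "- U \<noteq> {}" using U by auto
    define h where "h n u = min 1 (real n * infdist u (- U))" for n u
    have hc: "continuous_on UNIV (h n)" for n
      unfolding h_def[abs_def] by (intro continuous_intros)
    have hm: "(\<lambda>u. ennreal (h n u)) \<in> borel_measurable \<mu>" "(\<lambda>u. ennreal (h n u)) \<in> borel_measurable \<nu>" for n
      using borel_measurable_continuous_onI[OF hc[of n]]
      by (simp_all add: measurable_cong_sets[OF s(1) refl] measurable_cong_sets[OF s(2) refl])
    have h0: "h n u = 0" if "u \<notin> U" for n u using that by (simp add: h_def)
    have inc: "incseq (\<lambda>n u. ennreal (h n u))"
      unfolding incseq_def le_fun_def h_def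
      by (intro allI impI ennreal_leI min.mono order_refl mult_right_mono) (auto simp: infdist_nonneg)
    have sup: "(SUP n. ennreal (h n u)) = indicator U u" for u
    proof (cases "u \<in> U")
      case True
      have "0 < infdist u (- U)"
        using True U(1) ne in_closed_iff_infdist_zero[of "- U" u] infdist_nonneg[of u "- U"] by (auto simp: less_le)
      then obtain n where "1 < real n * infdist u (- U)" using reals_Archimedean3 by blast
      then have "h n u = 1" by (simp add: h_def)
      then have "1 \<le> (SUP n. ennreal (h n u))" by (intro SUP_upper2[of n]) auto
      moreover have "(SUP n. ennreal (h n u)) \<le> 1" by (intro SUP_least) (auto simp: h_def)
      ultimately show ?thesis using True by simp
    qed (simp add: h0)
    have "emeasure \<mu> U = (\<integral>\<^sup>+u. (SUP n. ennreal (h n u)) \<partial>\<mu>)" using U s by (simp add: sup)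
    also have "\<dots> = (SUP n. \<integral>\<^sup>+u. ennreal (h n u) \<partial>\<mu>)"
      by (rule nn_integral_monotone_convergence_SUP[OF inc hm(1)])
    also have "\<dots> \<le> (SUP n. \<integral>\<^sup>+u. ennreal (h n u) \<partial>\<nu>)"
    proof (rule SUP_mono, intro bexI)
      show "(\<integral>\<^sup>+u. ennreal (h n u) \<partial>\<mu>) \<le> (\<integral>\<^sup>+u. ennreal (h n u) \<partial>\<nu>)" for n
      proof (rule le[OF hc _ _ U(3)])
        show "h n u = 0" if "u \<notin> {-c..c}" for u using that U(2) by (intro h0) auto
      qed (auto simp: h_def infdist_nonneg)
    qed auto
    also have "\<dots> = (\<integral>\<^sup>+u. (SUP n. ennreal (h n u)) \<partial>\<nu>)"
      by (rule nn_integral_monotone_convergence_SUP[OF inc hm(2), symmetric])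
    also have "\<dots> = emeasure \<nu> U" using U s by (simp add: sup)
    finally show ?thesis .
  qed
  have bnd: "emeasure \<mu> B \<le> emeasure \<nu> B" if B: "B \<in> sets borel" "B \<subseteq> {-c<..<c}" "0 < c" for B c
  proof -
    let ?D = "{-c<..<c}"
    \<comment> \<open>Outer regularity is applied to a finite measure, so \<open>\<nu>\<close> is
      first restricted to a bounded interval. The open sets that approximate \<open>B\<close> are
      intersected with the same interval and fall under \<open>opn\<close>.\<close>
    define \<nu>' where "\<nu>' = density \<nu> (indicator ?D)"
    have em: "emeasure \<nu>' A = emeasure \<nu> (A \<inter> ?D)" if "A \<in> sets borel" for A
      using that s unfolding \<nu>'_def by (simp add: emeasure_restricted Int_commute)
    have "emeasure \<nu>' B = (INF U\<in>{U. B \<subseteq> U \<and> open U}. emeasure \<nu>' U)"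
    proof (rule outer_regular)
      show "sets \<nu>' = sets borel" using s by (simp add: \<nu>'_def)
      have "space \<nu>' = UNIV" using s sets_eq_imp_space_eq[of \<nu> borel] by (simp add: \<nu>'_def)
      then show "emeasure \<nu>' (space \<nu>') \<noteq> \<infinity>" using em[of UNIV] fin[of c] by auto
    qed (rule B)
    moreover have "emeasure \<mu> B \<le> (INF U\<in>{U. B \<subseteq> U \<and> open U}. emeasure \<nu>' U)"
    proof (rule INF_greatest)
      fix U assume "U \<in> {U. B \<subseteq> U \<and> open U}"
      then have U: "B \<subseteq> U" "open U" by auto
      have "emeasure \<mu> B \<le> emeasure \<mu> (U \<inter> ?D)" using U B s by (intro emeasure_mono) auto
      also have "\<dots> \<le> emeasure \<nu> (U \<inter> ?D)" using U B by (intro opn[of _ c]) auto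
      also have "\<dots> = emeasure \<nu>' U" using em[of U] U by simp
      finally show "emeasure \<mu> B \<le> emeasure \<nu>' U" .
    qed
    ultimately have "emeasure \<mu> B \<le> emeasure \<nu>' B" by simp
    also have "\<dots> = emeasure \<nu> B" using em[OF B(1)] B(2) by (simp add: Int_absorb2)
    finally show ?thesis .
  qed
  have all: "emeasure \<mu> B \<le> emeasure \<nu> B" if B: "B \<in> sets borel" for B
  proof -
    define C where "C n = B \<inter> {- real (Suc n)<..<real (Suc n)}" for n
    have inc: "incseq C" unfolding incseq_def C_def by auto
    have un: "(\<Union>n. C n) = B"
    proof
      show "B \<subseteq> (\<Union>n. C n)"
      proof
        fix u assume "u \<in> B"
        obtain n where "\<bar>u\<bar> < real n" using reals_Archimedean2 by blast
        then have "u \<in> C n" using \<open>u \<in> B\<close> by (auto simp: C_def)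
        then show "u \<in> (\<Union>n. C n)" by blast
      qed
    qed (auto simp: C_def)
    have Cm: "C n \<in> sets borel" for n unfolding C_def using B by (intro sets.Int) auto
    have "range C \<subseteq> sets \<mu>" unfolding s(1) using Cm by (rule image_subsetI)
    from SUP_emeasure_incseq[OF this inc]
    have "(SUP n. emeasure \<mu> (C n)) = emeasure \<mu> (\<Union>n. C n)" .
    then have "emeasure \<mu> B = (SUP n. emeasure \<mu> (C n))" by (simp only: un)
    also have "\<dots> \<le> emeasure \<nu> B"
    proof (rule SUP_least)
      fix n
      have "emeasure \<mu> (C n) \<le> emeasure \<nu> (C n)" by (rule bnd[OF Cm, where c = "real (Suc n)"]) (auto simp: C_def)
      also have "\<dots> \<le> emeasure \<nu> B" using B s by (intro emeasure_mono) (auto simp: C_def)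
      finally show "emeasure \<mu> (C n) \<le> emeasure \<nu> B" .
    qed
    finally show ?thesis .
  qed
  have "\<mu> \<le> \<nu>"
    using s all by (simp add: le_measure)
  then show ?thesis using s by (intro nn_integral_mono_measure) auto
qed

lemma emeasure_Ioc_finite: "emeasure lborel {s<..t :: real} < top"
  by (cases "s \<le> t") auto

section \<open>The occupation functional and the limit of the scheme\<close>

context regular_diffusion
begin

text \<open>Nothing is known about the path at negative times, so the time is clamped at 0 before
  continuity is used. The clamp disappears under an indicator of nonnegative times.\<close>

lemma path_measurable:
  assumes "\<omega> \<in> space M" "g \<in> borel_measurable borel"
  shows "(\<lambda>u. g (X (max 0 u) \<omega>)) \<in> borel_measurable borel"
proof -
  have "continuous_on UNIV (\<lambda>u. X (max 0 u) \<omega>)"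
    by (rule continuous_on_compose2[OF X_cont[OF assms(1)]]) (auto intro!: continuous_intros)
  from measurable_compose[OF borel_measurable_continuous_onI[OF this] assms(2)] show ?thesis .
qed

lemma path_measurable_on:
  fixes g :: "real \<Rightarrow> real"
  assumes "\<omega> \<in> space M" "g \<in> borel_measurable borel" "S \<in> sets borel" "S \<subseteq> {0..}"
  shows "(\<lambda>u. indicator S u * g (X u \<omega>)) \<in> borel_measurable (borel :: real measure)"
proof -
  note path_measurable[OF assms(1,2), measurable] assms(3)[measurable]
  have "(\<lambda>u. indicator S u * g (X (max 0 u) \<omega>)) \<in> borel_measurable borel" by measurable
  moreover have "indicator S u * g (X (max 0 u) \<omega>) = indicator S u * g (X u \<omega>)" for u
    using assms(4) by (cases "u \<in> S") (auto simp: max_def)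
  ultimately show ?thesis by simp
qed

text \<open>The versions stopped at time \<open>n\<close> are jointly measurable by
  \<open>X_joint\<close>, and at each point they are eventually constant in
  \<open>n\<close>.\<close>

lemma X_joint_all: "(\<lambda>p. X (max 0 (snd p)) (fst p)) \<in> borel_measurable (M \<Otimes>\<^sub>M borel)"
proof (rule borel_measurable_LIMSEQ_real)
  fix n :: nat
  have subT: "(\<lambda>p. p) \<in> measurable (M \<Otimes>\<^sub>M (borel :: real measure)) (F (real n) \<Otimes>\<^sub>M borel)"
  proof (rule measurable_pair)
    have "(\<lambda>\<omega>. \<omega>) \<in> measurable M (F (real n))" by (rule measurable_F_M[of _ "real n"]) simp
    then show "fst \<circ> (\<lambda>p. p) \<in> measurable (M \<Otimes>\<^sub>M (borel :: real measure)) (F (real n))"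
      by (simp add: comp_def measurable_compose[OF measurable_fst])
  qed (simp add: comp_def)
  show "(\<lambda>p. X (max 0 (min (real n) (snd p))) (fst p)) \<in> borel_measurable (M \<Otimes>\<^sub>M borel)"
    by (rule measurable_compose[OF subT X_joint]) simp
next
  fix p :: "'w \<times> real"
  obtain n0 where n0: "snd p < real n0" using reals_Archimedean2 by blast
  have "\<forall>\<^sub>F n in sequentially. X (max 0 (min (real n) (snd p))) (fst p) = X (max 0 (snd p)) (fst p)"
    unfolding eventually_sequentially
  proof (intro exI allI impI)
    fix n assume "n0 \<le> n"
    then have "min (real n) (snd p) = snd p" using n0 by simp
    then show "X (max 0 (min (real n) (snd p))) (fst p) = X (max 0 (snd p)) (fst p)" by (simp only:)
  qed
  then show "(\<lambda>n. X (max 0 (min (real n) (snd p))) (fst p)) \<longlonglongrightarrow> X (max 0 (snd p)) (fst p)"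
    by (rule tendsto_eventually)
qed

definition occupation :: "(real \<Rightarrow> real) \<Rightarrow> real \<Rightarrow> 'w \<Rightarrow> real" where
  "occupation g t \<omega> = (\<integral>u. indicator {0<..t} u * g (X u \<omega>) \<partial>lborel)"

lemma occupation_0: "occupation g 0 \<omega> = 0"
  by (simp add: occupation_def)

context
  fixes g :: "real \<Rightarrow> real" and C :: real
  assumes g: "g \<in> borel_measurable borel" "\<And>u. 0 \<le> g u" "\<And>u. g u \<le> C"
begin

lemma occupation_integrable:
  assumes "\<omega> \<in> space M" "0 \<le> s"
  shows "integrable lborel (\<lambda>u. indicator {s<..t} u * g (X u \<omega>))"
proof (rule Bochner_Integration.integrable_bound[of _ "\<lambda>u. indicator {s<..t} u * C"])
  show "integrable lborel (\<lambda>u. indicator {s<..t} u * C)"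
    by (intro integrable_mult_left integrable_real_indicator) (auto simp: emeasure_Ioc_finite)
  show "(\<lambda>u. indicator {s<..t} u * g (X u \<omega>)) \<in> borel_measurable lborel"
  proof -
    have "{s<..t} \<subseteq> {0..}" using assms(2) by auto
    then show ?thesis using path_measurable_on[OF assms(1) g(1), of "{s<..t}"] by simp
  qed
  show "AE u in lborel. norm (indicator {s<..t} u * g (X u \<omega>)) \<le> norm (indicator {s<..t} u * C)"
  proof (rule AE_I2)
    fix u
    have "\<bar>g (X u \<omega>)\<bar> \<le> \<bar>C\<bar>" using g(2,3)[of "X u \<omega>"] by linarith
    then show "norm (indicator {s<..t} u * g (X u \<omega>)) \<le> norm (indicator {s<..t} u * C)"
      by (simp add: indicator_def)
  qed
qed

lemma occupation_diff:
  assumes "\<omega> \<in> space M" "0 \<le> s" "s \<le> t"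
  shows "occupation g t \<omega> - occupation g s \<omega> = (\<integral>u. indicator {s<..t} u * g (X u \<omega>) \<partial>lborel)"
proof -
  have "occupation g t \<omega> = (\<integral>u. indicator {0<..s} u * g (X u \<omega>) + indicator {s<..t} u * g (X u \<omega>) \<partial>lborel)"
    unfolding occupation_def by (rule Bochner_Integration.integral_cong) (use assms in \<open>auto simp: indicator_def\<close>)
  also have "\<dots> = occupation g s \<omega> + (\<integral>u. indicator {s<..t} u * g (X u \<omega>) \<partial>lborel)"
    unfolding occupation_def by (rule Bochner_Integration.integral_add) (use occupation_integrable assms in auto)
  finally show ?thesis by simp
qed

lemma occupation_increment:
  assumes "\<omega> \<in> space M" "0 \<le> s" "s \<le> t"
  shows "occupation g s \<omega> \<le> occupation g t \<omega>" "occupation g t \<omega> - occupation g s \<omega> \<le> C * (t - s)"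
proof -
  have "0 \<le> (\<integral>u. indicator {s<..t} u * g (X u \<omega>) \<partial>lborel)"
    by (rule Bochner_Integration.integral_nonneg) (simp add: g)
  then show "occupation g s \<omega> \<le> occupation g t \<omega>" using occupation_diff[OF assms] by simp
  have "(\<integral>u. indicator {s<..t} u * g (X u \<omega>) \<partial>lborel) \<le> (\<integral>u. indicator {s<..t} u * C \<partial>lborel)"
  proof (rule integral_mono[OF occupation_integrable[OF assms(1,2)]])
    show "integrable lborel (\<lambda>u. indicator {s<..t} u * C)"
      by (intro integrable_mult_left integrable_real_indicator) (auto simp: emeasure_Ioc_finite)
  qed (simp add: g mult_left_mono)
  also have "\<dots> = C * (t - s)" using assms(3) by simp
  finally show "occupation g t \<omega> - occupation g s \<omega> \<le> C * (t - s)" using occupation_diff[OF assms] by simp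
qed

lemma occupation_nn:
  assumes "\<omega> \<in> space M" "0 \<le> s" "s \<le> t"
  shows "(\<integral>\<^sup>+u\<in>{s<..t}. ennreal (g (X u \<omega>)) \<partial>lborel) = ennreal (occupation g t \<omega> - occupation g s \<omega>)"
proof -
  have "(\<integral>\<^sup>+u\<in>{s<..t}. ennreal (g (X u \<omega>)) \<partial>lborel) = (\<integral>\<^sup>+u. ennreal (indicator {s<..t} u * g (X u \<omega>)) \<partial>lborel)"
    by (rule nn_integral_cong) (auto simp: indicator_def)
  also have "\<dots> = ennreal (\<integral>u. indicator {s<..t} u * g (X u \<omega>) \<partial>lborel)"
    by (rule nn_integral_eq_integral[OF occupation_integrable[OF assms(1,2)]]) (simp add: g)
  finally show ?thesis using occupation_diff[OF assms] by simp
qed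

lemma occupation_measurable: "0 \<le> t \<Longrightarrow> occupation g t \<in> borel_measurable (F t)"
  unfolding occupation_def[abs_def] by (rule additive_functional_measurable[OF _ _ _ g(1)]) auto

end

text \<open>Rational multiples of \<open>T\<close> contain all grid points and keep the event measurable.\<close>

definition confined :: "real \<Rightarrow> real \<Rightarrow> 'w set" where
  "confined T R = {\<omega> \<in> space M. \<forall>q\<in>\<rat> \<inter> {0..1}. \<bar>X (q * T) \<omega>\<bar> \<le> R}"

lemma confined_events: "0 \<le> T \<Longrightarrow> confined T R \<in> events"
proof -
  assume T: "0 \<le> T"
  have "confined T R = (\<Inter>q\<in>\<rat> \<inter> {0..1::real}. {\<omega> \<in> space M. \<bar>X (q * T) \<omega>\<bar> \<le> R})"
    unfolding confined_def by (auto intro!: exI[of _ "0::real"])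
  also have "\<dots> \<in> events"
  proof (rule sets.countable_INT')
    show "countable (\<rat> \<inter> {0..1::real})" by (intro countable_Int1 countable_rat)
    show "(\<lambda>q. {\<omega> \<in> space M. \<bar>X (q * T) \<omega>\<bar> \<le> R}) ` (\<rat> \<inter> {0..1}) \<subseteq> events"
    proof safe
      fix q :: real assume "q \<in> {0..1}"
      then have [measurable]: "X (q * T) \<in> borel_measurable M" using T by (intro X_borel) auto
      show "{\<omega> \<in> space M. \<bar>X (q * T) \<omega>\<bar> \<le> R} \<in> events" by measurable
    qed
    have "(0::real) \<in> \<rat> \<inter> {0..1}" by simp
    then show "\<rat> \<inter> {0..1::real} \<noteq> {}" by blast
  qed
  finally show ?thesis .
qed

text \<open>Grids with \<open>m * Suc n\<close> cells form a subsequence of all grids. Multiples of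
  \<open>m\<close> are taken so that the fixed times \<open>j * T / m\<close> are grid points of
  every one of them.\<close>

lemma step_error_tendsto:
  assumes T: "0 < T" and f: "continuous_on UNIV f" and p: "0 < p" and m: "0 < m" and \<omega>: "\<omega> \<in> space M"
  shows "(\<lambda>n. step_error T (m * Suc n) f p \<omega>) \<longlonglongrightarrow> 0"
proof -
  have "(\<lambda>n. step_error T (Suc n) f p \<omega>) \<longlonglongrightarrow> 0"
    unfolding step_error_def by (rule path_step_L(1)[OF T path_continuous[OF \<omega> f order_refl] p])
  moreover have "strict_mono (\<lambda>n. m * Suc n - 1)"
    using m by (auto simp: strict_mono_def intro!: diff_less_mono)
  ultimately have "((\<lambda>n. step_error T (Suc n) f p \<omega>) \<circ> (\<lambda>n. m * Suc n - 1)) \<longlonglongrightarrow> 0"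
    by (rule LIMSEQ_subseq_LIMSEQ)
  moreover have "Suc (m * Suc n - 1) = m * Suc n" for n using m by simp
  ultimately show ?thesis by (simp only: comp_def)
qed

text \<open>Given \<open>\<epsilon>\<close>, the closeness \<open>d\<close> and the Taylor constant
  are fixed; as the grid is refined the sampling errors and the mesh tend to 0, and only terms
  proportional to \<open>\<epsilon>\<close> survive. On the confined event every
  \<open>inside\<close> factor is 1, so its indicator bounds them all from below by something
  independent of the grid. That event depends on the whole path up to \<open>T\<close>; this is
  harmless, because it enters only after the estimate for the adapted factors has been
  obtained.\<close>

lemma occupation_core:
  fixes h h1 h2 g :: "real \<Rightarrow> real"
  assumes d1: "\<And>y. (h has_real_derivative h1 y) (at y)" and d2: "\<And>y. (h1 has_real_derivative h2 y) (at y)"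
    and uc: "uniformly_continuous_on UNIV h2"
    and hb: "\<And>y. 0 \<le> h y" "\<And>y. h y \<le> B" "\<And>y. \<bar>h1 y\<bar> \<le> B" "\<And>y. \<bar>h2 y\<bar> \<le> B"
    and g: "continuous_on UNIV g" "\<And>y. 0 \<le> g y" "\<And>y. g y \<le> B"
    and gen: "\<And>y. \<bar>y\<bar> \<le> R \<Longrightarrow> b y * h1 y + (a y)\<^sup>2 * h2 y / 2 = - g y"
    and T: "0 < T" and m: "0 < m" "j \<le> m"
    and Z: "Z \<in> borel_measurable (F (real j * T / real m))" "\<And>\<omega>. \<omega> \<in> space M \<Longrightarrow> 0 \<le> Z \<omega>" "\<And>\<omega>. \<omega> \<in> space M \<Longrightarrow> Z \<omega> \<le> B"
  shows "expectation (\<lambda>\<omega>. Z \<omega> * indicator (confined T R) \<omega> * (occupation g T \<omega> - occupation g (real j * T / real m) \<omega>))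
    \<le> expectation (\<lambda>\<omega>. Z \<omega> * h (X (real j * T / real m) \<omega>))"
proof -
  define s where "s = real j * T / real m"
  have s: "0 \<le> s" "s \<le> T" using T m by (auto simp: s_def field_simps)
  define E where "E = confined T R"
  have Em [measurable]: "E \<in> events" unfolding E_def using T by (intro confined_events) simp
  have cab: "compact (a ` {-R..R})" "compact (b ` {-R..R})"
    by (intro compact_continuous_image continuous_on_subset[OF cont_a] continuous_on_subset[OF cont_b]; simp)+
  obtain Ka where Ka: "\<And>y. y \<in> {-R..R} \<Longrightarrow> \<bar>a y\<bar> \<le> Ka"
    using compact_imp_bounded[OF cab(1)] unfolding bounded_iff real_norm_def by blast
  obtain Kb where Kb: "\<And>y. y \<in> {-R..R} \<Longrightarrow> \<bar>b y\<bar> \<le> Kb"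
    using compact_imp_bounded[OF cab(2)] unfolding bounded_iff real_norm_def by blast
  define K where "K = max B (max Ka Kb)"
  have K0: "0 \<le> K" using hb(1)[of 0] hb(2)[of 0] by (simp add: K_def)
  have BK: "B \<le> K" "Ka \<le> K" "Kb \<le> K" by (auto simp: K_def)
  have KaK: "\<bar>a y\<bar> \<le> K" "\<bar>b y\<bar> \<le> K" if "\<bar>y\<bar> \<le> R" for y
    using Ka[of y] Kb[of y] BK that by (auto simp: abs_le_iff)
  have hK: "h y \<le> K" "\<bar>h1 y\<bar> \<le> K" "\<bar>h2 y\<bar> \<le> K" "g y \<le> K" for y using hb(2-4)[of y] g(3)[of y] BK by linarith+
  have ZK: "Z \<omega> \<le> K" if "\<omega> \<in> space M" for \<omega> using Z(3)[OF that] BK by linarith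
  have gm [measurable]: "g \<in> borel_measurable borel" using g(1) by (rule borel_measurable_continuous_onI)
  have h2m: "h2 \<in> borel_measurable borel"
    using uniformly_continuous_imp_continuous[OF uc] by (rule borel_measurable_continuous_onI)
  have Zm [measurable]: "Z \<in> borel_measurable M" using Z(1) by (rule measurable_F_M)
  define N where "N n = m * Suc n" for n
  define i0 where "i0 n = j * Suc n" for n
  have N: "0 < N n" "i0 n \<le> N n" for n using m by (auto simp: N_def i0_def simp del: mult_Suc_right)
  have ti0: "real (i0 n) * T / real (N n) = s" for n
    unfolding i0_def N_def s_def of_nat_mult using m by (simp add: field_simps del: of_nat_Suc)
  define J where "J \<omega> = occupation g T \<omega> - occupation g s \<omega>" for \<omega>
  define Jn where "Jn n \<omega> = (\<Sum>k=i0 n..<N n. g (X (real k * T / real (N n)) \<omega>) * (T / real (N n)))" for n \<omega>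
  have tk: "real k * T / real (N n) \<ge> 0" for k n using T by simp
  have Jnm [measurable]: "Jn n \<in> borel_measurable M" for n
    unfolding Jn_def[abs_def] using X_borel[OF tk] by measurable
  have Jn_lim: "(\<lambda>n. Jn n \<omega>) \<longlonglongrightarrow> J \<omega>" if \<omega>: "\<omega> \<in> space M" for \<omega>
  proof -
    have "\<bar>Jn n \<omega> - J \<omega>\<bar> \<le> step_error T (N n) g 1 \<omega>" for n
    proof -
      let ?p = "path_step T (N n) (\<lambda>u. g (X u \<omega>))"
      have "real (N n) * T / real (N n) = T" using N(1)[of n] by simp
      then have hb: "has_bochner_integral lborel (\<lambda>u. indicator {s<..T} u * ?p u) (Jn n \<omega>)"
        using path_step_integral[OF T N(1) N(2) order_refl, of n "\<lambda>u. g (X u \<omega>)"] unfolding ti0 Jn_def by simp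
      note iX = occupation_integrable[OF gm g(2,3) \<omega> s(1), of T]
      have eq: "Jn n \<omega> - J \<omega> = (\<integral>u. indicator {s<..T} u * ?p u - indicator {s<..T} u * g (X u \<omega>) \<partial>lborel)"
        unfolding J_def occupation_diff[OF gm g(2,3) \<omega> s] has_bochner_integral_integral_eq[OF hb, symmetric]
        by (rule Bochner_Integration.integral_diff[OF integrable.intros[OF hb] iX, symmetric])
      have "\<bar>Jn n \<omega> - J \<omega>\<bar> \<le> (\<integral>u. \<bar>indicator {s<..T} u * ?p u - indicator {s<..T} u * g (X u \<omega>)\<bar> \<partial>lborel)"
        unfolding eq by (rule integral_abs_bound)
      also have "\<dots> \<le> step_error T (N n) g 1 \<omega>"
        unfolding step_error_def
      proof (rule integral_mono)
        show "integrable lborel (\<lambda>u. \<bar>indicator {s<..T} u * ?p u - indicator {s<..T} u * g (X u \<omega>)\<bar>)"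
          by (intro integrable_abs Bochner_Integration.integrable_diff iX integrable.intros[OF hb])
        show "integrable lborel (\<lambda>u. indicator {0..T} u * \<bar>?p u - g (X u \<omega>)\<bar> ^ 1)"
          using path_step_L(2)[OF T path_continuous[OF \<omega> g(1) order_refl] zero_less_one, of "N n - 1"] N(1)[of n] by simp
        show "\<bar>indicator {s<..T} u * ?p u - indicator {s<..T} u * g (X u \<omega>)\<bar> \<le> indicator {0..T} u * \<bar>?p u - g (X u \<omega>)\<bar> ^ 1" for u
          using s by (cases "u \<in> {s<..T}") (auto simp: indicator_def)
      qed
      finally show ?thesis .
    qed
    moreover have "(\<lambda>n. step_error T (N n) g 1 \<omega>) \<longlonglongrightarrow> 0"
      unfolding N_def by (rule step_error_tendsto[OF T g(1) _ m(1) \<omega>]) simp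
    ultimately have "(\<lambda>n. Jn n \<omega> - J \<omega>) \<longlonglongrightarrow> 0"
      by (intro Lim_null_comparison[of "\<lambda>n. Jn n \<omega> - J \<omega>" "\<lambda>n. step_error T (N n) g 1 \<omega>"]) auto
    then show ?thesis by (simp add: LIM_zero_iff)
  qed
  have Jn_b: "0 \<le> Jn n \<omega>" "Jn n \<omega> \<le> K * T" for n \<omega>
  proof -
    show "0 \<le> Jn n \<omega>" unfolding Jn_def using g(2) T by (intro sum_nonneg) auto
    have "Jn n \<omega> \<le> (\<Sum>k=i0 n..<N n. K * (T / real (N n)))"
      unfolding Jn_def using hK(4) T by (intro sum_mono mult_right_mono) auto
    also have "\<dots> = real (N n - i0 n) * (K * (T / real (N n)))" by simp
    also have "\<dots> \<le> real (N n) * (K * (T / real (N n)))" using K0 T by (intro mult_right_mono) auto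
    also have "\<dots> = K * T" using N(1)[of n] by simp
    finally show "Jn n \<omega> \<le> K * T" .
  qed
  have bd: "norm (Z \<omega> * indicator E \<omega> * Jn n \<omega>) \<le> K * 1 * (K * T)" if "\<omega> \<in> space M" for \<omega> n
  proof -
    have "norm (Z \<omega> * indicator E \<omega> * Jn n \<omega>) = Z \<omega> * indicator E \<omega> * Jn n \<omega>"
      using Z(2)[OF that] Jn_b(1) by (simp add: abs_mult)
    also have "\<dots> \<le> K * 1 * (K * T)"
      using Z(2)[OF that] ZK[OF that] Jn_b K0 by (intro mult_mono mult_nonneg_nonneg) auto
    finally show ?thesis .
  qed
  have Jm: "J \<in> borel_measurable M"
    by (rule borel_measurable_LIMSEQ_real[OF Jn_lim Jnm])
  have lim1: "(\<lambda>n. expectation (\<lambda>\<omega>. Z \<omega> * indicator E \<omega> * Jn n \<omega>)) \<longlonglongrightarrow> expectation (\<lambda>\<omega>. Z \<omega> * indicator E \<omega> * J \<omega>)"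
  proof (rule integral_dominated_convergence[where w = "\<lambda>_. K * 1 * (K * T)"])
    show "AE \<omega> in M. (\<lambda>n. Z \<omega> * indicator E \<omega> * Jn n \<omega>) \<longlonglongrightarrow> Z \<omega> * indicator E \<omega> * J \<omega>"
      by (intro AE_I2 tendsto_intros Jn_lim)
  qed (use bd Jm in \<open>auto intro!: AE_I2\<close>)
  \<comment> \<open>The coefficient of \<open>\<epsilon>\<close> that remains in the limit, where
    \<open>p n\<close> tends to \<open>\<epsilon>\<close>, the uniform closeness of the derivatives
    is \<open>\<epsilon>\<close>, and \<open>d \<le> \<epsilon>\<close>.\<close>
  define c where "c = 2 * K\<^sup>2 + T * (K\<^sup>2 + K ^ 3 + (2 * K ^ 3 + K ^ 4) + K ^ 3)"
  have c0: "0 \<le> c" unfolding c_def using K0 T by (intro add_nonneg_nonneg mult_nonneg_nonneg) auto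
  have main: "expectation (\<lambda>\<omega>. Z \<omega> * indicator E \<omega> * J \<omega>) \<le> expectation (\<lambda>\<omega>. Z \<omega> * h (X s \<omega>)) + c * \<epsilon>" if \<epsilon>: "0 < \<epsilon>" for \<epsilon>
  proof -
    obtain d0 where d0: "0 < d0" "\<And>u v. dist u v < d0 \<Longrightarrow> dist (h2 u) (h2 v) < \<epsilon>"
      using uc \<epsilon> unfolding uniformly_continuous_on_def by (metis UNIV_I)
    \<comment> \<open>The first bound serves the uniform continuity of \<open>h2\<close>. The second
      gives both \<open>K * d \<le> \<epsilon>\<close>, for the Lipschitz function
      \<open>h1\<close>, and \<open>d \<le> \<epsilon>\<close>; the summand 1 avoids a division by
      zero.\<close>
    define d where "d = min (d0 / 2) (\<epsilon> / (K + 1))"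
    have d: "0 < d" "d < d0" "d \<le> \<epsilon> / (K + 1)" using d0 \<epsilon> K0 by (auto simp: d_def)
    have "d * (K + 1) \<le> \<epsilon>" using d(3) K0 by (simp add: pos_le_divide_eq)
    then have dK: "K * d \<le> \<epsilon>" "d \<le> \<epsilon>" using d(1) K0 by (auto simp: algebra_simps intro: order_trans[rotated])
    have u1: "\<bar>h1 u - h1 v\<bar> \<le> \<epsilon>" if "\<bar>u - v\<bar> \<le> d" for u v
    proof -
      have "norm (h1 u - h1 v) \<le> K * norm (u - v)"
        by (rule field_differentiable_bound[of UNIV h1 h2]) (use d2 hK in \<open>auto intro: has_field_derivative_at_within\<close>)
      also have "\<dots> \<le> K * d" using that K0 by (intro mult_left_mono) auto
      finally show ?thesis using dK by simp
    qed
    have u2: "\<bar>h2 u - h2 v\<bar> \<le> \<epsilon>" if "\<bar>u - v\<bar> \<le> d" for u v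
      using d0(2)[of u v] that d by (simp add: dist_real_def)
    obtain C where C: "0 \<le> C" "\<And>y d. h (y + d) - h y \<le> h1 y * d + h2 y * d\<^sup>2 / 2 + \<epsilon> * d\<^sup>2 + C * d ^ 4"
      using taylor2_remainder_bound[OF d1 d2 uc hK(3) \<epsilon>] by blast
    \<comment> \<open>Chosen so that the last term of \<open>euler_error\<close> becomes exactly
      \<open>\<epsilon>\<close>.\<close>
    define e1 where "e1 = \<epsilon> * d\<^sup>2 / 64"
    have e1: "0 < e1" "64 * e1 / d\<^sup>2 = \<epsilon>" using \<epsilon> d by (auto simp: e1_def)
    define p where "p n = prob {\<omega> \<in> space M. step_error T (N n) b 1 \<omega> > d / 2} + (prob {\<omega> \<in> space M. step_error T (N n) a 2 \<omega> > e1} + \<epsilon>)" for n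
    have pl: "p \<longlonglongrightarrow> 0 + (0 + \<epsilon>)"
      unfolding p_def[abs_def] N_def
      by (intro tendsto_add tendsto_const prob_tendsto_0 step_error_measurable[OF T] a_measurable b_measurable
        step_error_tendsto[OF T _ _ m(1)] cont_a cont_b) (use d e1 in auto)
    have bound: "expectation (\<lambda>\<omega>. Z \<omega> * indicator E \<omega> * Jn n \<omega>) \<le> expectation (\<lambda>\<omega>. Z \<omega> * h (X s \<omega>)) + (K\<^sup>2 * \<epsilon> + K\<^sup>2 * p n)
      + T * (\<epsilon> * (K\<^sup>2 + K ^ 3) + (2 * K ^ 3 + K ^ 4) * p n + \<epsilon> * K ^ 3
         + ((K / 2 + \<epsilon>) * K ^ 3 + 24 * C * K ^ 5 + 8 * C * K ^ 5 * (T / real (N n))\<^sup>2) * (T / real (N n)))" for n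
    proof -
      let ?D = "inside T R (N n)" and ?t = "\<lambda>k. real k * T / real (N n)"
      have err: "prob {\<omega> \<in> space M. ?D k \<omega> = 1 \<and> \<bar>euler T R (N n) k \<omega> - X (?t k) \<omega>\<bar> > d} \<le> p n" if "k \<le> N n" for k
        unfolding p_def e1(2)[symmetric]
        by (rule euler_error[OF T N(1) K0 KaK that d(1) e1(1)])
      have Zs: "Z \<in> borel_measurable (F (?t (i0 n)))" using Z(1) unfolding ti0 s_def .
      have 1: "(\<Sum>k=i0 n..<N n. T / real (N n) * expectation (\<lambda>\<omega>. Z \<omega> * ?D k \<omega> * g (X (?t k) \<omega>)))
        \<le> expectation (\<lambda>\<omega>. Z \<omega> * h (X (?t (i0 n)) \<omega>)) + (K\<^sup>2 * d + K\<^sup>2 * p n)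
        + T * (\<epsilon> * (K\<^sup>2 + K ^ 3) + (2 * K ^ 3 + K ^ 4) * p n + \<epsilon> * K ^ 3
         + ((K / 2 + \<epsilon>) * K ^ 3 + 24 * C * K ^ 5 + 8 * C * K ^ 5 * (T / real (N n))\<^sup>2) * (T / real (N n)))"
        by (rule euler_expectation_bound[OF T N(1) K0 KaK d1 d2 h2m gm hb(1) hK(1-3) g(2) hK(4) gen less_imp_le[OF \<epsilon>] C
             less_imp_le[OF d(1)] less_imp_le[OF \<epsilon>] u1 u2 err N(2) Zs Z(2) ZK])
      have int: "integrable M (\<lambda>\<omega>. Z \<omega> * ?D k \<omega> * g (X (?t k) \<omega>))" for k
      proof (rule integrable_const_bound[of _ "K * 1 * K"])
        have "?D k \<in> borel_measurable M" by (rule measurable_F_M[OF inside_measurable[OF T N(1) K0 KaK]])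
        then show "(\<lambda>\<omega>. Z \<omega> * ?D k \<omega> * g (X (?t k) \<omega>)) \<in> borel_measurable M"
          using X_borel[OF tk] by measurable
        show "AE \<omega> in M. norm (Z \<omega> * ?D k \<omega> * g (X (?t k) \<omega>)) \<le> K * 1 * K"
        proof (rule AE_I2)
          fix \<omega> assume \<omega>: "\<omega> \<in> space M"
          have "norm (Z \<omega> * ?D k \<omega> * g (X (?t k) \<omega>)) = Z \<omega> * ?D k \<omega> * g (X (?t k) \<omega>)"
            using Z(2)[OF \<omega>] g(2) inside_range(1) by (simp add: abs_mult)
          also have "\<dots> \<le> K * 1 * K"
            using Z(2)[OF \<omega>] ZK[OF \<omega>] g(2) hK(4) inside_range K0 by (intro mult_mono mult_nonneg_nonneg) auto
          finally show "norm (Z \<omega> * ?D k \<omega> * g (X (?t k) \<omega>)) \<le> K * 1 * K" .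
        qed
      qed
      have "expectation (\<lambda>\<omega>. Z \<omega> * indicator E \<omega> * Jn n \<omega>) \<le> expectation (\<lambda>\<omega>. \<Sum>k=i0 n..<N n. T / real (N n) * (Z \<omega> * ?D k \<omega> * g (X (?t k) \<omega>)))"
      proof (rule integral_mono)
        show "integrable M (\<lambda>\<omega>. Z \<omega> * indicator E \<omega> * Jn n \<omega>)"
          by (rule integrable_const_bound[of _ "K * 1 * (K * T)"]) (use bd in \<open>auto intro!: AE_I2\<close>)
        show "integrable M (\<lambda>\<omega>. \<Sum>k=i0 n..<N n. T / real (N n) * (Z \<omega> * ?D k \<omega> * g (X (?t k) \<omega>)))"
          by (intro Bochner_Integration.integrable_sum integrable_mult_right int)
        fix \<omega> assume \<omega>: "\<omega> \<in> space M"
        have DE: "indicator E \<omega> \<le> ?D k \<omega>" if k: "k < N n" for k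
        proof (cases "\<omega> \<in> E")
          case True
          have "\<bar>X (?t l) \<omega>\<bar> \<le> R" if "l \<le> k" for l
          proof -
            have "real l / real (N n) \<in> \<rat> \<inter> {0..1}" using that k by (auto simp: field_simps)
            then have "\<bar>X (real l / real (N n) * T) \<omega>\<bar> \<le> R" using True unfolding E_def confined_def by blast
            then show ?thesis by simp
          qed
          then show ?thesis using True by (simp add: inside_eq)
        qed (simp add: inside_range)
        have "Z \<omega> * indicator E \<omega> * Jn n \<omega> = (\<Sum>k=i0 n..<N n. Z \<omega> * indicator E \<omega> * (g (X (?t k) \<omega>) * (T / real (N n))))"
          unfolding Jn_def by (rule sum_distrib_left)
        also have "\<dots> \<le> (\<Sum>k=i0 n..<N n. Z \<omega> * ?D k \<omega> * (g (X (?t k) \<omega>) * (T / real (N n))))"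
          using DE Z(2)[OF \<omega>] g(2) T by (intro sum_mono mult_right_mono mult_left_mono) auto
        also have "\<dots> = (\<Sum>k=i0 n..<N n. T / real (N n) * (Z \<omega> * ?D k \<omega> * g (X (?t k) \<omega>)))"
          by (intro sum.cong refl) simp
        finally show "Z \<omega> * indicator E \<omega> * Jn n \<omega> \<le> (\<Sum>k=i0 n..<N n. T / real (N n) * (Z \<omega> * ?D k \<omega> * g (X (?t k) \<omega>)))" .
      qed
      also have "\<dots> = (\<Sum>k=i0 n..<N n. T / real (N n) * expectation (\<lambda>\<omega>. Z \<omega> * ?D k \<omega> * g (X (?t k) \<omega>)))"
        by (subst Bochner_Integration.integral_sum) (intro integrable_mult_right int, simp only: integral_mult_right_zero)
      also note 1
      also have "K\<^sup>2 * d \<le> K\<^sup>2 * \<epsilon>" using dK by (intro mult_left_mono) auto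
      finally show ?thesis unfolding ti0 by simp
    qed
    have TN: "(\<lambda>n. T / real (N n)) \<longlonglongrightarrow> 0"
    proof -
      have "(\<lambda>n. (T / real m) * inverse (real (Suc n))) \<longlonglongrightarrow> (T / real m) * 0"
        by (intro tendsto_intros LIMSEQ_inverse_real_of_nat)
      then show ?thesis by (simp add: N_def field_simps)
    qed
    define q where "q n = T / real (N n)" for n
    define c1 c2 c3 c4 where "c1 = (K / 2 + \<epsilon>) * K ^ 3 + 24 * C * K ^ 5" and "c2 = 8 * C * K ^ 5"
      and "c3 = expectation (\<lambda>\<omega>. Z \<omega> * h (X s \<omega>)) + K\<^sup>2 * \<epsilon> + T * (\<epsilon> * (K\<^sup>2 + K ^ 3) + \<epsilon> * K ^ 3)"
      and "c4 = K\<^sup>2 + T * (2 * K ^ 3 + K ^ 4)"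
    have "expectation (\<lambda>\<omega>. Z \<omega> * indicator E \<omega> * J \<omega>) \<le> c3 + c4 * \<epsilon> + T * ((c1 + c2 * 0\<^sup>2) * 0)"
    proof (rule LIMSEQ_le[OF lim1])
      have "q \<longlonglongrightarrow> 0" using TN by (simp add: q_def[abs_def])
      moreover have "p \<longlonglongrightarrow> \<epsilon>" using pl by simp
      ultimately show "(\<lambda>n. c3 + c4 * p n + T * ((c1 + c2 * (q n)\<^sup>2) * q n)) \<longlonglongrightarrow> c3 + c4 * \<epsilon> + T * ((c1 + c2 * 0\<^sup>2) * 0)"
        by (intro tendsto_intros)
      have "expectation (\<lambda>\<omega>. Z \<omega> * indicator E \<omega> * Jn n \<omega>) \<le> c3 + c4 * p n + T * ((c1 + c2 * (q n)\<^sup>2) * q n)" for n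
        using bound[of n] unfolding c1_def c2_def c3_def c4_def q_def by (simp add: algebra_simps)
      then show "\<exists>n0. \<forall>n\<ge>n0. expectation (\<lambda>\<omega>. Z \<omega> * indicator E \<omega> * Jn n \<omega>) \<le> c3 + c4 * p n + T * ((c1 + c2 * (q n)\<^sup>2) * q n)"
        by blast
    qed
    also have "c3 + c4 * \<epsilon> + T * ((c1 + c2 * 0\<^sup>2) * 0) = expectation (\<lambda>\<omega>. Z \<omega> * h (X s \<omega>)) + c * \<epsilon>"
      unfolding c3_def c4_def c_def by (simp add: algebra_simps)
    finally show ?thesis .
  qed
  have "expectation (\<lambda>\<omega>. Z \<omega> * indicator E \<omega> * J \<omega>) \<le> expectation (\<lambda>\<omega>. Z \<omega> * h (X s \<omega>))"
  proof (rule field_le_epsilon)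
    fix e :: real assume e: "0 < e"
    have "c * (e / (c + 1)) \<le> e" using c0 e by (simp add: field_simps)
    moreover have "0 < e / (c + 1)" using c0 e by simp
    ultimately show "expectation (\<lambda>\<omega>. Z \<omega> * indicator E \<omega> * J \<omega>) \<le> expectation (\<lambda>\<omega>. Z \<omega> * h (X s \<omega>)) + e"
      using main[of "e / (c + 1)"] by linarith
  qed
  then show ?thesis unfolding E_def J_def s_def .
qed

end

section \<open>Occupation measure and Green potential\<close>

locale transient_diffusion = regular_diffusion M F W a b X A I x + transient_coefficients a b
  for M :: "'w measure" and F W a b X A I x
begin

lemma confined_exhausts:
  assumes T: "0 < T" and \<omega>: "\<omega> \<in> space M"
  shows "\<exists>n0. \<forall>n\<ge>n0. \<omega> \<in> confined T (real (Suc n))"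
proof -
  have "compact ((\<lambda>u. X u \<omega>) ` {0..T})"
    by (intro compact_continuous_image continuous_on_subset[OF X_cont[OF \<omega>]]) auto
  then have "bounded ((\<lambda>u. X u \<omega>) ` {0..T})" by (rule compact_imp_bounded)
  then obtain B where B: "\<And>u. u \<in> {0..T} \<Longrightarrow> \<bar>X u \<omega>\<bar> \<le> B" unfolding bounded_iff real_norm_def by blast
  obtain n0 where n0: "B < real n0" using reals_Archimedean2 by blast
  have "\<omega> \<in> confined T (real (Suc n))" if "n0 \<le> n" for n
    unfolding confined_def
  proof (intro CollectI conjI \<omega> ballI)
    fix q :: real assume q: "q \<in> \<rat> \<inter> {0..1}"
    then have "q * T \<in> {0..T}" using T by (auto simp: mult_left_le_one_le)
    from B[OF this] show "\<bar>X (q * T) \<omega>\<bar> \<le> real (Suc n)" using n0 that by simp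
  qed
  then show ?thesis by blast
qed

text \<open>For each \<open>n\<close> the potential of \<open>g\<close>, cut off at
  \<open>n + 1\<close>, is a test function whose generator equation holds on the range of the
  confined path. It lies below the full potential, so the right-hand side is free of
  \<open>n\<close>, and the confinement is removed on the left by monotone convergence.\<close>

lemma occupation_le_green_continuous:
  fixes g :: "real \<Rightarrow> real"
  assumes g: "continuous_on UNIV g" "\<And>u. 0 \<le> g u" "\<And>u. g u \<le> 1" "\<And>u. u \<notin> {-c..c} \<Longrightarrow> g u = 0" and c: "0 < c"
    and T: "0 < T" and m: "0 < m" "j \<le> m"
    and Z: "Z \<in> borel_measurable (F (real j * T / real m))" "\<And>\<omega>. \<omega> \<in> space M \<Longrightarrow> 0 \<le> Z \<omega>" "\<And>\<omega>. \<omega> \<in> space M \<Longrightarrow> Z \<omega> \<le> B"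
  shows "(\<integral>\<^sup>+\<omega>. ennreal (Z \<omega>) * (\<integral>\<^sup>+u\<in>{real j * T / real m<..T}. ennreal (g (X u \<omega>)) \<partial>lborel) \<partial>M)
    \<le> (\<integral>\<^sup>+\<omega>. ennreal (Z \<omega>) * green (\<lambda>u. ennreal (g u)) (X (real j * T / real m) \<omega>) \<partial>M)"
proof -
  define s where "s = real j * T / real m"
  have s: "0 \<le> s" "s \<le> T" using T m by (auto simp: s_def field_simps)
  have gm [measurable]: "g \<in> borel_measurable borel" using g(1) by (rule borel_measurable_continuous_onI)
  have Zm [measurable]: "Z \<in> borel_measurable M" using Z(1) by (rule measurable_F_M)
  have [measurable]: "X s \<in> borel_measurable M" by (rule X_borel[OF s(1)])
  define J where "J \<omega> = occupation g T \<omega> - occupation g s \<omega>" for \<omega>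
  have T0: "0 \<le> T" using T by simp
  have Jm [measurable]: "J \<in> borel_measurable M"
    unfolding J_def[abs_def]
    by (intro borel_measurable_diff measurable_F_M[OF occupation_measurable[OF gm g(2,3)]] T0 s)
  have J0: "0 \<le> J \<omega>" and J1: "J \<omega> \<le> T" if "\<omega> \<in> space M" for \<omega>
    using occupation_increment[OF gm g(2,3) that s] s(1) by (simp_all add: J_def)
  have Jnn: "(\<integral>\<^sup>+u\<in>{s<..T}. ennreal (g (X u \<omega>)) \<partial>lborel) = ennreal (J \<omega>)" if "\<omega> \<in> space M" for \<omega>
    unfolding J_def by (rule occupation_nn[OF gm g(2,3) that s])
  define E where "E n = confined T (real (Suc n))" for n
  have Em [measurable]: "E n \<in> events" for n unfolding E_def using T by (intro confined_events) simp
  have Einc: "incseq E" unfolding incseq_def E_def confined_def by force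
  have bound: "(\<integral>\<^sup>+\<omega>. ennreal (Z \<omega>) * ennreal (J \<omega>) * indicator (E n) \<omega> \<partial>M)
    \<le> (\<integral>\<^sup>+\<omega>. ennreal (Z \<omega>) * green (\<lambda>u. ennreal (g u)) (X s \<omega>) \<partial>M)" for n
  proof -
    obtain h h1 h2 and B' :: real where h:
      "\<And>x. (h has_real_derivative h1 x) (at x)" "\<And>x. (h1 has_real_derivative h2 x) (at x)"
      "uniformly_continuous_on UNIV h2" "\<And>x. \<bar>h1 x\<bar> \<le> B'" "\<And>x. \<bar>h2 x\<bar> \<le> B'" "\<And>x. h x \<le> B'"
      "\<And>x. 0 \<le> h x" "\<And>x. ennreal (h x) \<le> green (\<lambda>u. ennreal (g u)) x"
      "\<And>x. x \<le> real (Suc n) \<Longrightarrow> b x * h1 x + (a x)\<^sup>2 * h2 x / 2 = - g x"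
      by (rule green_test_function[OF g(1,2,4) c, of "real (Suc n)"]) auto
    define C where "C = max 1 (max B B')"
    have C: "1 \<le> C" "B \<le> C" "B' \<le> C" by (auto simp: C_def)
    have hm [measurable]: "h \<in> borel_measurable borel"
      by (rule borel_measurable_continuous_onI, rule DERIV_continuous_on, rule h(1))
    have core: "expectation (\<lambda>\<omega>. Z \<omega> * indicator (confined T (real (Suc n))) \<omega> * (occupation g T \<omega> - occupation g (real j * T / real m) \<omega>))
      \<le> expectation (\<lambda>\<omega>. Z \<omega> * h (X (real j * T / real m) \<omega>))"
    proof (rule occupation_core[OF h(1,2,3,7) _ _ _ g(1,2) _ _ T m Z(1,2), where B = C])
      show "h y \<le> C" "\<bar>h1 y\<bar> \<le> C" "\<bar>h2 y\<bar> \<le> C" "g y \<le> C" for y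
        using h(4-6)[of y] g(3)[of y] C by linarith+
      show "Z \<omega> \<le> C" if "\<omega> \<in> space M" for \<omega> using Z(3)[OF that] C by linarith
      show "b y * h1 y + (a y)\<^sup>2 * h2 y / 2 = - g y" if "\<bar>y\<bar> \<le> real (Suc n)" for y
        using that by (intro h(9)) linarith
    qed
    have ZC: "Z \<omega> \<le> C" if "\<omega> \<in> space M" for \<omega> using Z(3)[OF that] C by linarith
    have hC: "h y \<le> C" for y using h(6)[of y] C by linarith
    have "(\<integral>\<^sup>+\<omega>. ennreal (Z \<omega>) * ennreal (J \<omega>) * indicator (E n) \<omega> \<partial>M)
      = (\<integral>\<^sup>+\<omega>. ennreal (Z \<omega> * indicator (E n) \<omega> * J \<omega>) \<partial>M)"
      by (rule nn_integral_cong) (use Z(2) J0 in \<open>auto simp: indicator_def ennreal_mult\<close>)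
    also have "\<dots> = ennreal (expectation (\<lambda>\<omega>. Z \<omega> * indicator (E n) \<omega> * J \<omega>))"
    proof (rule nn_integral_eq_integral)
      show "integrable M (\<lambda>\<omega>. Z \<omega> * indicator (E n) \<omega> * J \<omega>)"
      proof (rule integrable_const_bound[of _ "C * 1 * T"])
        show "AE \<omega> in M. norm (Z \<omega> * indicator (E n) \<omega> * J \<omega>) \<le> C * 1 * T"
        proof (rule AE_I2)
          fix \<omega> assume \<omega>: "\<omega> \<in> space M"
          have "norm (Z \<omega> * indicator (E n) \<omega> * J \<omega>) = Z \<omega> * indicator (E n) \<omega> * J \<omega>"
            using Z(2)[OF \<omega>] J0[OF \<omega>] by (simp add: abs_mult)
          also have "\<dots> \<le> C * 1 * T"
            using Z(2)[OF \<omega>] ZC[OF \<omega>] J0[OF \<omega>] J1[OF \<omega>] C by (intro mult_mono mult_nonneg_nonneg) auto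
          finally show "norm (Z \<omega> * indicator (E n) \<omega> * J \<omega>) \<le> C * 1 * T" .
        qed
      qed measurable
      show "AE \<omega> in M. 0 \<le> Z \<omega> * indicator (E n) \<omega> * J \<omega>"
        by (intro AE_I2 mult_nonneg_nonneg Z(2) J0) auto
    qed
    also have "\<dots> \<le> ennreal (expectation (\<lambda>\<omega>. Z \<omega> * h (X s \<omega>)))"
      using core unfolding E_def J_def s_def by (rule ennreal_leI)
    also have "\<dots> = (\<integral>\<^sup>+\<omega>. ennreal (Z \<omega> * h (X s \<omega>)) \<partial>M)"
    proof (rule nn_integral_eq_integral[symmetric])
      show "integrable M (\<lambda>\<omega>. Z \<omega> * h (X s \<omega>))"
      proof (rule integrable_const_bound[of _ "C * C"])
        show "AE \<omega> in M. norm (Z \<omega> * h (X s \<omega>)) \<le> C * C"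
          using Z(2) ZC h(7) hC C by (intro AE_I2) (auto simp: abs_mult intro!: mult_mono)
      qed measurable
      show "AE \<omega> in M. 0 \<le> Z \<omega> * h (X s \<omega>)" by (intro AE_I2 mult_nonneg_nonneg Z(2) h(7))
    qed
    also have "\<dots> \<le> (\<integral>\<^sup>+\<omega>. ennreal (Z \<omega>) * green (\<lambda>u. ennreal (g u)) (X s \<omega>) \<partial>M)"
      by (rule nn_integral_mono) (use Z(2) h(7,8) in \<open>auto simp: ennreal_mult intro!: mult_left_mono\<close>)
    finally show ?thesis .
  qed
  have "(\<integral>\<^sup>+\<omega>. ennreal (Z \<omega>) * (\<integral>\<^sup>+u\<in>{s<..T}. ennreal (g (X u \<omega>)) \<partial>lborel) \<partial>M)
    = (\<integral>\<^sup>+\<omega>. (SUP n. ennreal (Z \<omega>) * ennreal (J \<omega>) * indicator (E n) \<omega>) \<partial>M)"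
  proof (rule nn_integral_cong)
    fix \<omega> assume \<omega>: "\<omega> \<in> space M"
    obtain n0 where n0: "\<omega> \<in> E n0" using confined_exhausts[OF T \<omega>] unfolding E_def by blast
    have "(SUP n. ennreal (Z \<omega>) * ennreal (J \<omega>) * indicator (E n) \<omega>) = ennreal (Z \<omega>) * ennreal (J \<omega>)"
    proof (rule antisym)
      show "(SUP n. ennreal (Z \<omega>) * ennreal (J \<omega>) * indicator (E n) \<omega>) \<le> ennreal (Z \<omega>) * ennreal (J \<omega>)"
        by (rule SUP_least) (simp add: indicator_def)
      show "ennreal (Z \<omega>) * ennreal (J \<omega>) \<le> (SUP n. ennreal (Z \<omega>) * ennreal (J \<omega>) * indicator (E n) \<omega>)"
        by (rule SUP_upper2[of n0]) (use n0 in auto)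
    qed
    then show "ennreal (Z \<omega>) * (\<integral>\<^sup>+u\<in>{s<..T}. ennreal (g (X u \<omega>)) \<partial>lborel) = (SUP n. ennreal (Z \<omega>) * ennreal (J \<omega>) * indicator (E n) \<omega>)"
      using Jnn[OF \<omega>] by simp
  qed
  also have "\<dots> = (SUP n. \<integral>\<^sup>+\<omega>. ennreal (Z \<omega>) * ennreal (J \<omega>) * indicator (E n) \<omega> \<partial>M)"
  proof (rule nn_integral_monotone_convergence_SUP)
    show "incseq (\<lambda>n \<omega>. ennreal (Z \<omega>) * ennreal (J \<omega>) * indicator (E n) \<omega>)"
      using Einc unfolding incseq_def le_fun_def by (intro allI impI mult_left_mono) (auto simp: indicator_def)
  qed measurable
  also have "\<dots> \<le> (\<integral>\<^sup>+\<omega>. ennreal (Z \<omega>) * green (\<lambda>u. ennreal (g u)) (X s \<omega>) \<partial>M)"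
    by (rule SUP_least) (rule bound)
  finally show ?thesis unfolding s_def .
qed

text \<open>The left side integrates \<open>g\<close> against \<open>\<mu>\<close>, the image under
  the process of the measure with density \<open>Z\<close> on the product of the probability space
  with \<open>(s, T]\<close>. The right side integrates it against \<open>\<nu>\<close>, whose
  Lebesgue density at \<open>u\<close> is the expectation of \<open>Z\<close> times the Green kernel
  from \<open>X s\<close> to \<open>u\<close>. Continuous functions of compact support are covered
  by the preceding inequality, and \<open>\<nu>\<close> is locally finite because the kernel is
  bounded uniformly in the starting point.\<close>

lemma occupation_le_green:
  fixes g :: "real \<Rightarrow> ennreal"
  assumes g: "g \<in> borel_measurable borel"
    and T: "0 < T" and m: "0 < m" "j \<le> m"
    and Z: "Z \<in> borel_measurable (F (real j * T / real m))" "\<And>\<omega>. \<omega> \<in> space M \<Longrightarrow> 0 \<le> Z \<omega>" "\<And>\<omega>. \<omega> \<in> space M \<Longrightarrow> Z \<omega> \<le> B"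
  shows "(\<integral>\<^sup>+\<omega>. ennreal (Z \<omega>) * (\<integral>\<^sup>+u\<in>{real j * T / real m<..T}. g (X u \<omega>) \<partial>lborel) \<partial>M)
    \<le> (\<integral>\<^sup>+\<omega>. ennreal (Z \<omega>) * green g (X (real j * T / real m) \<omega>) \<partial>M)"
proof -
  define s where "s = real j * T / real m"
  have s: "0 \<le> s" "s \<le> T" using T m by (auto simp: s_def field_simps)
  have Zm [measurable]: "Z \<in> borel_measurable M" using Z(1) by (rule measurable_F_M)
  have Xs [measurable]: "X s \<in> borel_measurable M" by (rule X_borel[OF s(1)])
  note X_joint_all[measurable]
  define w where "w p = ennreal (Z (fst p)) * indicator {s<..T} (snd p)" for p :: "'w \<times> real"
  have wm [measurable]: "w \<in> borel_measurable (M \<Otimes>\<^sub>M lborel)" unfolding w_def[abs_def] by measurable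
  define \<mu> where "\<mu> = distr (density (M \<Otimes>\<^sub>M lborel) w) borel (\<lambda>p. X (max 0 (snd p)) (fst p))"
  define k where "k u = (\<integral>\<^sup>+\<omega>. ennreal (Z \<omega>) * ennreal (green_kernel (X s \<omega>) u) \<partial>M)" for u
  have gkm [measurable]: "(\<lambda>p. ennreal (green_kernel (X s (fst p)) (snd p))) \<in> borel_measurable (M \<Otimes>\<^sub>M lborel)"
  proof -
    have "(\<lambda>p. (X s (fst p), snd p)) \<in> measurable (M \<Otimes>\<^sub>M lborel) (borel \<Otimes>\<^sub>M borel)" by measurable
    from measurable_compose[OF this green_kernel_measurable] show ?thesis by simp
  qed
  have gkm' [measurable]: "(\<lambda>p. ennreal (green_kernel (X s (snd p)) (fst p))) \<in> borel_measurable (lborel \<Otimes>\<^sub>M M)"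
  proof -
    have "(\<lambda>p. (X s (snd p), fst p)) \<in> measurable (lborel \<Otimes>\<^sub>M M) (borel \<Otimes>\<^sub>M borel)" by measurable
    from measurable_compose[OF this green_kernel_measurable] show ?thesis by simp
  qed
  have km [measurable]: "k \<in> borel_measurable lborel"
    unfolding k_def[abs_def] by (rule borel_measurable_nn_integral) (simp add: case_prod_beta')
  define \<nu> where "\<nu> = density lborel k"
  have int\<mu>: "(\<integral>\<^sup>+u. g u \<partial>\<mu>) = (\<integral>\<^sup>+\<omega>. ennreal (Z \<omega>) * (\<integral>\<^sup>+u\<in>{s<..T}. g (X u \<omega>) \<partial>lborel) \<partial>M)"
    if [measurable]: "g \<in> borel_measurable borel" for g :: "real \<Rightarrow> ennreal"
  proof -
    have "(\<integral>\<^sup>+u. g u \<partial>\<mu>) = (\<integral>\<^sup>+p. g (X (max 0 (snd p)) (fst p)) \<partial>density (M \<Otimes>\<^sub>M lborel) w)"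
      unfolding \<mu>_def by (rule nn_integral_distr) measurable
    also have "\<dots> = (\<integral>\<^sup>+p. w p * g (X (max 0 (snd p)) (fst p)) \<partial>(M \<Otimes>\<^sub>M lborel))"
      by (rule nn_integral_density) measurable
    also have "\<dots> = (\<integral>\<^sup>+\<omega>. \<integral>\<^sup>+u. w (\<omega>, u) * g (X (max 0 u) \<omega>) \<partial>lborel \<partial>M)"
      by (subst lborel.nn_integral_fst[symmetric]) simp_all
    also have "\<dots> = (\<integral>\<^sup>+\<omega>. ennreal (Z \<omega>) * (\<integral>\<^sup>+u\<in>{s<..T}. g (X u \<omega>) \<partial>lborel) \<partial>M)"
    proof (rule nn_integral_cong)
      fix \<omega> assume \<omega>: "\<omega> \<in> space M"
      have eq: "w (\<omega>, u) * g (X (max 0 u) \<omega>) = ennreal (Z \<omega>) * (g (X (max 0 u) \<omega>) * indicator {s<..T} u)" for u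
        by (simp add: w_def mult_ac)
      have [measurable]: "(\<lambda>u. X (max 0 u) \<omega>) \<in> borel_measurable lborel"
        using path_measurable[OF \<omega>, of "\<lambda>y. y"] by simp
      have "(\<integral>\<^sup>+u. w (\<omega>, u) * g (X (max 0 u) \<omega>) \<partial>lborel)
          = ennreal (Z \<omega>) * (\<integral>\<^sup>+u. g (X (max 0 u) \<omega>) * indicator {s<..T} u \<partial>lborel)"
        unfolding eq by (rule nn_integral_cmult) measurable
      also have "(\<integral>\<^sup>+u. g (X (max 0 u) \<omega>) * indicator {s<..T} u \<partial>lborel) = (\<integral>\<^sup>+u\<in>{s<..T}. g (X u \<omega>) \<partial>lborel)"
        by (rule nn_integral_cong) (use s in \<open>auto simp: indicator_def max_def min_def\<close>)
      finally show "(\<integral>\<^sup>+u. w (\<omega>, u) * g (X (max 0 u) \<omega>) \<partial>lborel) = ennreal (Z \<omega>) * (\<integral>\<^sup>+u\<in>{s<..T}. g (X u \<omega>) \<partial>lborel)" .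
    qed
    finally show ?thesis .
  qed
  have int\<nu>: "(\<integral>\<^sup>+u. g u \<partial>\<nu>) = (\<integral>\<^sup>+\<omega>. ennreal (Z \<omega>) * green g (X s \<omega>) \<partial>M)"
    if [measurable]: "g \<in> borel_measurable borel" for g :: "real \<Rightarrow> ennreal"
  proof -
    interpret P: pair_sigma_finite M lborel
      by (intro pair_sigma_finite.intro sigma_finite_lborel sigma_finite_measure_axioms)
    have "(\<integral>\<^sup>+u. g u \<partial>\<nu>) = (\<integral>\<^sup>+u. k u * g u \<partial>lborel)"
      unfolding \<nu>_def by (rule nn_integral_density) measurable
    also have "\<dots> = (\<integral>\<^sup>+u. \<integral>\<^sup>+\<omega>. ennreal (Z \<omega>) * (g u * ennreal (green_kernel (X s \<omega>) u)) \<partial>M \<partial>lborel)"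
    proof (rule nn_integral_cong)
      fix u :: real
      have [measurable]: "(\<lambda>\<omega>. ennreal (green_kernel (X s \<omega>) u)) \<in> borel_measurable M"
        using measurable_compose[OF measurable_Pair2'[of u lborel M] gkm] by simp
      have "k u * g u = (\<integral>\<^sup>+\<omega>. ennreal (Z \<omega>) * ennreal (green_kernel (X s \<omega>) u) * g u \<partial>M)"
        unfolding k_def by (rule nn_integral_multc[symmetric]) measurable
      also have "\<dots> = (\<integral>\<^sup>+\<omega>. ennreal (Z \<omega>) * (g u * ennreal (green_kernel (X s \<omega>) u)) \<partial>M)"
        by (rule nn_integral_cong) (simp add: mult_ac)
      finally show "k u * g u = (\<integral>\<^sup>+\<omega>. ennreal (Z \<omega>) * (g u * ennreal (green_kernel (X s \<omega>) u)) \<partial>M)" .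
    qed
    also have "\<dots> = (\<integral>\<^sup>+\<omega>. \<integral>\<^sup>+u. ennreal (Z \<omega>) * (g u * ennreal (green_kernel (X s \<omega>) u)) \<partial>lborel \<partial>M)"
      by (rule P.Fubini') (simp add: case_prod_beta')
    also have "\<dots> = (\<integral>\<^sup>+\<omega>. ennreal (Z \<omega>) * green g (X s \<omega>) \<partial>M)"
    proof (rule nn_integral_cong)
      fix \<omega> assume \<omega>: "\<omega> \<in> space M"
      have [measurable]: "(\<lambda>u. ennreal (green_kernel (X s \<omega>) u)) \<in> borel_measurable lborel"
        using measurable_compose[OF measurable_Pair1'[OF \<omega>, of lborel] gkm] by simp
      show "(\<integral>\<^sup>+u. ennreal (Z \<omega>) * (g u * ennreal (green_kernel (X s \<omega>) u)) \<partial>lborel) = ennreal (Z \<omega>) * green g (X s \<omega>)"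
        unfolding green_def by (rule nn_integral_cmult) measurable
    qed
    finally show ?thesis .
  qed
  have "(\<integral>\<^sup>+u. g u \<partial>\<mu>) \<le> (\<integral>\<^sup>+u. g u \<partial>\<nu>)"
  proof (rule real_measure_le_of_continuous)
    show "sets \<mu> = sets borel" "sets \<nu> = sets borel" by (simp_all add: \<mu>_def \<nu>_def)
    show "g \<in> borel_measurable borel" by (rule g)
    fix c :: real
    obtain C where C: "\<And>y u. u \<in> {-c..c} \<Longrightarrow> green_kernel y u \<le> C"
      using green_kernel_locally_bounded[of c] by blast
    have kC: "k u \<le> ennreal (\<bar>B\<bar> * \<bar>C\<bar>)" if u: "u \<in> {-c..c}" for u
    proof -
      have "k u \<le> (\<integral>\<^sup>+\<omega>. ennreal (\<bar>B\<bar> * \<bar>C\<bar>) \<partial>M)"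
        unfolding k_def
      proof (rule nn_integral_mono)
        fix \<omega> assume \<omega>: "\<omega> \<in> space M"
        have "ennreal (Z \<omega>) * ennreal (green_kernel (X s \<omega>) u) = ennreal (Z \<omega> * green_kernel (X s \<omega>) u)"
          using Z(2)[OF \<omega>] green_kernel_nonneg by (simp add: ennreal_mult)
        also have "\<dots> \<le> ennreal (\<bar>B\<bar> * \<bar>C\<bar>)"
          using Z(2,3)[OF \<omega>] C[OF u, of "X s \<omega>"] green_kernel_nonneg by (intro ennreal_leI mult_mono) auto
        finally show "ennreal (Z \<omega>) * ennreal (green_kernel (X s \<omega>) u) \<le> ennreal (\<bar>B\<bar> * \<bar>C\<bar>)" .
      qed
      then show ?thesis by (simp add: emeasure_space_1)
    qed
    have "emeasure \<nu> {-c<..<c} = (\<integral>\<^sup>+u. k u * indicator {-c<..<c} u \<partial>lborel)"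
      unfolding \<nu>_def by (rule emeasure_density) auto
    also have "\<dots> \<le> (\<integral>\<^sup>+u. ennreal (\<bar>B\<bar> * \<bar>C\<bar>) * indicator {-c..c} u \<partial>lborel)"
      by (rule nn_integral_mono) (use kC in \<open>auto simp: indicator_def\<close>)
    also have "\<dots> = ennreal (\<bar>B\<bar> * \<bar>C\<bar>) * emeasure lborel {-c..c}" by (rule nn_integral_cmult_indicator) auto
    also have "\<dots> < \<infinity>" by (auto simp: emeasure_lborel_Icc_eq ennreal_mult_less_top)
    finally show "emeasure \<nu> {-c<..<c} < \<infinity>" .
  next
    fix g :: "real \<Rightarrow> real" and c :: real
    assume g: "continuous_on UNIV g" "\<And>u. 0 \<le> g u" "\<And>u. g u \<le> 1" "0 < c" "\<And>u. u \<notin> {-c..c} \<Longrightarrow> g u = 0"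
    have "(\<lambda>u. ennreal (g u)) \<in> borel_measurable borel" using borel_measurable_continuous_onI[OF g(1)] by simp
    from int\<mu>[OF this] int\<nu>[OF this]
    show "(\<integral>\<^sup>+u. ennreal (g u) \<partial>\<mu>) \<le> (\<integral>\<^sup>+u. ennreal (g u) \<partial>\<nu>)"
      using occupation_le_green_continuous[OF g(1-3,5,4) T m Z] by (simp add: s_def)
  qed
  then show ?thesis using int\<mu>[OF g] int\<nu>[OF g] by (simp add: s_def)
qed

end

section \<open>Exponential moments\<close>

text \<open>From \<open>1 - y \<le> exp (- y)\<close> follows
  \<open>exp y - 1 \<le> y * exp y\<close>, so each increment of the exponential is at most
  \<open>c\<close> times its left value times the increment of \<open>a\<close>, up to the factor
  \<open>exp (c * D)\<close>, which tends to 1 with the mesh. Abel summation then shifts the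
  increments to the exponentials. Pairing with \<open>a n - a (Suc i)\<close> matters: the increment
  of the exponential is known at the right endpoint of its cell, and the remaining growth of
  \<open>a\<close> starts there.\<close>

lemma exp_summation_by_parts_bound:
  fixes a :: "nat \<Rightarrow> real" and c D :: real
  assumes c: "0 \<le> c" and a: "a 0 = 0" "\<And>i. i < n \<Longrightarrow> a i \<le> a (Suc i)" "\<And>i. i < n \<Longrightarrow> a (Suc i) - a i \<le> D"
  shows "exp (c * a n) - 1 \<le> c * exp (c * D) * (a n + (\<Sum>i<n. (exp (c * a (Suc i)) - exp (c * a i)) * (a n - a (Suc i))))"
proof -
  define e where "e i = exp (c * a i)" for i
  \<comment> \<open>The level \<open>y\<close> is independent of \<open>k\<close> so that the
    induction goes through; it is set to \<open>a n\<close> afterwards.\<close>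
  have parts: "(\<Sum>i<k. (e (Suc i) - e i) * (y - a (Suc i))) = e k * (y - a k) - e 0 * (y - a 0) + (\<Sum>i<k. e i * (a (Suc i) - a i))" for k y
    by (induction k) (simp_all add: algebra_simps)
  have inc: "e (Suc i) - e i \<le> c * exp (c * D) * (e i * (a (Suc i) - a i))" if i: "i < n" for i
  proof -
    define d where "d = a (Suc i) - a i"
    have d: "0 \<le> d" "d \<le> D" using a i by (auto simp: d_def)
    have "1 - c * d \<le> exp (- (c * d))" using exp_ge_add_one_self[of "- (c * d)"] by simp
    then have "(1 - c * d) * exp (c * d) \<le> exp (- (c * d)) * exp (c * d)" by (rule mult_right_mono) simp
    then have "exp (c * d) - 1 \<le> c * d * exp (c * d)" by (simp add: algebra_simps exp_minus)
    also have "\<dots> \<le> c * d * exp (c * D)" using c d by (intro mult_left_mono) (auto intro: mult_left_mono)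
    finally have "e i * (exp (c * d) - 1) \<le> e i * (c * d * exp (c * D))" by (rule mult_left_mono) (simp add: e_def)
    moreover have "e (Suc i) = e i * exp (c * d)" by (simp add: e_def d_def exp_add[symmetric] algebra_simps)
    ultimately show ?thesis by (simp add: algebra_simps d_def)
  qed
  have "exp (c * a n) - 1 = e n - e 0" using a(1) by (simp add: e_def)
  also have "\<dots> = (\<Sum>i<n. e (Suc i) - e i)" by (simp add: sum_lessThan_telescope)
  also have "\<dots> \<le> (\<Sum>i<n. c * exp (c * D) * (e i * (a (Suc i) - a i)))" by (intro sum_mono inc) simp
  also have "\<dots> = c * exp (c * D) * (\<Sum>i<n. e i * (a (Suc i) - a i))" by (simp add: sum_distrib_left)
  also have "(\<Sum>i<n. e i * (a (Suc i) - a i)) = a n + (\<Sum>i<n. (e (Suc i) - e i) * (a n - a (Suc i)))"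
    using parts[where k = n and y = "a n"] a(1) by (simp add: e_def)
  finally show ?thesis unfolding e_def .
qed

context transient_diffusion
begin

text \<open>The potential at the random point \<open>X s\<close> is replaced by its uniform bound
  \<open>P\<close>, so nothing about the law of \<open>X s\<close> enters. Since \<open>g\<close>
  and \<open>Z\<close> are bounded, the extended integrals are ordinary expectations.\<close>

lemma occupation_conditional_bound:
  assumes g: "g \<in> borel_measurable borel" "\<And>u. 0 \<le> g u" "\<And>u. g u \<le> C"
    and P: "\<And>y. green (\<lambda>u. ennreal (g u)) y \<le> ennreal P" "0 \<le> P"
    and T: "0 < T" and m: "0 < m" "j \<le> m"
    and Z: "Z \<in> borel_measurable (F (real j * T / real m))" "\<And>\<omega>. \<omega> \<in> space M \<Longrightarrow> 0 \<le> Z \<omega>" "\<And>\<omega>. \<omega> \<in> space M \<Longrightarrow> Z \<omega> \<le> B"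
  shows "expectation (\<lambda>\<omega>. Z \<omega> * (occupation g T \<omega> - occupation g (real j * T / real m) \<omega>)) \<le> P * expectation Z"
    "integrable M (\<lambda>\<omega>. Z \<omega> * (occupation g T \<omega> - occupation g (real j * T / real m) \<omega>))"
    "integrable M Z"
proof -
  define s where "s = real j * T / real m"
  have s: "0 \<le> s" "s \<le> T" using T m by (auto simp: s_def field_simps)
  have Zm [measurable]: "Z \<in> borel_measurable M" using Z(1) by (rule measurable_F_M)
  have [measurable]: "occupation g T \<in> borel_measurable M" "occupation g s \<in> borel_measurable M"
    by (rule measurable_F_M[OF occupation_measurable[OF g less_imp_le[OF T]]], rule measurable_F_M[OF occupation_measurable[OF g s(1)]])
  have Zi: "integrable M Z" using Z by (intro integrable_const_bound[of _ B] AE_I2) auto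
  have Ai: "integrable M (\<lambda>\<omega>. Z \<omega> * (occupation g T \<omega> - occupation g s \<omega>))"
  proof (rule integrable_const_bound[of _ "B * (C * (T - s))"])
    show "AE \<omega> in M. norm (Z \<omega> * (occupation g T \<omega> - occupation g s \<omega>)) \<le> B * (C * (T - s))"
    proof (rule AE_I2)
      fix \<omega> assume \<omega>: "\<omega> \<in> space M"
      have "norm (Z \<omega> * (occupation g T \<omega> - occupation g s \<omega>)) = Z \<omega> * (occupation g T \<omega> - occupation g s \<omega>)"
        using Z(2)[OF \<omega>] occupation_increment(1)[OF g \<omega> s] by (simp add: abs_mult)
      also have "\<dots> \<le> B * (C * (T - s))"
        using Z(2,3)[OF \<omega>] occupation_increment[OF g \<omega> s] by (intro mult_mono) auto
      finally show "norm (Z \<omega> * (occupation g T \<omega> - occupation g s \<omega>)) \<le> B * (C * (T - s))" .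
    qed
  qed measurable
  have "ennreal (expectation (\<lambda>\<omega>. Z \<omega> * (occupation g T \<omega> - occupation g s \<omega>))) = (\<integral>\<^sup>+\<omega>. ennreal (Z \<omega> * (occupation g T \<omega> - occupation g s \<omega>)) \<partial>M)"
    by (rule nn_integral_eq_integral[OF Ai, symmetric])
      (use Z(2) occupation_increment(1)[OF g _ s] in \<open>auto intro!: AE_I2 mult_nonneg_nonneg\<close>)
  also have "\<dots> = (\<integral>\<^sup>+\<omega>. ennreal (Z \<omega>) * (\<integral>\<^sup>+u\<in>{s<..T}. ennreal (g (X u \<omega>)) \<partial>lborel) \<partial>M)"
    by (rule nn_integral_cong) (use Z(2) occupation_increment(1)[OF g _ s] occupation_nn[OF g _ s] in \<open>auto simp: ennreal_mult\<close>)
  also have "\<dots> \<le> (\<integral>\<^sup>+\<omega>. ennreal (Z \<omega>) * green (\<lambda>u. ennreal (g u)) (X s \<omega>) \<partial>M)"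
    unfolding s_def by (rule occupation_le_green[OF _ T m Z]) (use g(1) in measurable)
  also have "\<dots> \<le> (\<integral>\<^sup>+\<omega>. ennreal (Z \<omega>) * ennreal P \<partial>M)"
    by (intro nn_integral_mono mult_left_mono P) simp
  also have "\<dots> = (\<integral>\<^sup>+\<omega>. ennreal (Z \<omega>) \<partial>M) * ennreal P" by (rule nn_integral_multc) measurable
  also have "(\<integral>\<^sup>+\<omega>. ennreal (Z \<omega>) \<partial>M) = ennreal (expectation Z)"
    by (rule nn_integral_eq_integral[OF Zi]) (use Z(2) in \<open>auto intro!: AE_I2\<close>)
  also have "ennreal (expectation Z) * ennreal P = ennreal (P * expectation Z)"
    using P(2) Bochner_Integration.integral_nonneg[of M Z] Z(2) by (simp add: ennreal_mult mult.commute)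
  finally show "expectation (\<lambda>\<omega>. Z \<omega> * (occupation g T \<omega> - occupation g (real j * T / real m) \<omega>)) \<le> P * expectation Z"
    using P(2) Bochner_Integration.integral_nonneg[of M Z] Z(2) unfolding s_def by simp
  show "integrable M (\<lambda>\<omega>. Z \<omega> * (occupation g T \<omega> - occupation g (real j * T / real m) \<omega>))" "integrable M Z"
    using Ai Zi unfolding s_def by auto
qed

text \<open>With the bound \<open>C\<close> on \<open>g\<close> the exponential moment is finite
  from the outset, and each mesh \<open>T / (n + 1)\<close> gives an inequality for it with the
  extra factor \<open>exp (c * C * T / (n + 1))\<close>. In the limit the factor is 1, and
  \<open>c * P < 1\<close> allows the inequality to be solved.\<close>

lemma exponential_moment_bound:
  assumes g: "g \<in> borel_measurable borel" "\<And>u. 0 \<le> g u" "\<And>u. g u \<le> C"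
    and P: "\<And>y. green (\<lambda>u. ennreal (g u)) y \<le> ennreal P" "0 \<le> P"
    and T: "0 < T" and c: "0 \<le> c" "c * P < 1"
  shows "integrable M (\<lambda>\<omega>. exp (c * occupation g T \<omega>))" "expectation (\<lambda>\<omega>. exp (c * occupation g T \<omega>)) \<le> 1 / (1 - c * P)"
proof -
  have C0: "0 \<le> C" using g(2,3)[of 0] by linarith
  have bnd: "exp (c * occupation g t \<omega>) \<le> exp (c * (C * T))" if "\<omega> \<in> space M" "0 \<le> t" "t \<le> T" for t \<omega>
  proof -
    have "occupation g t \<omega> \<le> C * t" using occupation_increment(2)[OF g that(1) order_refl that(2)] by (simp add: occupation_0)
    also have "\<dots> \<le> C * T" using C0 that by (intro mult_left_mono) auto
    finally show ?thesis using c by (simp add: mult_left_mono)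
  qed
  have Am: "occupation g t \<in> borel_measurable M" if "0 \<le> t" for t by (rule measurable_F_M[OF occupation_measurable[OF g that]])
  define x where "x = expectation (\<lambda>\<omega>. exp (c * occupation g T \<omega>))"
  have ei: "integrable M (\<lambda>\<omega>. exp (c * occupation g t \<omega>))" if "0 \<le> t" "t \<le> T" for t
    by (rule integrable_const_bound[of _ "exp (c * (C * T))"]) (use bnd that Am[OF that(1)] in \<open>auto intro!: AE_I2\<close>)
  show "integrable M (\<lambda>\<omega>. exp (c * occupation g T \<omega>))" using ei[of T] T by simp
  have step: "x - 1 \<le> c * exp (c * (C * (T / real (Suc n)))) * (P * x)" for n
  proof -
    define m where "m = Suc n"
    have m: "0 < m" by (simp add: m_def)
    define t where "t i = real i * T / real m" for i
    have t: "0 \<le> t i" "t i \<le> t (Suc i)" for i using T by (auto simp: t_def intro!: divide_right_mono mult_right_mono)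
    have tT: "t i \<le> T" if "i \<le> m" for i using that T m by (simp add: t_def field_simps)
    have tm: "t m = T" "t 0 = 0" using m by (auto simp: t_def)
    have td: "t (Suc i) - t i = T / real m" for i using m by (simp add: t_def field_simps)
    define D where "D = C * (T / real m)"
    define Z where "Z i \<omega> = exp (c * occupation g (t (Suc i)) \<omega>) - exp (c * occupation g (t i) \<omega>)" for i \<omega>
    have Zp: "0 \<le> Z i \<omega>" "Z i \<omega> \<le> exp (c * (C * T))" if "\<omega> \<in> space M" "i < m" for i \<omega>
    proof -
      show "0 \<le> Z i \<omega>" unfolding Z_def using occupation_increment(1)[OF g that(1) t[of i]] c(1) by (simp add: mult_left_mono)
      show "Z i \<omega> \<le> exp (c * (C * T))" unfolding Z_def
        using bnd[OF that(1) t(1) tT[of "Suc i"]] that(2) exp_ge_zero[of "c * occupation g (t i) \<omega>"] by linarith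
    qed
    have Zm: "Z i \<in> borel_measurable (F (t (Suc i)))" for i
    proof -
      have "occupation g (t i) \<in> borel_measurable (F (t (Suc i)))" "occupation g (t (Suc i)) \<in> borel_measurable (F (t (Suc i)))"
        by (rule measurable_F_mono[OF t(2) occupation_measurable[OF g t(1)]]) (rule occupation_measurable[OF g t(1)])
      then show ?thesis unfolding Z_def[abs_def] by measurable
    qed
    have cb: "expectation (\<lambda>\<omega>. Z i \<omega> * (occupation g T \<omega> - occupation g (t (Suc i)) \<omega>)) \<le> P * expectation (Z i)"
      "integrable M (\<lambda>\<omega>. Z i \<omega> * (occupation g T \<omega> - occupation g (t (Suc i)) \<omega>))" "integrable M (Z i)" if "i < m" for i
      using occupation_conditional_bound[OF g P T m Suc_leI[OF that] Zm[of i, unfolded t_def] Zp[OF _ that]]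
      unfolding t_def by blast+
    have c0: "expectation (occupation g T) \<le> P" "integrable M (occupation g T)"
      using occupation_conditional_bound(1)[OF g P T m le0, of "\<lambda>_. 1" 1]
        occupation_conditional_bound(2)[OF g P T m le0, of "\<lambda>_. 1" 1] by (simp_all add: occupation_0 prob_space)
    have "expectation (\<lambda>\<omega>. exp (c * occupation g T \<omega>) - 1)
      \<le> expectation (\<lambda>\<omega>. c * exp (c * D) * (occupation g T \<omega> + (\<Sum>i<m. Z i \<omega> * (occupation g T \<omega> - occupation g (t (Suc i)) \<omega>))))"
    proof (rule integral_mono)
      show "integrable M (\<lambda>\<omega>. exp (c * occupation g T \<omega>) - 1)" using ei[of T] T by simp
      show "integrable M (\<lambda>\<omega>. c * exp (c * D) * (occupation g T \<omega> + (\<Sum>i<m. Z i \<omega> * (occupation g T \<omega> - occupation g (t (Suc i)) \<omega>))))"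
        by (intro integrable_mult_right Bochner_Integration.integrable_add Bochner_Integration.integrable_sum c0 cb) simp
      fix \<omega> assume \<omega>: "\<omega> \<in> space M"
      have "exp (c * occupation g (t m) \<omega>) - 1 \<le> c * exp (c * D) * (occupation g (t m) \<omega> + (\<Sum>i<m. (exp (c * occupation g (t (Suc i)) \<omega>) - exp (c * occupation g (t i) \<omega>)) * (occupation g (t m) \<omega> - occupation g (t (Suc i)) \<omega>)))"
      proof (rule exp_summation_by_parts_bound[OF c(1)])
        show "occupation g (t 0) \<omega> = 0" by (simp add: tm occupation_0)
        show "occupation g (t i) \<omega> \<le> occupation g (t (Suc i)) \<omega>" for i by (rule occupation_increment(1)[OF g \<omega> t])
        show "occupation g (t (Suc i)) \<omega> - occupation g (t i) \<omega> \<le> D" for i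
          using occupation_increment(2)[OF g \<omega> t[of i]] unfolding td D_def .
      qed
      then show "exp (c * occupation g T \<omega>) - 1 \<le> c * exp (c * D) * (occupation g T \<omega> + (\<Sum>i<m. Z i \<omega> * (occupation g T \<omega> - occupation g (t (Suc i)) \<omega>)))"
        unfolding tm Z_def .
    qed
    also have "\<dots> = c * exp (c * D) * (expectation (occupation g T) + (\<Sum>i<m. expectation (\<lambda>\<omega>. Z i \<omega> * (occupation g T \<omega> - occupation g (t (Suc i)) \<omega>))))"
    proof -
      have int_sum: "integrable M (\<lambda>\<omega>. \<Sum>i<m. Z i \<omega> * (occupation g T \<omega> - occupation g (t (Suc i)) \<omega>))"
        by (rule Bochner_Integration.integrable_sum) (use cb in simp)
      have "expectation (\<lambda>\<omega>. \<Sum>i<m. Z i \<omega> * (occupation g T \<omega> - occupation g (t (Suc i)) \<omega>))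
          = (\<Sum>i<m. expectation (\<lambda>\<omega>. Z i \<omega> * (occupation g T \<omega> - occupation g (t (Suc i)) \<omega>)))"
        by (rule Bochner_Integration.integral_sum) (use cb in simp)
      then show ?thesis
        by (simp only: integral_mult_right_zero Bochner_Integration.integral_add[OF c0(2) int_sum])
    qed
    also have "\<dots> \<le> c * exp (c * D) * (P + (\<Sum>i<m. P * expectation (Z i)))"
      using c(1) by (intro mult_left_mono add_mono c0 sum_mono cb) auto
    \<comment> \<open>The weights telescope to the exponential minus 1, so the leading
      \<open>P\<close> and the sum combine to \<open>P * x\<close>.\<close>
    also have "(\<Sum>i<m. P * expectation (Z i)) = P * expectation (\<lambda>\<omega>. \<Sum>i<m. Z i \<omega>)"
      using cb(3) by (simp add: sum_distrib_left Bochner_Integration.integral_sum)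
    also have "(\<lambda>\<omega>. \<Sum>i<m. Z i \<omega>) = (\<lambda>\<omega>. exp (c * occupation g T \<omega>) - 1)"
    proof
      show "(\<Sum>i<m. Z i \<omega>) = exp (c * occupation g T \<omega>) - 1" for \<omega>
        unfolding Z_def using sum_lessThan_telescope[of "\<lambda>i. exp (c * occupation g (t i) \<omega>)" m]
        by (simp add: tm occupation_0)
    qed
    finally show ?thesis
      using ei[of T] T unfolding x_def D_def m_def by (simp add: prob_space algebra_simps)
  qed
  have "(\<lambda>n. T * inverse (real (Suc n))) \<longlonglongrightarrow> T * 0" by (intro tendsto_intros LIMSEQ_inverse_real_of_nat)
  then have "(\<lambda>n. T / real (Suc n)) \<longlonglongrightarrow> 0" by (simp add: divide_inverse)
  then have "(\<lambda>n. c * exp (c * (C * (T / real (Suc n)))) * (P * x)) \<longlonglongrightarrow> c * exp (c * (C * 0)) * (P * x)"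
    by (intro tendsto_intros)
  then have "x - 1 \<le> c * exp (c * (C * 0)) * (P * x)"
    by (rule LIMSEQ_le_const) (use step in blast)
  then have "x * (1 - c * P) \<le> 1" by (simp add: algebra_simps)
  then show "expectation (\<lambda>\<omega>. exp (c * occupation g T \<omega>)) \<le> 1 / (1 - c * P)"
    using c(2) unfolding x_def[symmetric] by (simp add: pos_le_divide_eq)
qed

lemma green_mono: "(\<And>u. g u \<le> g' u) \<Longrightarrow> green g y \<le> green g' y"
  unfolding green_def by (intro nn_integral_mono mult_right_mono) auto

text \<open>\<open>J n\<close> truncates both the values of \<open>\<bar>f\<bar>\<close> and the
  time at \<open>n + 1\<close> and increases to the integral of \<open>\<bar>f\<bar>\<close> along
  the path. Its first moments are at most \<open>P\<close>, so that integral is almost surely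
  finite. This must be settled separately, since a Bochner integral of a non-integrable function is
  0 by default and a bound on it would be void.\<close>

lemma exponential_functional_bound:
  fixes f :: "real \<Rightarrow> real"
  assumes f: "f \<in> borel_measurable borel" and P: "\<And>y. green (\<lambda>u. ennreal \<bar>f u\<bar>) y \<le> ennreal P" "0 \<le> P"
    and c: "0 \<le> c" "c * P < 1"
  shows "AE \<omega> in M. set_integrable lborel {0..} (\<lambda>s. f (X s \<omega>))"
    "J_infinity f X \<in> borel_measurable M"
    "(\<integral>\<^sup>+\<omega>. ennreal (exp (c * J_infinity f X \<omega>)) \<partial>M) \<le> ennreal (1 / (1 - c * P))"
proof -
  define g where "g n u = min \<bar>f u\<bar> (real (Suc n))" for n u
  have g: "g n \<in> borel_measurable borel" "\<And>u. 0 \<le> g n u" "\<And>u. g n u \<le> real (Suc n)" for n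
    using f unfolding g_def[abs_def] by auto
  have gP: "green (\<lambda>u. ennreal (g n u)) y \<le> ennreal P" for n y
    by (rule order_trans[OF green_mono P(1)]) (auto simp: g_def intro: ennreal_leI)
  define J where "J n = occupation (g n) (real (Suc n))" for n
  have T: "0 < real (Suc n)" for n by simp
  have Jm [measurable]: "J n \<in> borel_measurable M" for n
    unfolding J_def by (rule measurable_F_M[OF occupation_measurable[OF g]]) simp
  define G where "G \<omega> = (\<integral>\<^sup>+u\<in>{0..}. ennreal \<bar>f (X u \<omega>)\<bar> \<partial>lborel)" for \<omega>
  have Jnn: "ennreal (J n \<omega>) = (\<integral>\<^sup>+u\<in>{0<..real (Suc n)}. ennreal (g n (X u \<omega>)) \<partial>lborel)" if "\<omega> \<in> space M" for n \<omega>
    unfolding J_def using occupation_nn[OF g that order_refl, of "real (Suc n)" n] by (simp add: occupation_0)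
  have J0: "0 \<le> J n \<omega>" for n \<omega>
    unfolding J_def occupation_def by (rule Bochner_Integration.integral_nonneg) (simp add: g)
  have Jmono: "J n \<omega> \<le> J (Suc n) \<omega>" if "\<omega> \<in> space M" for n \<omega>
  proof -
    have "ennreal (J n \<omega>) \<le> ennreal (J (Suc n) \<omega>)"
      unfolding Jnn[OF that] by (intro nn_integral_mono) (auto simp: g_def indicator_def intro!: ennreal_leI)
    then show ?thesis using J0 by (simp add: ennreal_le_iff)
  qed
  have JG: "(SUP n. ennreal (J n \<omega>)) = G \<omega>" if \<omega>: "\<omega> \<in> space M" for \<omega>
  proof -
    have "(SUP n. ennreal (J n \<omega>)) = (\<integral>\<^sup>+u. (SUP n. ennreal (g n (X u \<omega>)) * indicator {0<..real (Suc n)} u) \<partial>lborel)"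
      unfolding Jnn[OF \<omega>]
    proof (rule nn_integral_monotone_convergence_SUP[symmetric])
      show "incseq (\<lambda>n u. ennreal (g n (X u \<omega>)) * indicator {0<..real (Suc n)} u)"
        unfolding incseq_def le_fun_def by (auto simp: g_def indicator_def intro!: ennreal_leI)
      show "(\<lambda>u. ennreal (g n (X u \<omega>)) * indicator {0<..real (Suc n)} u) \<in> borel_measurable lborel" for n
      proof -
        have "{0<..real (Suc n)} \<subseteq> {0..}" by auto
        then have "(\<lambda>u. ennreal (indicator {0<..real (Suc n)} u * g n (X u \<omega>))) \<in> borel_measurable lborel"
          using path_measurable_on[OF \<omega> g(1), of "{0<..real (Suc n)}" n] by simp
        moreover have "ennreal (indicator {0<..real (Suc n)} u * g n (X u \<omega>)) = ennreal (g n (X u \<omega>)) * indicator {0<..real (Suc n)} u" for u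
          by (auto simp: indicator_def)
        ultimately show ?thesis by simp
      qed
    qed
    also have "\<dots> = (\<integral>\<^sup>+u. ennreal \<bar>f (X u \<omega>)\<bar> * indicator {0<..} u \<partial>lborel)"
    proof (rule nn_integral_cong)
      fix u :: real
      show "(SUP n. ennreal (g n (X u \<omega>)) * indicator {0<..real (Suc n)} u) = ennreal \<bar>f (X u \<omega>)\<bar> * indicator {0<..} u"
      proof (rule antisym)
        show "(SUP n. ennreal (g n (X u \<omega>)) * indicator {0<..real (Suc n)} u) \<le> ennreal \<bar>f (X u \<omega>)\<bar> * indicator {0<..} u"
          by (rule SUP_least) (auto simp: g_def indicator_def intro!: ennreal_leI)
        obtain n where n: "max u \<bar>f (X u \<omega>)\<bar> < real n" using reals_Archimedean2 by blast
        show "ennreal \<bar>f (X u \<omega>)\<bar> * indicator {0<..} u \<le> (SUP n. ennreal (g n (X u \<omega>)) * indicator {0<..real (Suc n)} u)"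
          by (rule SUP_upper2[of n]) (use n in \<open>auto simp: g_def indicator_def min_def\<close>)
      qed
    qed
    also have "\<dots> = G \<omega>"
      unfolding G_def
    proof (rule nn_integral_cong_AE)
      show "AE u in lborel. ennreal \<bar>f (X u \<omega>)\<bar> * indicator {0<..} u = ennreal \<bar>f (X u \<omega>)\<bar> * indicator {0..} u"
        using AE_lborel_singleton[of "0::real"] by (rule AE_mp) (intro AE_I2, auto simp: indicator_def)
    qed
    finally show ?thesis .
  qed
  have "(\<integral>\<^sup>+\<omega>. G \<omega> \<partial>M) = (\<integral>\<^sup>+\<omega>. (SUP n. ennreal (J n \<omega>)) \<partial>M)"
    by (rule nn_integral_cong) (simp add: JG)
  also have "\<dots> = (SUP n. \<integral>\<^sup>+\<omega>. ennreal (J n \<omega>) \<partial>M)"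
    by (rule nn_integral_monotone_convergence_SUP_AE) (use Jmono in \<open>auto intro!: AE_I2 ennreal_leI\<close>)
  also have "\<dots> \<le> ennreal P"
  proof (rule SUP_least)
    fix n
    have e: "integrable M (J n)" "expectation (J n) \<le> P"
      using occupation_conditional_bound(1)[OF g[of n] gP[of n] P(2) T[of n] zero_less_one le0, where Z = "\<lambda>_. 1" and B = 1]
        occupation_conditional_bound(2)[OF g[of n] gP[of n] P(2) T[of n] zero_less_one le0, where Z = "\<lambda>_. 1" and B = 1]
      by (simp_all add: occupation_0 prob_space J_def)
    then show "(\<integral>\<^sup>+\<omega>. ennreal (J n \<omega>) \<partial>M) \<le> ennreal P"
      using nn_integral_eq_integral[OF e(1)] J0 by (simp add: ennreal_leI)
  qed
  finally have EG: "(\<integral>\<^sup>+\<omega>. G \<omega> \<partial>M) \<le> ennreal P" .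
  have "G \<in> borel_measurable M \<longleftrightarrow> (\<lambda>\<omega>. SUP n. ennreal (J n \<omega>)) \<in> borel_measurable M"
    by (rule measurable_cong) (simp add: JG)
  then have "G \<in> borel_measurable M" by simp
  then have Gfin: "AE \<omega> in M. G \<omega> \<noteq> \<infinity>"
    by (rule nn_integral_PInf_AE) (use EG in \<open>auto simp: top_unique\<close>)
  have int: "set_integrable lborel {0..} (\<lambda>s. f (X s \<omega>))" if \<omega>: "\<omega> \<in> space M" "G \<omega> \<noteq> \<infinity>" for \<omega>
    unfolding set_integrable_def
  proof (rule integrableI_bounded)
    show "(\<lambda>s. indicator {0..} s *\<^sub>R f (X s \<omega>)) \<in> borel_measurable lborel"
      using path_measurable_on[OF \<omega>(1) f, of "{0..}"] by simp
    have "(\<integral>\<^sup>+s. ennreal (norm (indicator {0..} s *\<^sub>R f (X s \<omega>))) \<partial>lborel) = G \<omega>"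
      unfolding G_def by (rule nn_integral_cong) (auto simp: indicator_def)
    then show "(\<integral>\<^sup>+s. ennreal (norm (indicator {0..} s *\<^sub>R f (X s \<omega>))) \<partial>lborel) < \<infinity>" using \<omega>(2) by (simp add: less_top)
  qed
  show "AE \<omega> in M. set_integrable lborel {0..} (\<lambda>s. f (X s \<omega>))"
    using Gfin by (rule AE_mp) (use int in \<open>auto intro!: AE_I2\<close>)
  show "J_infinity f X \<in> borel_measurable M"
  proof -
    note X_joint_all[measurable] f[measurable]
    have "(\<lambda>p. indicator {0..} (snd p) * f (X (max 0 (snd p)) (fst p))) \<in> borel_measurable (M \<Otimes>\<^sub>M lborel)" by measurable
    then have "(\<lambda>\<omega>. \<integral>s. indicator {0..} s * f (X (max 0 s) \<omega>) \<partial>lborel) \<in> borel_measurable M"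
      by (intro sigma_finite_measure.borel_measurable_lebesgue_integral[OF sigma_finite_lborel]) (simp add: case_prod_beta')
    moreover have "indicator {0..} s * f (X (max 0 s) \<omega>) = indicator {0..} s * f (X s \<omega>)" for s \<omega>
      by (cases "0 \<le> s") (auto simp: max_def)
    ultimately show ?thesis
      unfolding J_infinity_def[abs_def] set_lebesgue_integral_def by simp
  qed
  \<comment> \<open>As \<open>f\<close> may change sign, \<open>J_infinity\<close> is only bounded
    above by the integral \<open>r\<close> of \<open>\<bar>f\<bar>\<close>. With
    \<open>c \<ge> 0\<close> this is the direction that the exponential needs.\<close>
  have le: "ennreal (exp (c * J_infinity f X \<omega>)) \<le> (SUP n. ennreal (exp (c * J n \<omega>)))" if \<omega>: "\<omega> \<in> space M" "G \<omega> \<noteq> \<infinity>" for \<omega>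
  proof -
    define r where "r = (\<integral>s. indicator {0..} s * \<bar>f (X s \<omega>)\<bar> \<partial>lborel)"
    have i1: "integrable lborel (\<lambda>s. indicator {0..} s * f (X s \<omega>))" using int[OF \<omega>] by (simp add: set_integrable_def)
    have "integrable lborel (\<lambda>s. \<bar>indicator {0..} s * f (X s \<omega>)\<bar>)" using i1 by (rule integrable_abs)
    then have i2: "integrable lborel (\<lambda>s. indicator {0..} s * \<bar>f (X s \<omega>)\<bar>)" by (simp add: abs_mult)
    have r0: "0 \<le> r" unfolding r_def by (rule Bochner_Integration.integral_nonneg) simp
    have "G \<omega> = (\<integral>\<^sup>+s. ennreal (indicator {0..} s * \<bar>f (X s \<omega>)\<bar>) \<partial>lborel)"
      unfolding G_def by (rule nn_integral_cong) (auto simp: indicator_def)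
    also have "\<dots> = ennreal r" unfolding r_def by (rule nn_integral_eq_integral[OF i2]) simp
    finally have Gr: "G \<omega> = ennreal r" .
    have "J_infinity f X \<omega> = (\<integral>s. indicator {0..} s * f (X s \<omega>) \<partial>lborel)" by (simp add: J_infinity_def set_lebesgue_integral_def)
    also have "\<dots> \<le> r" unfolding r_def by (rule integral_mono[OF i1 i2]) (auto intro: mult_left_mono)
    finally have Jr: "J_infinity f X \<omega> \<le> r" .
    have inc: "incseq (\<lambda>n. ennreal (J n \<omega>))" by (rule incseq_SucI) (intro ennreal_leI Jmono \<omega>)
    have "(\<lambda>n. ennreal (J n \<omega>)) \<longlonglongrightarrow> ennreal r" using LIMSEQ_SUP[OF inc] JG[OF \<omega>(1)] Gr by simp
    then have "(\<lambda>n. J n \<omega>) \<longlonglongrightarrow> r" using J0 r0 by (simp add: tendsto_ennreal_iff)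
    then have "(\<lambda>n. ennreal (exp (c * J n \<omega>))) \<longlonglongrightarrow> ennreal (exp (c * r))"
      by (intro tendsto_intros)
    moreover have "incseq (\<lambda>n. ennreal (exp (c * J n \<omega>)))"
      by (rule incseq_SucI) (use Jmono[OF \<omega>(1)] c in \<open>auto intro!: ennreal_leI mult_left_mono\<close>)
    ultimately have "(SUP n. ennreal (exp (c * J n \<omega>))) = ennreal (exp (c * r))"
      using LIMSEQ_SUP LIMSEQ_unique by blast
    moreover have "ennreal (exp (c * J_infinity f X \<omega>)) \<le> ennreal (exp (c * r))"
      using Jr c by (intro ennreal_leI) (simp add: mult_left_mono)
    ultimately show ?thesis by simp
  qed
  have "(\<integral>\<^sup>+\<omega>. ennreal (exp (c * J_infinity f X \<omega>)) \<partial>M) \<le> (\<integral>\<^sup>+\<omega>. (SUP n. ennreal (exp (c * J n \<omega>))) \<partial>M)"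
    by (rule nn_integral_mono_AE, rule AE_mp[OF Gfin]) (use le in \<open>auto intro!: AE_I2\<close>)
  also have "\<dots> = (SUP n. \<integral>\<^sup>+\<omega>. ennreal (exp (c * J n \<omega>)) \<partial>M)"
    by (rule nn_integral_monotone_convergence_SUP_AE) (use Jmono c in \<open>auto intro!: AE_I2 ennreal_leI mult_left_mono\<close>)
  also have "\<dots> \<le> ennreal (1 / (1 - c * P))"
  proof (rule SUP_least)
    fix n
    show "(\<integral>\<^sup>+\<omega>. ennreal (exp (c * J n \<omega>)) \<partial>M) \<le> ennreal (1 / (1 - c * P))"
      using exponential_moment_bound[OF g gP P(2) T c, of n n]
      by (subst nn_integral_eq_integral) (auto simp: J_def intro: ennreal_leI)
  qed
  finally show "(\<integral>\<^sup>+\<omega>. ennreal (exp (c * J_infinity f X \<omega>)) \<partial>M) \<le> ennreal (1 / (1 - c * P))" .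
qed

end

section \<open>From an almost surely continuous solution to the regular setting\<close>

theorem theorem6:
  fixes M :: "'w measure" and F :: "real \<Rightarrow> 'w measure"
    and W :: "real \<Rightarrow> 'w \<Rightarrow> real" and X :: "real \<Rightarrow> real \<Rightarrow> 'w \<Rightarrow> real"
    and a b f :: "real \<Rightarrow> real" and x c :: real
  assumes "complete_filtered_prob_space M F"
    and "wiener_process M F W"
    and "continuous_on UNIV a" and "continuous_on UNIV b" and "\<And>y. a y \<noteq> 0"
    and "\<And>y. sde_solution M F W a b y (X y)"
    and "Phi_top a b 0 < \<infinity>" and "Phi_bot a b 0 = -\<infinity>"
    and "f \<in> borel_measurable borel"
    and "locally_integrable f" and "locally_integrable (\<lambda>u. f u / (a u)\<^sup>2)"
    and "P0 a b f < \<infinity>"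
    and "0 \<le> c" and "ennreal c < inverse (P0 a b f)"
  shows "(AE \<omega> in M. set_integrable lborel {0..} (\<lambda>s. f (X x s \<omega>))) \<and>
         integrable M (\<lambda>\<omega>. exp (c * J_infinity f (X x) \<omega>)) \<and>
         (\<integral>\<omega>. exp (c * J_infinity f (X x) \<omega>) \<partial>M) \<le> 1 / (1 - c * enn2real (P0 a b f))"
proof -
  interpret complete_filtered_prob_space M F by fact
  interpret transient_coefficients a b
    by unfold_locales (use assms in auto)
  define P where "P = enn2real (P0 a b f)"
  have P: "P0 a b f = ennreal P" "0 \<le> P" using assms(12) by (simp_all add: P_def less_top)
  \<comment> \<open>For \<open>P = 0\<close> the inverse in the hypothesis is infinite and the claim
    is immediate; otherwise the inverse is that of a positive real.\<close>
  have cP: "c * P < 1"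
  proof (cases "P = 0")
    case False
    then have "ennreal c < ennreal (inverse P)" using assms(14) P by (simp add: inverse_ennreal)
    then have "c < inverse P" using assms(13) by (simp add: ennreal_less_iff)
    then show ?thesis using P(2) False by (simp add: field_simps)
  qed simp
  note sol = assms(6)[of x, unfolded sde_solution_def]
  then obtain I where I: "is_ito_integral M F W (\<lambda>s \<omega>. a (X x s \<omega>)) I"
    "AE \<omega> in M. \<forall>t\<ge>0. set_integrable lborel {0..t} (\<lambda>s. b (X x s \<omega>)) \<and>
             X x t \<omega> = x + (\<integral>s\<in>{0..t}. b (X x s \<omega>) \<partial>lborel) + I t \<omega>" by blast
  have ad: "X x t \<in> borel_measurable (F t)" if "0 \<le> t" for t
    using sol[THEN conjunct1] that unfolding adapted_def by blast
  have "AE \<omega> in M. continuous_on {0..} (\<lambda>t. X x t \<omega>)"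
    using sol[THEN conjunct2, THEN conjunct1] unfolding continuous_paths_def .
  then obtain N where N: "N \<in> null_sets M" "\<And>\<omega>. \<omega> \<in> space M - N \<Longrightarrow> continuous_on {0..} (\<lambda>t. X x t \<omega>)"
    by (elim AE_E3) blast
  txt \<open>\<open>Y\<close> is \<open>X\<close> changed on a null set, so that every path is continuous; the completeness of the
    filtration keeps it adapted.\<close>
  define Y where "Y t \<omega> = (if \<omega> \<in> N then x else X x t \<omega>)" for t \<omega>
  have NF: "N \<in> sets (F t)" if "0 \<le> t" for t
    using N(1) null_sets_F sets_F_mono[OF that] by blast
  have YX: "AE \<omega> in M. \<forall>t. Y t \<omega> = X x t \<omega>"
    using AE_not_in[OF N(1)] by (rule AE_mp) (auto simp: Y_def intro!: AE_I2)
  \<comment> \<open>The integrand slot receives \<open>a\<close> along the original solution, for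
    which \<open>I\<close> is the given integral. The modified process \<open>Y\<close> enters only
    through almost sure equalities, so the integral need not be constructed again.\<close>
  interpret transient_diffusion M F W a b Y "\<lambda>s \<omega>. a (X x s \<omega>)" I x
  proof unfold_locales
    show "wiener_process M F W" by fact
    show "Y t \<in> borel_measurable (F t)" if "0 \<le> t" for t
      unfolding Y_def[abs_def]
      by (rule measurable_If_set[OF _ ad[OF that]]) (use NF[OF that] in auto)
    show "continuous_on {0..} (\<lambda>t. Y t \<omega>)" if "\<omega> \<in> space M" for \<omega>
      using N(2)[of \<omega>] that by (cases "\<omega> \<in> N") (auto simp: Y_def)
    show "is_ito_integral M F W (\<lambda>s \<omega>. a (X x s \<omega>)) I" by fact
    show "AE \<omega> in M. \<forall>s\<ge>0. a (X x s \<omega>) = a (Y s \<omega>)"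
      using YX by (rule AE_mp) (auto intro!: AE_I2)
    show "AE \<omega> in M. \<forall>t\<ge>0. Y t \<omega> = x + (\<integral>s\<in>{0..t}. b (Y s \<omega>) \<partial>lborel) + I t \<omega>"
      using AE_conjI[OF YX I(2)] by (rule AE_mp) (auto intro!: AE_I2)
  qed fact+
  have gP: "green (\<lambda>u. ennreal \<bar>f u\<bar>) y \<le> ennreal P" for y
    using green_le_P0[OF assms(9), of y] P by simp
  note bound = exponential_functional_bound[OF assms(9) gP P(2) assms(13) cP]
  have AEint: "AE \<omega> in M. set_integrable lborel {0..} (\<lambda>s. f (X x s \<omega>))"
    using AE_conjI[OF YX bound(1)] by (rule AE_mp) (auto intro!: AE_I2)
  have Jeq: "AE \<omega> in M. J_infinity f Y \<omega> = J_infinity f (X x) \<omega>"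
    using YX by (rule AE_mp) (auto intro!: AE_I2 simp: J_infinity_def)
  \<comment> \<open>The exponential along the original solution agrees with a measurable function
    off a null set only; completeness of the probability space makes it measurable, which its
    Bochner integral requires.\<close>
  interpret complete_measure M
    by unfold_locales (use complete_M in blast)
  define h where "h \<omega> = exp (c * J_infinity f (X x) \<omega>)" for \<omega>
  have hY: "AE \<omega> in M. exp (c * J_infinity f Y \<omega>) = h \<omega>"
    using Jeq by (rule AE_mp) (auto intro!: AE_I2 simp: h_def)
  have hm: "h \<in> borel_measurable M"
  proof (rule measurableI)
    fix A :: "real set" assume A: "A \<in> sets borel"
    have "(\<lambda>\<omega>. exp (c * J_infinity f Y \<omega>)) \<in> borel_measurable M" using bound(2) by measurable
    then have "(\<lambda>\<omega>. exp (c * J_infinity f Y \<omega>)) -` A \<inter> space M \<in> sets M" using A by (rule measurable_sets)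
    then show "h -` A \<inter> space M \<in> sets M"
      by (rule in_sets_AE[rotated]) (use hY in \<open>auto elim!: eventually_mono\<close>)
  qed simp
  have "(\<integral>\<^sup>+\<omega>. ennreal (h \<omega>) \<partial>M) = (\<integral>\<^sup>+\<omega>. ennreal (exp (c * J_infinity f Y \<omega>)) \<partial>M)"
    by (rule nn_integral_cong_AE) (use hY in \<open>auto elim!: eventually_mono\<close>)
  then have nn: "(\<integral>\<^sup>+\<omega>. ennreal (h \<omega>) \<partial>M) \<le> ennreal (1 / (1 - c * P))" using bound(3) by simp
  have h0: "0 \<le> h \<omega>" for \<omega> by (simp add: h_def)
  have hi: "integrable M h"
  proof (rule integrableI_bounded[OF hm])
    show "(\<integral>\<^sup>+\<omega>. ennreal (norm (h \<omega>)) \<partial>M) < \<infinity>"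
      using nn h0 by (simp add: le_less_trans)
  qed
  have "ennreal (\<integral>\<omega>. h \<omega> \<partial>M) \<le> ennreal (1 / (1 - c * P))"
    using nn nn_integral_eq_integral[OF hi] h0 by simp
  then have "(\<integral>\<omega>. h \<omega> \<partial>M) \<le> 1 / (1 - c * P)"
    using cP by (subst (asm) ennreal_le_iff) auto
  then show ?thesis using AEint hi unfolding h_def[abs_def] P_def by blast
qed

end
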